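(* Let $0<\mu,\nu,\lambda<\infty$. For any sequence $\{\omega_n\}$ satisfying $\omega_n\in K_{\mu_n,\nu}$, $\mu_n\to\mu$ and $-E_{2,\lambda}[\omega_n]\to I_{\mu,\nu,\lambda}$ as $n\to\infty$, there exists a sequence $\{y_n\}\subset\partial\mathbb{R}^2_+$ such that $\{\omega_n(\cdot+y_n)\}$ is relatively compact in $L^2(\mathbb{R}^2_+)$ and $\{x_2\omega_n(\cdot+y_n)\}$ is relatively compact in $L^1(\mathbb{R}^2_+)$. In particular, there exists $\omega\in K_{\mu,\nu}$ with $-E_{2,\lambda}[\omega]=I_{\mu,\nu,\lambda}$.
   Context: $\mathbb{R}^2_+=\{x=(x_1,x_2)\in\mathbb{R}^2 : x_2>0\}$, $\partial\mathbb{R}^2_+=\{(y_1,0): y_1\in\mathbb{R}\}$. Let $$G(x,y)=\frac{1}{4\pi}\log\left(1+\frac{4x_2y_2}{|x-y|^2}\right),\quad x,y\in\mathbb{R}^2_+,$$ $$E[\omega]=\frac12\int_{\mathbb{R}^2_+}\int_{\mathbb{R}^2_+}G(x,y)\omega(x)\omega(y)\,dx\,dy,\qquad E_{2,\lambda}[\omega]=E[\omega]-\frac{1}{2\lambda}\int_{\mathbb{R}^2_+}\omega^2\,dx,$$ $$K_{\mu,\nu}=\left\{\omega\in L^2(\mathbb{R}^2_+) : \omega\ge0,\ \int_{\mathbb{R}^2_+}x_2\omega\,dx=\mu,\ \int_{\mathbb{R}^2_+}\omega\,dx\le\nu\right\},\qquad I_{\mu,\nu,\lambda}=\inf_{\omega\in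 K_{\mu,\nu}}\{-E_{2,\lambda}[\omega]\}.$$ *)

theory Defs
  imports "HOL-Analysis.Analysis"
begin

definition halfplane :: "(real \<times> real) set" where
  "halfplane = {x. snd x > 0}"

definition halfplane_boundary :: "(real \<times> real) set" where
  "halfplane_boundary = {y. snd y = 0}"

text \<open>Lebesgue measure on the half plane. Functions on the half plane are total functions
  on the plane; nothing below depends on their values outside \<^term>\<open>halfplane\<close>.\<close>

abbreviation halfplane_measure :: "(real \<times> real) measure" where
  "halfplane_measure \<equiv> lebesgue_on halfplane"

subsection \<open>The spaces \<open>L\<^sup>p\<close>\<close>

definition Lp :: "real \<Rightarrow> 'a measure \<Rightarrow> ('a \<Rightarrow> real) set" where
  "Lp p M = {f \<in> borel_measurable M. integrable M (\<lambda>x. \<bar>f x\<bar> powr p)}"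

definition Lp_norm :: "real \<Rightarrow> 'a measure \<Rightarrow> ('a \<Rightarrow> real) \<Rightarrow> real" where
  "Lp_norm p M f = (\<integral>x. \<bar>f x\<bar> powr p \<partial>M) powr (1 / p)"

text \<open>The norm topology of \<open>L\<^sup>p\<close>, on functions rather than on classes of functions that agree
  almost everywhere. It is induced by a pseudometric whose metric quotient is the usual space;
  every closed set is a union of classes, so a set has compact closure here iff the set of its
  classes has compact closure in the quotient.\<close>

definition Lp_topology :: "real \<Rightarrow> 'a measure \<Rightarrow> ('a \<Rightarrow> real) topology" where
  "Lp_topology p M = topology (\<lambda>U. U \<subseteq> Lp p M \<and>
     (\<forall>f\<in>U. \<exists>e>0. \<forall>g\<in>Lp p M. Lp_norm p M (\<lambda>x. g x - f x) < e \<longrightarrow> g \<in> U))"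

lemma openin_Lp_topology:
  "openin (Lp_topology p M) U \<longleftrightarrow> U \<subseteq> Lp p M \<and>
     (\<forall>f\<in>U. \<exists>e>0. \<forall>g\<in>Lp p M. Lp_norm p M (\<lambda>x. g x - f x) < e \<longrightarrow> g \<in> U)"
proof -
  let ?P = "\<lambda>U. U \<subseteq> Lp p M \<and>
     (\<forall>f\<in>U. \<exists>e>0. \<forall>g\<in>Lp p M. Lp_norm p M (\<lambda>x. g x - f x) < e \<longrightarrow> g \<in> U)"
  have "istopology ?P"
    unfolding istopology_def
  proof (intro conjI allI impI)
    fix S T assume S: "?P S" and T: "?P T"
    show "S \<inter> T \<subseteq> Lp p M" using S by blast
    show "\<forall>f\<in>S \<inter> T. \<exists>e>0. \<forall>g\<in>Lp p M. Lp_norm p M (\<lambda>x. g x - f x) < e \<longrightarrow> g \<in> S \<inter> T"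
    proof
      fix f assume f: "f \<in> S \<inter> T"
      obtain d where d: "d > 0" "\<forall>g\<in>Lp p M. Lp_norm p M (\<lambda>x. g x - f x) < d \<longrightarrow> g \<in> S"
        using S f by blast
      obtain e where e: "e > 0" "\<forall>g\<in>Lp p M. Lp_norm p M (\<lambda>x. g x - f x) < e \<longrightarrow> g \<in> T"
        using T f by blast
      show "\<exists>e>0. \<forall>g\<in>Lp p M. Lp_norm p M (\<lambda>x. g x - f x) < e \<longrightarrow> g \<in> S \<inter> T"
        by (rule exI[of _ "min d e"]) (use d e in auto)
    qed
  next
    fix \<K> assume K: "\<forall>U\<in>\<K>. ?P U"
    show "\<Union>\<K> \<subseteq> Lp p M" using K by blast
    show "\<forall>f\<in>\<Union>\<K>. \<exists>e>0. \<forall>g\<in>Lp p M. Lp_norm p M (\<lambda>x. g x - f x) < e \<longrightarrow> g \<in> \<Union>\<K>"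
      using K by (meson UnionE UnionI)
  qed
  then show ?thesis
    by (simp add: Lp_topology_def topology_inverse')
qed

lemma topspace_Lp_topology [simp]: "topspace (Lp_topology p M) = Lp p M"
proof
  show "topspace (Lp_topology p M) \<subseteq> Lp p M"
    using openin_Lp_topology[of p M] openin_topspace by blast
  have "openin (Lp_topology p M) (Lp p M)"
    unfolding openin_Lp_topology by (auto intro: exI[of _ "1::real"])
  then show "Lp p M \<subseteq> topspace (Lp_topology p M)"
    by (rule openin_subset)
qed

definition relatively_compactin :: "'a topology \<Rightarrow> 'a set \<Rightarrow> bool" where
  "relatively_compactin X S \<longleftrightarrow> S \<subseteq> topspace X \<and> compactin X (X closure_of S)"

subsection \<open>The variational problem\<close>

text \<open>On the diagonal the value is \<^term>\<open>0::real\<close> because of division by zero; for fixed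
  \<open>y\<close> this affects a null set only.\<close>

definition green :: "real \<times> real \<Rightarrow> real \<times> real \<Rightarrow> real" where
  "green x y = 1 / (4 * pi) * ln (1 + 4 * snd x * snd y / (dist x y)\<^sup>2)"

text \<open>The integrals are Bochner integrals, which default to \<open>0\<close> if they diverge. The energies
  are only evaluated on \<open>admissible\<close> functions, which lie in \<open>L\<^sup>1 \<inter> L\<^sup>2\<close> with finite first moment;
  there the integrals converge. In \<open>admissible\<close> itself integrability is stated explicitly.\<close>

definition energy :: "(real \<times> real \<Rightarrow> real) \<Rightarrow> real" where
  "energy \<omega> = 1 / 2 * (\<integral>y. (\<integral>x. green x y * \<omega> x * \<omega> y \<partial>halfplane_measure) \<partial>halfplane_measure)"

definition penalized_energy :: "real \<Rightarrow> (real \<times> real \<Rightarrow> real) \<Rightarrow> real" where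
  "penalized_energy l \<omega> = energy \<omega> - 1 / (2 * l) * (\<integral>x. (\<omega> x)\<^sup>2 \<partial>halfplane_measure)"

definition admissible :: "real \<Rightarrow> real \<Rightarrow> (real \<times> real \<Rightarrow> real) set" where
  "admissible \<mu> \<nu> = {\<omega> \<in> Lp 2 halfplane_measure.
     (AE x in halfplane_measure. 0 \<le> \<omega> x) \<and>
     integrable halfplane_measure (\<lambda>x. snd x * \<omega> x) \<and>
     (\<integral>x. snd x * \<omega> x \<partial>halfplane_measure) = \<mu> \<and>
     integrable halfplane_measure \<omega> \<and>
     (\<integral>x. \<omega> x \<partial>halfplane_measure) \<le> \<nu>}"

text \<open>Taken in the extended reals, so that the infimum is meaningful without a prior proof that
  the functional is bounded below.\<close>

definition min_value :: "real \<Rightarrow> real \<Rightarrow> real \<Rightarrow> ereal" where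
  "min_value \<mu> \<nu> l = (INF \<omega>\<in>admissible \<mu> \<nu>. ereal (- penalized_energy l \<omega>))"

end

theory Submission
  imports Defs "HOL-Complex_Analysis.Great_Picard"
begin

text \<open>The Green function satisfies \<open>G(x,y) \<le> t\<^sup>2\<close>, \<open>G(x,y) \<le> t\<close> and \<open>G(x,y)\<^sup>2 \<le> t\<close> for
  \<open>t = sqrt (x\<^sub>2 y\<^sub>2) / \<bar>x - y\<bar>\<close>. So, uniformly on sets of bounded mass, impulse and enstrophy, the
  energy is carried by a bounded kernel supported at bounded heights and distances. This makes the
  energy weakly continuous on strips, and shows that a maximizing sequence cannot vanish: after
  horizontal translations it has a nonzero weak limit \<open>w\<close>.

  Suppose that a tail escaping horizontally keeps a positive amount of energy. Far apart, the two
  parts do not interact, so \<open>w\<close> maximizes the energy under its own constraints. Then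
  \<open>G w > w / l\<close> almost everywhere: lowering \<open>w\<close> where this fails costs only second order and
  releases impulse, which an upward shift turns into a first-order gain. Hence adding the tail,
  translated so that it has a nonzero weak limit \<open>v\<close>, on top of \<open>w\<close> gains at least
  \<open>\<integral> (G w - w / l) v > 0\<close>, which is impossible. So the tail carries no energy, \<open>w\<close> is a maximizer, and
  the norms converge.\<close>

section \<open>Weak sequential compactness in Hilbert spaces\<close>

text \<open>A sequence can lose compactness in three ways. Spreading out is impossible because the
  truncated kernel sees only the mass in a slab of fixed size, so positive energy forces some slab
  to hold a fixed mass. Escape upward can carry off impulse, since mass \<open>1 / h\<close> at
  height \<open>h\<close> has impulse one, but no energy. It is ruled out because a vertical shift
  strictly raises the energy: under the relaxed constraint impulse \<le> \<mu> the value stays below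
  the supremum unless equality holds, so a maximizing weak limit has lost no impulse. Mass is only
  bounded by \<nu> and may still get lost; this is why the second convergence carries the weight x2.
  Horizontal splitting is the hard case. Instead of proving strict subadditivity of the infimum,
  both pieces are put on top of each other. Their masses and impulses satisfy the original
  constraints up to a factor tending to 1, and such a factor costs little because the functional is
  quadratic. The only loss is the cross term of the enstrophies, and the Euler-Lagrange inequality
  says exactly that the interaction outweighs it.\<close>

lemma Hilbert_projection:
  fixes V :: "'a::{real_inner,complete_space} set"
  assumes V: "subspace V" "closed V"
  obtains v where "v \<in> V" "\<And>w. w \<in> V \<Longrightarrow> inner (x - v) w = 0"
proof -
  define d where "d = (INF v\<in>V. (norm (x - v))\<^sup>2)"
  have ne: "V \<noteq> {}" using V(1) subspace_0 by blast
  have bdd: "bdd_below ((\<lambda>v. (norm (x - v))\<^sup>2) ` V)"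
    by (rule bdd_belowI[of _ 0]) auto
  have d_le: "d \<le> (norm (x - v))\<^sup>2" if "v \<in> V" for v
    unfolding d_def by (rule cINF_lower[OF bdd that])
  have "\<exists>v\<in>V. (norm (x - v))\<^sup>2 < d + inverse (real (Suc n))" for n
  proof -
    have "(INF v\<in>V. (norm (x - v))\<^sup>2) < d + inverse (real (Suc n))"
      unfolding d_def by simp
    then show ?thesis
      using cINF_less_iff[OF ne bdd] by blast
  qed
  then obtain v where vV: "\<And>n. v n \<in> V"
    and v: "\<And>n. (norm (x - v n))\<^sup>2 < d + inverse (real (Suc n))"
    by metis
  \<comment> \<open>Parallelogram identity: the midpoint of \<open>v m\<close> and
    \<open>v n\<close> lies in \<open>V\<close>, so its squared distance to \<open>x\<close> is at
    least \<open>d\<close>, and what remains bounds the difference.\<close>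
  have par: "(norm (v m - v n))\<^sup>2 \<le> 2 * inverse (real (Suc m)) + 2 * inverse (real (Suc n))" for m n
  proof -
    have "(norm (v m - v n))\<^sup>2 + 4 * (norm (x - (1/2) *\<^sub>R (v m + v n)))\<^sup>2
      = 2 * (norm (x - v m))\<^sup>2 + 2 * (norm (x - v n))\<^sup>2"
      by (simp add: power2_norm_eq_inner algebra_simps inner_commute)
    moreover have "(1/2) *\<^sub>R (v m + v n) \<in> V"
      using V(1) vV by (simp add: subspace_add subspace_scale)
    ultimately show ?thesis using d_le[of "(1/2) *\<^sub>R (v m + v n)"] v[of m] v[of n] by linarith
  qed
  have "Cauchy v"
  proof (rule metric_CauchyI)
    fix e :: real assume e: "e > 0"
    obtain N where N: "inverse (real (Suc N)) < e\<^sup>2 / 4"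
      using e reals_Archimedean[of "e\<^sup>2 / 4"] by auto
    have "dist (v m) (v n) < e" if "m \<ge> N" "n \<ge> N" for m n
    proof -
      have *: "inverse (real (Suc k)) \<le> inverse (real (Suc N))" if "k \<ge> N" for k
        using that by (intro le_imp_inverse_le) auto
      have "(norm (v m - v n))\<^sup>2 < e\<^sup>2"
        using par[of m n] *[OF that(1)] *[OF that(2)] N by linarith
      then show ?thesis
        using e by (simp add: dist_norm power2_less_imp_less)
    qed
    then show "\<exists>M. \<forall>m\<ge>M. \<forall>n\<ge>M. dist (v m) (v n) < e" by blast
  qed
  then obtain u where u: "v \<longlonglongrightarrow> u"
    using Cauchy_convergent_iff convergent_def by blast
  have uV: "u \<in> V"
    using closed_sequentially[OF V(2)] vV u by blast
  have "(\<lambda>n. (norm (x - v n))\<^sup>2) \<longlonglongrightarrow> (norm (x - u))\<^sup>2"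
    by (intro tendsto_intros u)
  moreover have "(\<lambda>n. d + inverse (real (Suc n))) \<longlonglongrightarrow> d + 0"
    by (intro tendsto_intros LIMSEQ_inverse_real_of_nat)
  ultimately have ud: "(norm (x - u))\<^sup>2 \<le> d"
    using v by (intro LIMSEQ_le[of _ _ _ d]) (auto intro: less_imp_le)
  have "inner (x - u) w = 0" if w: "w \<in> V" for w
  proof (rule ccontr)
    assume nz: "inner (x - u) w \<noteq> 0"
    then have w0: "inner w w > 0" by (metis inner_gt_zero_iff inner_zero_right)
    \<comment> \<open>The minimizer over t of the squared distance from \<open>x\<close> to
      \<open>u + t *\<^sub>R w\<close>; unless the inner product vanishes, it improves on
      \<open>u\<close>.\<close>
    define t where "t = inner (x - u) w / inner w w"
    have "u + t *\<^sub>R w \<in> V"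
      using V(1) uV w by (simp add: subspace_add subspace_scale)
    then have "(norm (x - u))\<^sup>2 \<le> (norm (x - (u + t *\<^sub>R w)))\<^sup>2"
      by (rule order_trans[OF ud d_le])
    also have "\<dots> = (norm (x - u))\<^sup>2 - 2 * t * inner (x - u) w + t * t * inner w w"
      by (simp add: power2_norm_eq_inner algebra_simps inner_commute)
    finally have "2 * t * inner (x - u) w \<le> t * t * inner w w" by simp
    then have "2 * (inner (x - u) w)\<^sup>2 / inner w w \<le> (inner (x - u) w)\<^sup>2 / inner w w"
      using w0 by (simp add: t_def power2_eq_square)
    then show False using w0 nz by (simp add: divide_le_cancel)
  qed
  then show thesis using that uV by blast
qed

text \<open>The kernel of \<open>L\<close> is a closed subspace of codimension one. The part
  \<open>u\<close> of some \<open>z\<close> outside it that is orthogonal to it represents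
  \<open>L\<close> up to a scalar, because every \<open>x\<close> is a multiple of \<open>u\<close>
  plus an element of the kernel.\<close>

lemma Riesz_representation:
  fixes L :: "'a::{real_inner,complete_space} \<Rightarrow> real"
  assumes L: "bounded_linear L"
  shows "\<exists>g. \<forall>x. L x = inner g x"
proof (cases "\<forall>x. L x = 0")
  case True
  then show ?thesis by (intro exI[of _ 0]) simp
next
  case False
  then obtain z where z: "L z \<noteq> 0" by blast
  interpret L: bounded_linear L by fact
  define V where "V = {x. L x = 0}"
  have "subspace V"
    unfolding V_def subspace_def by (simp add: L.add L.scaleR L.zero)
  moreover have "closed V"
    unfolding V_def by (intro closed_Collect_eq L.continuous_on continuous_on_id continuous_on_const)
  ultimately obtain v where v: "v \<in> V" "\<And>w. w \<in> V \<Longrightarrow> inner (z - v) w = 0"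
    using Hilbert_projection[of V z] by blast
  define u where "u = z - v"
  have Lu: "L u = L z" using v(1) by (simp add: u_def L.diff V_def)
  have u0: "inner u u \<noteq> 0" using Lu z L.zero by auto
  have "L x = inner ((L u / inner u u) *\<^sub>R u) x" for x
  proof -
    have "x - (L x / L u) *\<^sub>R u \<in> V"
      using z Lu by (simp add: V_def L.diff L.scaleR)
    then have "inner u (x - (L x / L u) *\<^sub>R u) = 0" using v(2) u_def by blast
    then have "inner u x = (L x / L u) * inner u u" by (simp add: inner_diff_right)
    then show ?thesis using u0 Lu z by (simp add: field_simps)
  qed
  then show ?thesis by blast
qed

lemma subspace_closure:
  fixes S :: "'a::real_normed_vector set"
  assumes "subspace S"
  shows "subspace (closure S)"
  unfolding subspace_def
proof (intro conjI ballI allI)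
  show "0 \<in> closure S" using assms subspace_0 closure_subset by blast
next
  fix x y assume "x \<in> closure S" "y \<in> closure S"
  then obtain u v where "\<And>n. u n \<in> S" "u \<longlonglongrightarrow> x" "\<And>n. v n \<in> S" "v \<longlonglongrightarrow> y"
    unfolding closure_sequential by blast
  then have "\<forall>n. u n + v n \<in> S" "(\<lambda>n. u n + v n) \<longlonglongrightarrow> x + y"
    using assms by (auto intro: subspace_add tendsto_add)
  then show "x + y \<in> closure S"
    unfolding closure_sequential by (intro exI[of _ "\<lambda>n. u n + v n"] conjI)
next
  fix x and c :: real assume "x \<in> closure S"
  then obtain u where "\<And>n. u n \<in> S" "u \<longlonglongrightarrow> x"
    unfolding closure_sequential by blast
  then have "\<forall>n. c *\<^sub>R u n \<in> S" "(\<lambda>n. c *\<^sub>R u n) \<longlonglongrightarrow> c *\<^sub>R x"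
    using assms by (auto intro: subspace_scale tendsto_scaleR)
  then show "c *\<^sub>R x \<in> closure S"
    unfolding closure_sequential by (intro exI[of _ "\<lambda>n. c *\<^sub>R u n"] conjI)
qed

text \<open>A diagonal argument gives convergence against the countably many vectors
  \<open>f n\<close> themselves. The vectors against which the subsequence converges form a closed
  subspace \<open>W\<close>, which therefore contains the closed span \<open>V\<close> of the
  sequence; orthogonally to \<open>V\<close> all inner products are zero. Testing against the
  sequence itself takes the place of a countable dense set. The limit functional is bounded by
  \<open>B\<close> and is represented by Riesz.\<close>

theorem Hilbert_weakly_convergent_subsequence:
  fixes f :: "nat \<Rightarrow> 'a::{real_inner,complete_space}"
  assumes B: "\<And>n. norm (f n) \<le> B"
  shows "\<exists>r g. strict_mono r \<and> (\<forall>x. (\<lambda>n. inner (f (r n)) x) \<longlonglongrightarrow> inner g x)"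
proof -
  have B0: "B \<ge> 0" by (rule order_trans[OF norm_ge_zero B])
  have bnd: "norm (inner (f n) x) \<le> B * norm x" for n x
    using Cauchy_Schwarz_ineq2[of "f n" x] mult_right_mono[OF B[of n] norm_ge_zero[of x]] by simp
  have bnd': "norm (inner (f n) x) \<le> B * B" if x: "x \<in> range f" for n x
  proof -
    have "norm x \<le> B" using x B by blast
    then show ?thesis by (rule order_trans[OF bnd mult_left_mono[OF _ B0]])
  qed
  obtain r where r: "strict_mono (r :: nat \<Rightarrow> nat)"
    and conv: "\<And>x. x \<in> range f \<Longrightarrow> \<exists>l. (\<lambda>n. inner (f (r n)) x) \<longlonglongrightarrow> l"
  proof (rule function_convergent_subsequence[of "range f" "\<lambda>n x. inner (f n) x" "B * B"])
    show "countable (range f)" by simp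
    show "norm (inner (f n) x) \<le> B * B" if "x \<in> range f" for n x by (rule bnd'[OF that])
  qed blast
  define W where "W = {x. convergent (\<lambda>n. inner (f (r n)) x)}"
  have subW: "subspace W"
    unfolding W_def subspace_def
    by (auto simp: inner_add_right intro: convergent_add convergent_mult convergent_const)
  have "closed W"
  proof -
    have "x \<in> W" if x: "x \<in> closure W" for x
    proof -
      have "Cauchy (\<lambda>n. inner (f (r n)) x)"
      proof (rule metric_CauchyI)
        fix e :: real assume e: "e > 0"
        obtain y where y: "y \<in> W" "dist y x < e / (4 * (B + 1))"
          using x e B0 by (metis closure_approachable divide_pos_pos mult_pos_pos zero_less_numeral
              add_nonneg_pos zero_less_one)
        have "Cauchy (\<lambda>n. inner (f (r n)) y)"
          using y(1) convergent_Cauchy unfolding W_def by blast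
        then obtain M where M: "\<And>m n. m \<ge> M \<Longrightarrow> n \<ge> M \<Longrightarrow>
            dist (inner (f (r m)) y) (inner (f (r n)) y) < e / 2"
          using e by (meson half_gt_zero metric_CauchyD)
        have *: "\<bar>inner (f n) x - inner (f n) y\<bar> \<le> e / 4" for n
        proof -
          have "\<bar>inner (f n) x - inner (f n) y\<bar> \<le> B * norm (x - y)"
            using bnd[of n "x - y"] by (simp add: inner_diff_right)
          also have "\<dots> \<le> (B + 1) * (e / (4 * (B + 1)))"
            using y(2) B0 by (intro mult_mono) (auto simp: dist_norm norm_minus_commute)
          also have "\<dots> = e / 4" using B0 by (simp add: field_simps)
          finally show ?thesis .
        qed
        have "dist (inner (f (r m)) x) (inner (f (r n)) x) < e" if "m \<ge> M" "n \<ge> M" for m n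
          using M[OF that] *[of "r m"] *[of "r n"] unfolding dist_real_def by linarith
        then show "\<exists>M. \<forall>m\<ge>M. \<forall>n\<ge>M. dist (inner (f (r m)) x) (inner (f (r n)) x) < e" by blast
      qed
      then show ?thesis unfolding W_def using Cauchy_convergent_iff by blast
    qed
    then show ?thesis using closure_subset_eq by blast
  qed
  define V where "V = closure (span (range f))"
  have "range f \<subseteq> W" using conv unfolding W_def convergent_def by blast
  then have VW: "V \<subseteq> W"
    unfolding V_def using subW \<open>closed W\<close> by (intro closure_minimal span_minimal)
  have V: "subspace V" "closed V" unfolding V_def
    by (rule subspace_closure[OF subspace_span], rule closed_closure)
  have fV: "f n \<in> V" for n
    unfolding V_def by (rule subsetD[OF closure_subset], rule span_base) simp
  have W: "x \<in> W" for x
  proof -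
    obtain v where v: "v \<in> V" "\<And>w. w \<in> V \<Longrightarrow> inner (x - v) w = 0"
      using Hilbert_projection[OF V, of x] by blast
    have "inner (f (r n)) x = inner (f (r n)) v" for n
      using v(2)[OF fV[of "r n"]] by (simp add: inner_diff_left inner_commute)
    then show ?thesis using v(1) VW unfolding W_def by auto
  qed
  define L where "L = (\<lambda>x. lim (\<lambda>n. inner (f (r n)) x))"
  have L: "(\<lambda>n. inner (f (r n)) x) \<longlonglongrightarrow> L x" for x
    using W[of x] unfolding L_def W_def by (simp add: convergent_LIMSEQ_iff)
  have "bounded_linear L"
  proof (rule bounded_linear_intro[where K = B])
    show "L (x + y) = L x + L y" for x y
      by (rule LIMSEQ_unique[OF L]) (simp add: inner_add_right tendsto_add L)
    show "L (c *\<^sub>R x) = c *\<^sub>R L x" for c x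
      by (rule LIMSEQ_unique[OF L]) (simp add: tendsto_mult_left L)
    show "norm (L x) \<le> norm x * B" for x
      by (rule LIMSEQ_le_const2[OF tendsto_norm[OF L]]) (use bnd in \<open>auto simp: mult.commute\<close>)
  qed
  then obtain g where g: "\<forall>x. L x = inner g x" using Riesz_representation by blast
  have "(\<lambda>n. inner (f (r n)) x) \<longlonglongrightarrow> inner g x" for x
    using L[of x] g by simp
  then show ?thesis using r by blast
qed

section \<open>The Hilbert space of square integrable functions\<close>

definition square_integrable :: "('a::euclidean_space \<Rightarrow> real) \<Rightarrow> bool" where
  "square_integrable f \<longleftrightarrow> f \<in> borel_measurable borel \<and> integrable lborel (\<lambda>x. (f x)\<^sup>2)"

lemma square_integrable_mult:
  assumes "square_integrable f" "square_integrable g"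
  shows "integrable lborel (\<lambda>x. f x * g x)"
proof (rule Bochner_Integration.integrable_bound)
  show "integrable lborel (\<lambda>x. (f x)\<^sup>2 + (g x)\<^sup>2)"
    using assms unfolding square_integrable_def by auto
  show "(\<lambda>x. f x * g x) \<in> borel_measurable lborel"
    using assms unfolding square_integrable_def by auto
  have "\<bar>f x * g x\<bar> \<le> (f x)\<^sup>2 + (g x)\<^sup>2" for x
    using sum_squares_bound[of "f x" "g x"] sum_squares_bound[of "- f x" "g x"]
      zero_le_power2[of "f x"] zero_le_power2[of "g x"]
    by (simp add: abs_le_iff)
  then show "AE x in lborel. norm (f x * g x) \<le> norm ((f x)\<^sup>2 + (g x)\<^sup>2)"
    by (auto intro: order_trans[OF _ abs_ge_self])
qed

lemma square_integrable_add:
  assumes "square_integrable f" "square_integrable g"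
  shows "square_integrable (\<lambda>x. f x + g x)"
  using assms square_integrable_mult[OF assms]
  unfolding square_integrable_def by (auto simp: power2_sum mult.assoc)

lemma square_integrable_cmult:
  assumes "square_integrable f"
  shows "square_integrable (\<lambda>x. c * f x)"
  using assms unfolding square_integrable_def by (auto simp: power_mult_distrib)

lemma square_integrable_diff:
  assumes "square_integrable f" "square_integrable g"
  shows "square_integrable (\<lambda>x. f x - g x)"
  using square_integrable_add[OF assms(1) square_integrable_cmult[OF assms(2), of "-1"]] by simp

\<comment> \<open>The space is built as a type so that it can be an instance of
  \<open>real_inner\<close> and \<open>complete_space\<close>, the setting of the weak compactness
  theorem. Functions that are not square integrable are related to nothing and so belong to no
  class.\<close>
quotient_type (overloaded) 'a l2 = "'a::euclidean_space \<Rightarrow> real" / partial: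
  "\<lambda>f g. square_integrable f \<and> square_integrable g \<and> (AE x in lborel. f x = g x)"
proof (rule part_equivpI)
  show "\<exists>x::'a \<Rightarrow> real. square_integrable x \<and> square_integrable x \<and> (AE y in lborel. x y = x y)"
    by (rule exI[of _ "\<lambda>_. 0"]) (simp add: square_integrable_def)
  show "symp (\<lambda>f g. square_integrable (f::'a \<Rightarrow> real) \<and> square_integrable g \<and> (AE x in lborel. f x = g x))"
    by (rule sympI) (auto elim: AE_mp)
  show "transp (\<lambda>f g. square_integrable (f::'a \<Rightarrow> real) \<and> square_integrable g \<and> (AE x in lborel. f x = g x))"
    by (rule transpI) auto
qed

instantiation l2 :: (euclidean_space) real_inner
begin

lift_definition zero_l2 :: "'a l2" is "\<lambda>_. 0" by (simp add: square_integrable_def)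
lift_definition plus_l2 :: "'a l2 \<Rightarrow> 'a l2 \<Rightarrow> 'a l2" is "\<lambda>f g x. f x + g x"
  by (auto intro: square_integrable_add)
lift_definition minus_l2 :: "'a l2 \<Rightarrow> 'a l2 \<Rightarrow> 'a l2" is "\<lambda>f g x. f x - g x"
  by (auto intro: square_integrable_diff)
lift_definition uminus_l2 :: "'a l2 \<Rightarrow> 'a l2" is "\<lambda>f x. - f x"
  using square_integrable_cmult[of _ "-1"] by auto
lift_definition scaleR_l2 :: "real \<Rightarrow> 'a l2 \<Rightarrow> 'a l2" is "\<lambda>c f x. c * f x"
  by (auto intro: square_integrable_cmult)
lift_definition inner_l2 :: "'a l2 \<Rightarrow> 'a l2 \<Rightarrow> real" is "\<lambda>f g. \<integral>x. f x * g x \<partial>lborel"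
  by (intro integral_cong_AE) (auto simp: square_integrable_def)
definition norm_l2 :: "'a l2 \<Rightarrow> real" where "norm_l2 f = sqrt (inner f f)"
definition dist_l2 :: "'a l2 \<Rightarrow> 'a l2 \<Rightarrow> real" where "dist_l2 f g = norm (f - g)"
definition sgn_l2 :: "'a l2 \<Rightarrow> 'a l2" where "sgn_l2 f = scaleR (inverse (norm f)) f"
definition uniformity_l2 :: "('a l2 \<times> 'a l2) filter" where
  "uniformity_l2 = (INF e\<in>{0<..}. principal {(x, y). dist x y < e})"
definition open_l2 :: "'a l2 set \<Rightarrow> bool" where
  "open_l2 S = (\<forall>x\<in>S. \<forall>\<^sub>F (x', y) in uniformity. x' = x \<longrightarrow> y \<in> S)"

instance
proof
  fix f g h :: "'a l2" and a b :: real
  show "f + g + h = f + (g + h)"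
    by transfer (auto intro!: square_integrable_add simp: add.assoc)
  show "f + g = g + f" by transfer (auto intro!: square_integrable_add simp: add.commute)
  show "0 + f = f" by transfer auto
  show "- f + f = 0" by transfer (auto simp: square_integrable_def)
  show "f - g = f + - g"
    by transfer (auto intro: square_integrable_diff)
  show "a *\<^sub>R (f + g) = a *\<^sub>R f + a *\<^sub>R g"
    by transfer (auto intro!: square_integrable_cmult square_integrable_add simp: distrib_left)
  show "(a + b) *\<^sub>R f = a *\<^sub>R f + b *\<^sub>R f"
    by transfer (auto intro!: square_integrable_cmult square_integrable_add simp: distrib_right)
  show "a *\<^sub>R b *\<^sub>R f = (a * b) *\<^sub>R f"
    by transfer (auto intro!: square_integrable_cmult simp: mult.assoc)
  show "1 *\<^sub>R f = f" by transfer auto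
  show "dist f g = norm (f - g)" by (simp add: dist_l2_def)
  show "sgn f = scaleR (inverse (norm f)) f" by (simp add: sgn_l2_def)
  show "uniformity = (INF e\<in>{0<..}. principal {(x, y :: 'a l2). dist x y < e})"
    by (simp add: uniformity_l2_def)
  show "open U = (\<forall>x\<in>U. \<forall>\<^sub>F (x', y) in uniformity. x' = x \<longrightarrow> y \<in> U)" for U :: "'a l2 set"
    by (simp add: open_l2_def)
  show "inner f g = inner g f" by transfer (simp add: mult.commute)
  show "inner (f + g) h = inner f h + inner g h"
    by transfer (simp add: distrib_right square_integrable_mult)
  show "inner (a *\<^sub>R f) g = a * inner f g"
    by transfer (simp add: mult.assoc)
  show "0 \<le> inner f f" by transfer simp
  show "inner f f = 0 \<longleftrightarrow> f = 0"
  proof transfer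
    fix f :: "'a \<Rightarrow> real"
    assume "square_integrable f \<and> square_integrable f \<and> (AE x in lborel. f x = f x)"
    then have f: "square_integrable f" by simp
    have "(\<integral>x. (f x)\<^sup>2 \<partial>lborel) = 0 \<longleftrightarrow> (AE x in lborel. (f x)\<^sup>2 = 0)"
      using f unfolding square_integrable_def by (intro integral_nonneg_eq_0_iff_AE) auto
    then show "(\<integral>x. f x * f x \<partial>lborel) = 0 \<longleftrightarrow>
        square_integrable f \<and> square_integrable (\<lambda>_::'a. 0::real) \<and> (AE x in lborel. f x = 0)"
      using f by (simp add: power2_eq_square square_integrable_def)
  qed
  show "norm f = sqrt (inner f f)" by (simp add: norm_l2_def)
qed

end


lemma norm_l2_abs_l2:
  assumes "square_integrable f"
  shows "(norm (abs_l2 f))\<^sup>2 = (\<integral>x. (f x)\<^sup>2 \<partial>lborel)"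
proof -
  have "inner (abs_l2 f) (abs_l2 f) = (\<integral>x. f x * f x \<partial>lborel)"
    using assms by (subst inner_l2.abs_eq) (auto simp: eq_onp_def)
  then show ?thesis by (simp only: power2_norm_eq_inner) (simp add: power2_eq_square)
qed

lemma abs_l2_surj: "\<exists>f. square_integrable f \<and> F = abs_l2 f"
proof (rule l2.abs_induct)
  fix f :: "'a \<Rightarrow> real"
  assume "square_integrable f \<and> square_integrable f \<and> (AE x in lborel. f x = f x)"
  then show "\<exists>g. square_integrable g \<and> abs_l2 f = abs_l2 g"
    by (intro exI[of _ f] conjI) (rule conjunct1, assumption, rule refl)
qed

lemma abs_l2_diff:
  assumes "square_integrable f" "square_integrable g"
  shows "abs_l2 f - abs_l2 g = abs_l2 (\<lambda>x. f x - g x)"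
  using assms by (subst minus_l2.abs_eq) auto

lemma inner_abs_l2:
  assumes "square_integrable f" "square_integrable g"
  shows "inner (abs_l2 f) (abs_l2 g) = (\<integral>x. f x * g x \<partial>lborel)"
  using assms by (subst inner_l2.abs_eq) auto

text \<open>Along a subsequence whose increments are at most \<open>1 / 2 ^ n\<close>, the series
  \<open>\<Sum>n. 2 ^ n * (f (n + 1) - f n)\<^sup>2\<close> has a finite integral, so almost everywhere the increments
  are dominated by a geometric series.\<close>

lemma square_integrable_complete:
  fixes f :: "nat \<Rightarrow> 'a::euclidean_space \<Rightarrow> real"
  assumes f: "\<And>n. square_integrable (f n)"
    and small: "\<And>m n. n \<le> m \<Longrightarrow> (\<integral>x. (f m x - f n x)\<^sup>2 \<partial>lborel) \<le> (1/4) ^ n"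
  shows "\<exists>g. square_integrable g \<and> (\<forall>n. (\<integral>x. (g x - f n x)\<^sup>2 \<partial>lborel) \<le> (1/4) ^ n)"
proof -
  have meas [measurable]: "f n \<in> borel_measurable borel" for n
    using f unfolding square_integrable_def by blast
  have int: "integrable lborel (\<lambda>x. (f m x - f n x)\<^sup>2)" for m n
    using square_integrable_diff[OF f f] unfolding square_integrable_def by blast
  have nn: "(\<integral>\<^sup>+x. ennreal ((f m x - f n x)\<^sup>2) \<partial>lborel) \<le> ennreal ((1/4) ^ n)" if "n \<le> m" for m n
    using small[OF that] int by (subst nn_integral_eq_integral) (auto intro: ennreal_leI)
  define h where "h = (\<lambda>n x. 2 ^ n * (f (Suc n) x - f n x)\<^sup>2)"
  have [measurable]: "h n \<in> borel_measurable borel" for n unfolding h_def by measurable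
  have hnn: "(\<integral>\<^sup>+x. ennreal (h n x) \<partial>lborel) \<le> ennreal ((1/2) ^ n)" for n
  proof -
    have "(\<integral>\<^sup>+x. ennreal (h n x) \<partial>lborel) = ennreal (2 ^ n) * (\<integral>\<^sup>+x. ennreal ((f (Suc n) x - f n x)\<^sup>2) \<partial>lborel)"
      unfolding h_def by (subst nn_integral_cmult[symmetric]) (auto simp: ennreal_mult)
    also have "\<dots> \<le> ennreal (2 ^ n) * ennreal ((1/4) ^ n)"
      by (intro mult_left_mono nn) auto
    also have "\<dots> = ennreal ((1/2) ^ n)"
      by (simp add: ennreal_mult[symmetric] power_mult_distrib[symmetric])
    finally show ?thesis .
  qed
  have "(\<integral>\<^sup>+x. (\<Sum>n. ennreal (h n x)) \<partial>lborel) = (\<Sum>n. \<integral>\<^sup>+x. ennreal (h n x) \<partial>lborel)"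
    by (rule nn_integral_suminf) auto
  also have "\<dots> \<le> (\<Sum>n. ennreal ((1/2) ^ n))"
    by (intro suminf_le hnn) auto
  also have "\<dots> = ennreal (\<Sum>n. (1/2) ^ n)"
    by (rule suminf_ennreal2) (auto intro: summable_geometric)
  also have "\<dots> < \<infinity>" by simp
  finally have "AE x in lborel. (\<Sum>n. ennreal (h n x)) \<noteq> \<infinity>"
    by (intro nn_integral_PInf_AE) auto
  then have conv: "AE x in lborel. convergent (\<lambda>n. f n x)"
  proof eventually_elim
    case (elim x)
    have "summable (\<lambda>n. h n x)"
      using elim by (intro summable_suminf_not_top) (auto simp: h_def top_ennreal_def)
    then have "Bseq (\<lambda>n. h n x)"
      by (rule convergent_imp_Bseq[OF convergentI[OF summable_LIMSEQ_zero]])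
    then obtain C where "C > 0" and C: "\<forall>n. norm (h n x) \<le> C" by (rule BseqE)
    have geo: "norm (f (Suc n) x - f n x) \<le> sqrt C * (sqrt (1/2)) ^ n" for n
    proof -
      have "(f (Suc n) x - f n x)\<^sup>2 \<le> C * (1/2) ^ n"
        using C[rule_format, of n] by (simp add: h_def power_one_over divide_simps mult.commute)
      then have "sqrt ((f (Suc n) x - f n x)\<^sup>2) \<le> sqrt (C * (1/2) ^ n)"
        by (rule real_sqrt_le_mono)
      then have "\<bar>f (Suc n) x - f n x\<bar> \<le> sqrt (C * (1/2) ^ n)" by (simp only: real_sqrt_abs)
      then show ?thesis by (simp only: real_norm_def real_sqrt_mult real_sqrt_power)
    qed
    have sg: "summable (\<lambda>n. sqrt C * (sqrt (1/2)) ^ n)"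
    proof (intro summable_mult summable_geometric)
      have "sqrt (1/2) < sqrt 1" by (rule real_sqrt_less_mono) simp
      then show "norm (sqrt (1/2)) < 1" by simp
    qed
    have "summable (\<lambda>n. f (Suc n) x - f n x)"
      by (rule summable_comparison_test'[OF sg, of 0]) (rule geo)
    then have "convergent (\<lambda>n. \<Sum>i<n. f (Suc i) x - f i x)"
      by (simp only: summable_iff_convergent)
    then have "convergent (\<lambda>n. (\<Sum>i<n. f (Suc i) x - f i x) + f 0 x)"
      by (intro convergent_add convergent_const)
    then show ?case by (simp add: sum_lessThan_telescope[of "\<lambda>i. f i x"])
  qed
  define g where "g = (\<lambda>x. lim (\<lambda>n. f n x))"
  have [measurable]: "g \<in> borel_measurable borel" unfolding g_def by measurable
  have lim: "AE x in lborel. (\<lambda>n. f n x) \<longlonglongrightarrow> g x"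
    using conv by eventually_elim (simp add: g_def convergent_LIMSEQ_iff)
  \<comment> \<open>Fatou's lemma in \<open>m\<close>, with \<open>n\<close> fixed: the integrals
    are at most \<open>(1/4) ^ n\<close> as soon as \<open>n \<le> m\<close>.\<close>
  have bound: "(\<integral>\<^sup>+x. ennreal ((g x - f n x)\<^sup>2) \<partial>lborel) \<le> ennreal ((1/4) ^ n)" for n
  proof -
    have "(\<integral>\<^sup>+x. ennreal ((g x - f n x)\<^sup>2) \<partial>lborel)
        = (\<integral>\<^sup>+x. liminf (\<lambda>m. ennreal ((f m x - f n x)\<^sup>2)) \<partial>lborel)"
    proof (rule nn_integral_cong_AE)
      show "AE x in lborel. ennreal ((g x - f n x)\<^sup>2) = liminf (\<lambda>m. ennreal ((f m x - f n x)\<^sup>2))"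
        using lim
      proof eventually_elim
        case (elim x)
        have "(\<lambda>m. ennreal ((f m x - f n x)\<^sup>2)) \<longlonglongrightarrow> ennreal ((g x - f n x)\<^sup>2)"
          by (intro tendsto_ennrealI tendsto_intros elim)
        from lim_imp_Liminf[OF trivial_limit_sequentially this] show ?case by (rule sym)
      qed
    qed
    also have "\<dots> \<le> liminf (\<lambda>m. \<integral>\<^sup>+x. ennreal ((f m x - f n x)\<^sup>2) \<partial>lborel)"
      by (rule nn_integral_liminf) auto
    also have "\<dots> \<le> ennreal ((1/4) ^ n)"
    proof -
      have ev: "eventually (\<lambda>m. (\<integral>\<^sup>+x. ennreal ((f m x - f n x)\<^sup>2) \<partial>lborel) \<le> ennreal ((1/4) ^ n)) sequentially"
        by (rule eventually_sequentiallyI[of n]) (rule nn)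
      show ?thesis
        by (rule order_trans[OF Liminf_le_Limsup[OF trivial_limit_sequentially] Limsup_bounded[OF ev]])
    qed
    finally show ?thesis .
  qed
  have gint: "integrable lborel (\<lambda>x. (g x - f n x)\<^sup>2)" for n
  proof (rule integrableI_bounded)
    have "(\<integral>\<^sup>+x. ennreal (norm ((g x - f n x)\<^sup>2)) \<partial>lborel) \<le> ennreal ((1/4) ^ n)"
      using bound[of n] by simp
    also have "\<dots> < \<infinity>" by simp
    finally show "(\<integral>\<^sup>+x. ennreal (norm ((g x - f n x)\<^sup>2)) \<partial>lborel) < \<infinity>" .
  qed measurable
  have "square_integrable (\<lambda>x. (g x - f 0 x) + f 0 x)"
    by (rule square_integrable_add[OF _ f]) (use gint in \<open>auto simp: square_integrable_def\<close>)
  moreover have "(\<integral>x. (g x - f n x)\<^sup>2 \<partial>lborel) \<le> (1/4) ^ n" for n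
    using bound[of n] gint[of n] by (subst (asm) nn_integral_eq_integral) auto
  ultimately show ?thesis by (intro exI[of _ g]) simp
qed

instance l2 :: (euclidean_space) complete_space
proof
  fix X :: "nat \<Rightarrow> 'a l2"
  assume X: "Cauchy X"
  have "\<exists>N. \<forall>m\<ge>N. \<forall>n\<ge>N. dist (X m) (X n) < (1/2) ^ k" for k :: nat
    by (rule metric_CauchyD[OF X]) simp
  then obtain N where "\<forall>k. \<forall>m\<ge>N k. \<forall>n\<ge>N k. dist (X m) (X n) < (1/2) ^ k"
    using choice[of "\<lambda>k N. \<forall>m\<ge>N. \<forall>n\<ge>N. dist (X m) (X n) < (1/2) ^ k"] by blast
  then have N: "\<And>k m n. m \<ge> N k \<Longrightarrow> n \<ge> N k \<Longrightarrow> dist (X m) (X n) < (1/2) ^ k"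
    by blast
  \<comment> \<open>The sum makes \<open>s m\<close> at least as large as each of
    \<open>N 0, ..., N m\<close>, so later terms along \<open>s\<close> keep the closeness required
    at every earlier stage.\<close>
  define s where "s = (\<lambda>k::nat. k + (\<Sum>i\<le>k. N i))"
  have sN: "N k \<le> s m" if "k \<le> m" for k m
  proof -
    have "N k \<le> (\<Sum>i\<le>m. N i)" using that by (intro member_le_sum) auto
    then show ?thesis by (simp add: s_def)
  qed
  have "\<forall>k. \<exists>f. square_integrable f \<and> X (s k) = abs_l2 f"
    by (rule allI, rule abs_l2_surj)
  from choice[OF this] obtain f
    where f: "\<And>k. square_integrable (f k)" and Xf: "\<And>k. X (s k) = abs_l2 (f k)" by blast
  have d: "(\<integral>x. (g x - f k x)\<^sup>2 \<partial>lborel) = (dist (abs_l2 g) (X (s k)))\<^sup>2" if "square_integrable g" for g k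
    unfolding dist_norm Xf abs_l2_diff[OF that f] norm_l2_abs_l2[OF square_integrable_diff[OF that f]] ..
  have pw: "((1/2) ^ n)\<^sup>2 = (1/4 :: real) ^ n" for n
  proof -
    have "((1/2) ^ n)\<^sup>2 = ((1/2)\<^sup>2 :: real) ^ n"
      by (simp only: power_mult[symmetric] mult.commute)
    also have "((1/2)\<^sup>2 :: real) = 1/4" by (simp add: power_divide)
    finally show ?thesis .
  qed
  have "(\<integral>x. (f m x - f n x)\<^sup>2 \<partial>lborel) \<le> (1/4) ^ n" if "n \<le> m" for m n
  proof -
    have "dist (X (s m)) (X (s n)) \<le> (1/2) ^ n"
      using N[of n "s m" "s n"] sN[OF that] sN[of n n] by (simp add: less_imp_le)
    then have "(dist (X (s m)) (X (s n)))\<^sup>2 \<le> (1/4) ^ n"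
      unfolding pw[symmetric] by (rule power_mono) (rule zero_le_dist)
    then show ?thesis unfolding d[OF f[of m], of n] Xf[symmetric] .
  qed
  then obtain g where g: "square_integrable g" "\<And>n. (\<integral>x. (g x - f n x)\<^sup>2 \<partial>lborel) \<le> (1/4) ^ n"
    using square_integrable_complete[of f, OF f] by blast
  have gd: "dist (abs_l2 g) (X (s n)) \<le> (1/2) ^ n" for n
  proof (rule power2_le_imp_le)
    show "(dist (abs_l2 g) (X (s n)))\<^sup>2 \<le> ((1/2) ^ n)\<^sup>2"
      using g(2)[of n] unfolding d[OF g(1), of n] pw[of n] .
  qed simp
  have "X \<longlonglongrightarrow> abs_l2 g"
  proof (rule metric_LIMSEQ_I)
    fix e :: real assume "e > 0"
    then obtain k where k: "(1/2::real) ^ k < e / 2"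
      using real_arch_pow_inv[of "e/2" "1/2"] by force
    have "dist (X n) (abs_l2 g) < e" if "n \<ge> N k" for n
      using dist_triangle2[of "X n" "abs_l2 g" "X (s k)"] N[of k n "s k"] sN[of k k] that gd[of k] k
      by (simp add: dist_commute)
    then show "\<exists>no. \<forall>n\<ge>no. dist (X n) (abs_l2 g) < e" by blast
  qed
  then show "convergent X" by (rule convergentI)
qed

theorem square_integrable_weakly_convergent_subsequence:
  fixes f :: "nat \<Rightarrow> 'a::euclidean_space \<Rightarrow> real"
  assumes f: "\<And>n. square_integrable (f n)"
    and B: "\<And>n. (\<integral>x. (f n x)\<^sup>2 \<partial>lborel) \<le> B"
  shows "\<exists>r g. strict_mono r \<and> square_integrable g \<and>
    (\<forall>\<phi>. square_integrable \<phi> \<longrightarrow>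
      (\<lambda>n. \<integral>x. f (r n) x * \<phi> x \<partial>lborel) \<longlonglongrightarrow> (\<integral>x. g x * \<phi> x \<partial>lborel))"
proof -
  have "norm (abs_l2 (f n)) \<le> sqrt B" for n
    using norm_l2_abs_l2[OF f[of n]] B[of n] by (intro real_le_rsqrt) simp
  then obtain r G where r: "strict_mono (r :: nat \<Rightarrow> nat)"
    and G: "\<And>x. (\<lambda>n. inner (abs_l2 (f (r n))) x) \<longlonglongrightarrow> inner G x"
    using Hilbert_weakly_convergent_subsequence[of "\<lambda>n. abs_l2 (f n)"] by blast
  obtain g where g: "square_integrable g" "G = abs_l2 g" using abs_l2_surj by blast
  have "(\<lambda>n. \<integral>x. f (r n) x * \<phi> x \<partial>lborel) \<longlonglongrightarrow> (\<integral>x. g x * \<phi> x \<partial>lborel)"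
    if \<phi>: "square_integrable \<phi>" for \<phi>
    using G[of "abs_l2 \<phi>"] by (simp add: g(2) inner_abs_l2 f \<phi> g(1))
  then show ?thesis using r g(1) by blast
qed

section \<open>The Green function\<close>

text \<open>Cutting the heights off at \<open>0\<close> makes the kernel nonnegative, and zero outside the half plane,
  so that all integrals can be taken over the plane.\<close>

definition hgreen :: "real \<times> real \<Rightarrow> real \<times> real \<Rightarrow> real" where
  "hgreen x y = 1 / (4 * pi) * ln (1 + 4 * max 0 (snd x) * max 0 (snd y) / (dist x y)\<^sup>2)"

text \<open>Borel representatives of admissible functions, extended by zero to the plane. Sign and
  support are imposed at every point, so that kernels and profiles can be compared pointwise; the
  passage from classes to representatives is made only at the end.\<close>

definition vorticity :: "(real \<times> real \<Rightarrow> real) \<Rightarrow> bool" where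
  "vorticity f \<longleftrightarrow> f \<in> borel_measurable borel \<and> (\<forall>x. 0 \<le> f x) \<and> (\<forall>x. snd x \<le> 0 \<longrightarrow> f x = 0) \<and>
     integrable lborel f \<and> integrable lborel (\<lambda>x. snd x * f x) \<and> integrable lborel (\<lambda>x. (f x)\<^sup>2)"

definition mass :: "(real \<times> real \<Rightarrow> real) \<Rightarrow> real" where
  "mass f = (\<integral>x. f x \<partial>lborel)"

definition impulse :: "(real \<times> real \<Rightarrow> real) \<Rightarrow> real" where
  "impulse f = (\<integral>x. snd x * f x \<partial>lborel)"

definition enstrophy :: "(real \<times> real \<Rightarrow> real) \<Rightarrow> real" where
  "enstrophy f = (\<integral>x. (f x)\<^sup>2 \<partial>lborel)"

text \<open>A single integral over the product space: linearity and monotonicity in all three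
  arguments are then those of one integral, and Fubini is called only where a potential
  appears.\<close>

definition pairing :: "(real \<times> real \<Rightarrow> real \<times> real \<Rightarrow> real) \<Rightarrow> (real \<times> real \<Rightarrow> real) \<Rightarrow> (real \<times> real \<Rightarrow> real) \<Rightarrow> real" where
  "pairing k f g = (\<integral>z. k (fst z) (snd z) * f (fst z) * g (snd z) \<partial>(lborel \<Otimes>\<^sub>M lborel))"

definition kernel :: "(real \<times> real \<Rightarrow> real \<times> real \<Rightarrow> real) \<Rightarrow> bool" where
  "kernel k \<longleftrightarrow> (\<lambda>z. k (fst z) (snd z)) \<in> borel_measurable (borel \<Otimes>\<^sub>M borel) \<and> (\<forall>x y. 0 \<le> k x y)"

lemma snd_borel [measurable]: "(snd :: real \<times> real \<Rightarrow> real) \<in> borel_measurable borel"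
  by (intro borel_measurable_continuous_onI continuous_intros)

lemma hgreen_measurable [measurable]:
  "(\<lambda>z. hgreen (fst z) (snd z)) \<in> borel_measurable (borel \<Otimes>\<^sub>M borel)"
proof -
  have [measurable]: "(\<lambda>z::(real \<times> real) \<times> real \<times> real. snd (fst z)) \<in> borel_measurable (borel \<Otimes>\<^sub>M borel)"
    by (rule measurable_compose[OF measurable_fst snd_borel])
  have [measurable]: "(\<lambda>z::(real \<times> real) \<times> real \<times> real. snd (snd z)) \<in> borel_measurable (borel \<Otimes>\<^sub>M borel)"
    by (rule measurable_compose[OF measurable_snd snd_borel])
  show ?thesis unfolding hgreen_def by measurable
qed

lemma hgreen_nonneg: "0 \<le> hgreen x y"
  unfolding hgreen_def by (intro mult_nonneg_nonneg ln_ge_zero) auto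

lemma kernel_hgreen: "kernel hgreen"
  unfolding kernel_def using hgreen_nonneg by simp

lemma kernel_measurable: "kernel k \<Longrightarrow> (\<lambda>z. k (fst z) (snd z)) \<in> borel_measurable (borel \<Otimes>\<^sub>M borel)"
  by (simp add: kernel_def)

lemma kernel_nonneg: "kernel k \<Longrightarrow> 0 \<le> k x y"
  by (simp only: kernel_def)

lemma kernel_measurable_right:
  assumes "kernel k"
  shows "k x \<in> borel_measurable borel"
proof -
  have "(\<lambda>y. (x, y)) \<in> borel \<rightarrow>\<^sub>M borel \<Otimes>\<^sub>M borel" by measurable
  from measurable_compose[OF this kernel_measurable[OF assms]] show ?thesis by simp
qed

lemma hgreen_sym: "hgreen x y = hgreen y x"
  unfolding hgreen_def by (simp add: dist_commute mult.commute mult.left_commute)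

lemma hgreen_pos:
  assumes "0 < snd x" "0 < snd y" "x \<noteq> y"
  shows "0 < hgreen x y"
  unfolding hgreen_def using assms by (intro mult_pos_pos ln_gt_zero) auto

lemma hgreen_eq_0: "snd x \<le> 0 \<or> snd y \<le> 0 \<Longrightarrow> hgreen x y = 0"
  unfolding hgreen_def by (auto simp: max_def)

definition hratio :: "real \<times> real \<Rightarrow> real \<times> real \<Rightarrow> real" where
  "hratio x y = sqrt (snd x * snd y) / dist x y"

text \<open>With t = \<open>hratio x y\<close> the kernel is ln(1 + 4t^2) / (4 pi). The second bound
  is ln(1 + z) \<le> z and serves for distant points, where it separates into a product of heights.
  The first uses 1 + 4t^2 \<le> (1 + 2t)^2. The third uses 1 + u^4 \<le> (1 + u)^4 with u^4 = 4t^2,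
  hence u^2 = 2t; it shows that even the square of the kernel is only as singular as
  \<open>1 / dist x y\<close>, which is integrable in the plane.\<close>

lemma hratio_bounds:
  assumes "0 < snd x" "0 < snd y"
  shows hgreen_le_hratio: "hgreen x y \<le> hratio x y"
    and hgreen_le_hratio_sq: "hgreen x y \<le> (hratio x y)\<^sup>2"
    and hgreen_sq_le_hratio: "(hgreen x y)\<^sup>2 \<le> hratio x y"
proof -
  define t where "t = hratio x y"
  have t0: "t \<ge> 0" using assms by (simp add: t_def hratio_def)
  have t2: "t\<^sup>2 = snd x * snd y / (dist x y)\<^sup>2"
    using assms by (simp add: t_def hratio_def power_divide)
  have h: "hgreen x y = ln (1 + 4 * t\<^sup>2) / (4 * pi)"
    unfolding hgreen_def t2 using assms by (simp add: max_def mult.assoc)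
  have pi: "pi > 2" using pi_gt3 by linarith
  have "ln (1 + 4 * t\<^sup>2) \<le> ln ((1 + 2 * t)\<^sup>2)"
    using t0 by (subst ln_le_cancel_iff) (auto simp: power2_eq_square algebra_simps add_pos_nonneg)
  also have "\<dots> = 2 * ln (1 + 2 * t)" using t0 by (simp add: ln_realpow)
  also have "\<dots> \<le> 4 * t" using ln_add_one_self_le_self[of "2 * t"] t0 by simp
  finally have 1: "ln (1 + 4 * t\<^sup>2) \<le> 4 * t" .
  have "ln (1 + 4 * t\<^sup>2) / (4 * pi) \<le> 4 * t / 4"
    using 1 t0 pi by (intro frac_le) auto
  then show "hgreen x y \<le> hratio x y" by (simp add: h t_def)
  have "ln (1 + 4 * t\<^sup>2) \<le> 4 * t\<^sup>2" by (rule ln_add_one_self_le_self) simp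
  then have "ln (1 + 4 * t\<^sup>2) / (4 * pi) \<le> 4 * t\<^sup>2 / 4"
    using pi by (intro frac_le) auto
  then show "hgreen x y \<le> (hratio x y)\<^sup>2" by (simp add: h t_def)
  define u where "u = sqrt (2 * t)"
  have u: "u \<ge> 0" "u\<^sup>2 = 2 * t" using t0 by (auto simp: u_def)
  have u4: "4 * t\<^sup>2 = u ^ 4"
    using u(2) by (simp add: power2_eq_square power4_eq_xxxx)
  have "1 + u ^ 4 \<le> (1 + u) ^ 4"
  proof -
    have "(1 + u) ^ 4 = 1 + u ^ 4 + (4 * u + 6 * u ^ 2 + 4 * u ^ 3)" by algebra
    then show ?thesis using u(1) by simp
  qed
  then have "ln (1 + u ^ 4) \<le> ln ((1 + u) ^ 4)"
    using u(1) by (subst ln_le_cancel_iff) (auto simp: add_pos_nonneg)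
  also have "\<dots> = 4 * ln (1 + u)" using u(1) by (simp add: ln_realpow)
  also have "\<dots> \<le> 4 * u" using ln_add_one_self_le_self[of u] u(1) by simp
  finally have 2: "ln (1 + 4 * t\<^sup>2) \<le> 4 * u" unfolding u4 .
  have "0 \<le> ln (1 + 4 * t\<^sup>2)" by (rule ln_ge_zero) simp
  then have "(ln (1 + 4 * t\<^sup>2))\<^sup>2 \<le> (4 * u)\<^sup>2" using 2 by (intro power_mono) auto
  also have "\<dots> = 32 * t" using u(2) by (simp add: power_mult_distrib)
  finally have 3: "(ln (1 + 4 * t\<^sup>2))\<^sup>2 \<le> 32 * t" .
  have "32 \<le> (4 * pi)\<^sup>2"
    using mult_mono[of 2 pi 2 pi] pi by (simp add: power2_eq_square)
  then have "(ln (1 + 4 * t\<^sup>2))\<^sup>2 / (4 * pi)\<^sup>2 \<le> 32 * t / 32"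
    using 3 t0 by (intro frac_le) auto
  then show "(hgreen x y)\<^sup>2 \<le> hratio x y"
    unfolding h t_def[symmetric] by (simp add: power_divide)
qed

section \<open>Translations and integrability of the kernel singularity\<close>

lemma nn_integral_lborel_translate:
  fixes F :: "'a::euclidean_space \<Rightarrow> ennreal"
  assumes [measurable]: "F \<in> borel_measurable borel"
  shows "(\<integral>\<^sup>+x. F (x + a) \<partial>lborel) = (\<integral>\<^sup>+x. F x \<partial>lborel)"
proof -
  have "(\<integral>\<^sup>+x. F x \<partial>lborel) = (\<integral>\<^sup>+x. F x \<partial>distr lborel borel ((+) a))"
    by (simp add: lborel_distr_plus)
  also have "\<dots> = (\<integral>\<^sup>+x. F (a + x) \<partial>lborel)" by (rule nn_integral_distr) auto
  finally show ?thesis by (simp add: add.commute)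
qed

lemma integral_lborel_translate:
  fixes F :: "'a::euclidean_space \<Rightarrow> real"
  assumes [measurable]: "F \<in> borel_measurable borel"
  shows "(\<integral>x. F (x + a) \<partial>lborel) = (\<integral>x. F x \<partial>lborel)"
proof -
  have "(\<integral>x. F x \<partial>lborel) = (\<integral>x. F x \<partial>distr lborel borel ((+) a))"
    by (simp add: lborel_distr_plus)
  also have "\<dots> = (\<integral>x. F (a + x) \<partial>lborel)" by (rule integral_distr) auto
  finally show ?thesis by (simp add: add.commute)
qed

lemma integrable_lborel_translate:
  fixes F :: "'a::euclidean_space \<Rightarrow> real"
  assumes [measurable]: "F \<in> borel_measurable borel" and "integrable lborel F"
  shows "integrable lborel (\<lambda>x. F (x + a))"
proof -
  have "integrable (distr lborel borel ((+) a)) F"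
    using assms(2) by (simp add: lborel_distr_plus)
  then have "integrable lborel (\<lambda>x. F (a + x))" by (subst (asm) integrable_distr_eq) auto
  then show ?thesis by (simp add: add.commute)
qed

lemma nn_integral_inverse_sqrt:
  assumes e: "0 < e"
  shows "(\<integral>\<^sup>+s. ennreal (indicator {-e..e} s * \<bar>s\<bar> powr (-1/2)) \<partial>lborel) = ennreal (4 * sqrt e)"
proof -
  define h where "h = (\<lambda>s::real. indicator {0..e} s * s powr (-1/2))"
  have [measurable]: "h \<in> borel_measurable borel" unfolding h_def by measurable
  have "((\<lambda>x. x powr (-1/2)) has_integral (e powr (-1/2+1) / (-1/2+1))) {0..e}"
    by (rule has_integral_powr_from_0) (use e in auto)
  then have "((\<lambda>x. x powr (-1/2)) has_integral (2 * sqrt e)) {0..e}"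
    using e by (simp add: powr_half_sqrt mult.commute)
  then have "((\<lambda>x. if x \<in> {0..e} then x powr (-1/2) else 0) has_integral (2 * sqrt e)) UNIV"
    by (simp only: has_integral_restrict_UNIV)
  then have "(h has_integral (2 * sqrt e)) UNIV"
    by (rule has_integral_eq[rotated]) (simp add: h_def indicator_def)
  then have hi: "(\<integral>\<^sup>+s. ennreal (h s) \<partial>lborel) = ennreal (2 * sqrt e)"
    by (intro nn_integral_has_integral_lborel) (auto simp: h_def)
  have hm: "(\<integral>\<^sup>+s. ennreal (h (- s)) \<partial>lborel) = ennreal (2 * sqrt e)"
  proof -
    have "(\<integral>\<^sup>+s. ennreal (h s) \<partial>lborel) = (\<integral>\<^sup>+s. ennreal (h s) \<partial>distr lborel borel uminus)"
      by (simp add: lborel_distr_uminus)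
    also have "\<dots> = (\<integral>\<^sup>+s. ennreal (h (- s)) \<partial>lborel)" by (rule nn_integral_distr) auto
    finally show ?thesis using hi by simp
  qed
  have "(\<integral>\<^sup>+s. ennreal (indicator {-e..e} s * \<bar>s\<bar> powr (-1/2)) \<partial>lborel)
      = (\<integral>\<^sup>+s. ennreal (h s) + ennreal (h (- s)) \<partial>lborel)"
  proof (rule nn_integral_cong)
    fix s :: real
    show "ennreal (indicator {-e..e} s * \<bar>s\<bar> powr (-1/2)) = ennreal (h s) + ennreal (h (- s))"
      by (cases "s > 0"; cases "s = 0") (auto simp: h_def indicator_def)
  qed
  also have "\<dots> = ennreal (2 * sqrt e) + ennreal (2 * sqrt e)"
    by (subst nn_integral_add) (auto simp: hi hm)
  also have "\<dots> = ennreal (4 * sqrt e)"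
    using e by (subst ennreal_plus[symmetric]) auto
  finally show ?thesis .
qed

text \<open>Since \<open>\<bar>z\<bar>\<^sup>2 \<ge> \<bar>z\<^sub>1\<bar> \<bar>z\<^sub>2\<bar>\<close>, the kernel \<open>1 / \<bar>z\<bar>\<close> is dominated by a product of one-dimensional ones.\<close>

lemma nn_integral_inverse_norm:
  assumes e: "0 < e"
  shows "(\<integral>\<^sup>+z. ennreal (indicator (ball 0 e) z / norm z) \<partial>(lborel :: (real \<times> real) measure)) \<le> ennreal (16 * e)"
proof -
  \<comment> \<open>On the axes the formula would give 0, because \<open>0 powr a = 0\<close>, and
    the product bound would fail. The value infinity on this null set restores it: the other factor
    is nonzero on the ball.\<close>
  define q where "q = (\<lambda>s::real. if s = 0 then \<infinity> else ennreal (indicator {-e..e} s * \<bar>s\<bar> powr (-1/2)))"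
  have [measurable]: "q \<in> borel_measurable borel" unfolding q_def by measurable
  have "AE s in lborel. q s = ennreal (indicator {-e..e} s * \<bar>s\<bar> powr (-1/2))"
    using AE_lborel_singleton[of 0] by eventually_elim (simp add: q_def)
  then have qi: "(\<integral>\<^sup>+s. q s \<partial>lborel) = ennreal (4 * sqrt e)"
    using nn_integral_cong_AE nn_integral_inverse_sqrt[OF e] by metis
  have le: "ennreal (indicator (ball 0 e) z / norm z) \<le> q (fst z) * q (snd z)" for z :: "real \<times> real"
  proof (cases "z \<in> ball 0 e")
    case True
    then have "norm z < e" by simp
    then have in': "\<bar>fst z\<bar> \<le> e" "\<bar>snd z\<bar> \<le> e"
      using norm_fst_le[of "fst z" "snd z"] norm_snd_le[of "snd z" "fst z"] by auto
    show ?thesis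
    proof (cases "fst z = 0 \<or> snd z = 0")
      case True
      have "q s \<noteq> 0" if "\<bar>s\<bar> \<le> e" for s
        using that by (auto simp: q_def abs_le_iff)
      then have "q (fst z) * q (snd z) = \<infinity>"
        using True in' by (auto simp: q_def ennreal_mult_eq_top_iff)
      then show ?thesis by simp
    next
      case False
      have "\<bar>fst z\<bar> * \<bar>snd z\<bar> \<le> (norm z)\<^sup>2"
      proof -
        have "2 * (\<bar>fst z\<bar> * \<bar>snd z\<bar>) \<le> (fst z)\<^sup>2 + (snd z)\<^sup>2"
          using sum_squares_bound[of "\<bar>fst z\<bar>" "\<bar>snd z\<bar>"] by (simp add: mult.assoc)
        moreover have "0 \<le> \<bar>fst z\<bar> * \<bar>snd z\<bar>" by simp
        ultimately have "\<bar>fst z\<bar> * \<bar>snd z\<bar> \<le> (fst z)\<^sup>2 + (snd z)\<^sup>2" by linarith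
        then show ?thesis by (simp add: norm_prod_def)
      qed
      then have "sqrt (\<bar>fst z\<bar> * \<bar>snd z\<bar>) \<le> norm z"
        by (intro real_le_lsqrt) auto
      then have "1 / norm z \<le> 1 / sqrt (\<bar>fst z\<bar> * \<bar>snd z\<bar>)"
        using False by (intro divide_left_mono mult_pos_pos) auto
      also have "\<dots> = \<bar>fst z\<bar> powr (-1/2) * \<bar>snd z\<bar> powr (-1/2)"
        using False by (simp add: powr_minus_divide powr_half_sqrt real_sqrt_mult)
      finally have "ennreal (1 / norm z) \<le> ennreal (\<bar>fst z\<bar> powr (-1/2) * \<bar>snd z\<bar> powr (-1/2))"
        by (rule ennreal_leI)
      also have "\<dots> = q (fst z) * q (snd z)"
        using in' False by (simp add: q_def abs_le_iff ennreal_mult)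
      finally show ?thesis using True by simp
    qed
  qed simp
  have "(\<integral>\<^sup>+z. ennreal (indicator (ball 0 e) z / norm z) \<partial>(lborel :: (real \<times> real) measure))
      \<le> (\<integral>\<^sup>+z. q (fst z) * q (snd z) \<partial>(lborel :: (real \<times> real) measure))"
    by (intro nn_integral_mono le)
  also have "\<dots> = (\<integral>\<^sup>+z. q (fst z) * q (snd z) \<partial>(lborel \<Otimes>\<^sub>M lborel))"
    by (simp add: lborel_prod)
  also have "\<dots> = (\<integral>\<^sup>+s. \<integral>\<^sup>+t. q s * q t \<partial>lborel \<partial>lborel)"
    by (subst lborel.nn_integral_fst[symmetric]) auto
  also have "\<dots> = ennreal (4 * sqrt e) * ennreal (4 * sqrt e)"
    by (simp add: nn_integral_cmult nn_integral_multc qi)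
  also have "\<dots> = ennreal (16 * e)"
    using e by (simp add: ennreal_mult[symmetric])
  finally show ?thesis .
qed

lemma vorticityD:
  assumes "vorticity f"
  shows vorticity_measurable: "f \<in> borel_measurable borel"
    and vorticity_nonneg: "0 \<le> f x"
    and vorticity_zero: "snd x \<le> 0 \<Longrightarrow> f x = 0"
    and vorticity_integrable: "integrable lborel f"
    and vorticity_impulse_integrable: "integrable lborel (\<lambda>x. snd x * f x)"
    and vorticity_square_integrable: "integrable lborel (\<lambda>x. (f x)\<^sup>2)"
  using assms unfolding vorticity_def by blast+

lemma vorticity_height_nonneg: "vorticity f \<Longrightarrow> 0 \<le> snd x * f x"
  using vorticity_nonneg[of f x] vorticity_zero[of f x] by (cases "0 < snd x") auto

lemma mass_nonneg: "vorticity f \<Longrightarrow> 0 \<le> mass f"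
  unfolding mass_def by (intro integral_nonneg_AE) (simp add: vorticity_nonneg)

lemma impulse_nonneg: "vorticity f \<Longrightarrow> 0 \<le> impulse f"
  unfolding impulse_def by (intro integral_nonneg_AE) (simp add: vorticity_height_nonneg)

lemma enstrophy_nonneg: "0 \<le> enstrophy f"
  unfolding enstrophy_def by (intro integral_nonneg_AE) simp

text \<open>The free parameter \<open>s\<close> comes from Young's inequality
  \<open>G \<omega> \<le> (\<sigma> G\<^sup>2 + \<omega>\<^sup>2 / \<sigma>) / 2\<close> with \<open>\<sigma> = s / sqrt (1 + x\<^sub>2)\<close>; it allows the contribution of the
  enstrophy to be made as small as desired.\<close>

lemma near_potential_le:
  assumes g: "vorticity g" and x: "0 < snd x" and e: "0 < e" "e \<le> 1" and s: "0 < s"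
  shows "(\<integral>\<^sup>+y. ennreal (indicator (ball x e) y * hgreen x y * g y) \<partial>lborel)
    \<le> ennreal (sqrt (1 + snd x) * (8 * s * e + enstrophy g / (2 * s)))"
proof -
  note [measurable] = vorticity_measurable[OF g] kernel_measurable_right[OF kernel_hgreen, of x]
  have [measurable]: "ball 0 e \<in> sets (borel :: (real \<times> real) measure)" by simp
  define r where "r = sqrt (1 + snd x)"
  have r: "r > 0" "r\<^sup>2 = 1 + snd x" using x by (auto simp: r_def)
  have pt: "indicator (ball x e) y * hgreen x y * g y
      \<le> s * r / 2 * (indicator (ball 0 e) (y + (- x)) / norm (y + (- x))) + r / (2 * s) * (g y)\<^sup>2" for y
  proof (cases "y \<in> ball x e \<and> 0 < snd y")
    case False
    then have "indicator (ball x e) y * hgreen x y * g y = 0"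
      using vorticity_zero[OF g, of y] by (cases "y \<in> ball x e") (auto simp: not_less)
    moreover have "0 \<le> s * r / 2 * (indicator (ball 0 e) (y + (- x)) / norm (y + (- x))) + r / (2 * s) * (g y)\<^sup>2"
      using r s by (intro add_nonneg_nonneg mult_nonneg_nonneg divide_nonneg_nonneg) auto
    ultimately show ?thesis by (simp only:)
  next
    case True
    define h where "h = hgreen x y"
    have h0: "0 \<le> h" by (simp add: h_def hgreen_nonneg)
    have g0: "0 \<le> g y" by (rule vorticity_nonneg[OF g])
    have "2 * ((s / r) * h) * g y * 1 \<le> ((s / r) * h)\<^sup>2 + (g y)\<^sup>2"
      using sum_squares_bound[of "(s / r) * h" "g y"] by simp
    then have "r / (2 * s) * (2 * ((s / r) * h) * g y) \<le> r / (2 * s) * (((s / r) * h)\<^sup>2 + (g y)\<^sup>2)"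
      using r s by (intro mult_left_mono) auto
    then have 1: "h * g y \<le> s / (2 * r) * h\<^sup>2 + r / (2 * s) * (g y)\<^sup>2"
      using r(1) s by (simp add: distrib_left power2_eq_square mult_ac)
    \<comment> \<open>In a ball of radius at most 1 both heights are at most
      \<open>r\<^sup>2\<close>, so \<open>hratio x y\<close> is at most
      \<open>r\<^sup>2 / dist x y\<close>. The integral of the inverse distance over the ball is at
      most \<open>16 * e\<close>, which is where \<open>8 * s * e\<close> comes from.\<close>
    have "snd y - snd x \<le> dist x y"
      using dist_snd_le[of y x] by (simp add: dist_real_def dist_commute)
    then have "snd y \<le> 1 + snd x" using True e by (simp add: dist_commute)
    then have "snd x * snd y \<le> (1 + snd x) * (1 + snd x)"
      using x True by (intro mult_mono) auto
    then have "snd x * snd y \<le> (r\<^sup>2)\<^sup>2" unfolding r(2) by (simp only: power2_eq_square)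
    then have "sqrt (snd x * snd y) \<le> r\<^sup>2"
      by (intro real_le_lsqrt) auto
    then have "sqrt (snd x * snd y) / dist x y \<le> r\<^sup>2 / dist x y"
      by (rule divide_right_mono) simp
    with hgreen_sq_le_hratio[OF x conjunct2[OF True]] have "h\<^sup>2 \<le> r\<^sup>2 / dist x y"
      unfolding h_def hratio_def by (rule order_trans)
    then have "s / (2 * r) * h\<^sup>2 \<le> s / (2 * r) * (r\<^sup>2 / dist x y)"
      using r s by (intro mult_left_mono) auto
    also have "\<dots> = s * r / 2 * (1 / dist x y)"
      using r(1) by (simp add: power2_eq_square)
    finally show ?thesis
      using 1 True by (simp add: h_def dist_norm norm_minus_commute)
  qed
  have "(\<integral>\<^sup>+y. ennreal (indicator (ball x e) y * hgreen x y * g y) \<partial>lborel)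
     \<le> (\<integral>\<^sup>+y. ennreal (s * r / 2) * ennreal (indicator (ball 0 e) (y + (- x)) / norm (y + (- x)))
        + ennreal (r / (2 * s)) * ennreal ((g y)\<^sup>2) \<partial>lborel)"
    using pt r s
    by (intro nn_integral_mono) (simp add: ennreal_mult[symmetric] ennreal_plus[symmetric] del: ennreal_plus)
  also have "\<dots> = ennreal (s * r / 2) * (\<integral>\<^sup>+y. ennreal (indicator (ball 0 e) (y + (- x)) / norm (y + (- x))) \<partial>lborel)
        + ennreal (r / (2 * s)) * (\<integral>\<^sup>+y. ennreal ((g y)\<^sup>2) \<partial>lborel)"
  proof -
    have [measurable]: "(\<lambda>y. y + (- x)) \<in> borel \<rightarrow>\<^sub>M borel" by measurable
    have "(\<lambda>z. ennreal (indicator (ball 0 e) z / norm z)) \<in> borel_measurable (borel :: (real \<times> real) measure)"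
      by measurable
    from measurable_compose[OF \<open>(\<lambda>y. y + (- x)) \<in> borel \<rightarrow>\<^sub>M borel\<close> this]
    have m1: "(\<lambda>y. ennreal (indicator (ball 0 e) (y + (- x)) / norm (y + (- x)))) \<in> borel_measurable lborel"
      by simp
    have m2: "(\<lambda>y. ennreal ((g y)\<^sup>2)) \<in> borel_measurable lborel" by measurable
    show ?thesis
      by (simp only: nn_integral_add[OF borel_measurable_times_ennreal[OF borel_measurable_const m1]
            borel_measurable_times_ennreal[OF borel_measurable_const m2]] nn_integral_cmult[OF m1] nn_integral_cmult[OF m2])
  qed
  also have "(\<integral>\<^sup>+y. ennreal (indicator (ball 0 e) (y + (- x)) / norm (y + (- x))) \<partial>lborel)
      = (\<integral>\<^sup>+y. ennreal (indicator (ball 0 e) y / norm y) \<partial>(lborel :: (real \<times> real) measure))"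
    by (rule nn_integral_lborel_translate[of "\<lambda>y. ennreal (indicator (ball 0 e) y / norm y)"]) measurable
  also have "(\<integral>\<^sup>+y. ennreal ((g y)\<^sup>2) \<partial>lborel) = ennreal (enstrophy g)"
    unfolding enstrophy_def by (rule nn_integral_eq_integral[OF vorticity_square_integrable[OF g]]) simp
  also have "ennreal (s * r / 2) * (\<integral>\<^sup>+y. ennreal (indicator (ball 0 e) y / norm y) \<partial>(lborel :: (real \<times> real) measure))
      + ennreal (r / (2 * s)) * ennreal (enstrophy g)
     \<le> ennreal (s * r / 2) * ennreal (16 * e) + ennreal (r / (2 * s)) * ennreal (enstrophy g)"
    by (intro add_mono mult_left_mono nn_integral_inverse_norm e) auto
  also have "\<dots> = ennreal (r * (8 * s * e + enstrophy g / (2 * s)))"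
    using r s e enstrophy_nonneg[of g]
    by (simp add: ennreal_mult[symmetric] ennreal_plus[symmetric] algebra_simps del: ennreal_plus)
  finally show ?thesis by (simp add: r_def)
qed

text \<open>In the unit ball around \<open>x\<close> the estimate of the singularity applies.
  Outside it, t \<le> sqrt(x2 y2) \<le> sqrt(1 + x2) (1 + y2), and integrating
  \<open>1 + snd y\<close> against \<open>g\<close> gives mass plus impulse. What matters later is
  that the growth in the height of \<open>x\<close> is only a square root, slower than the weight in
  the impulse.\<close>

lemma potential_le:
  assumes g: "vorticity g" and s: "0 < s"
  shows "(\<integral>\<^sup>+y. ennreal (hgreen x y * g y) \<partial>lborel)
    \<le> ennreal (sqrt (1 + max 0 (snd x)) * (8 * s + enstrophy g / (2 * s) + mass g + impulse g))"
proof (cases "0 < snd x")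
  case False
  then show ?thesis by (simp add: hgreen_eq_0)
next
  case x: True
  note [measurable] = vorticity_measurable[OF g] kernel_measurable_right[OF kernel_hgreen, of x]
  define r where "r = sqrt (1 + snd x)"
  have r: "r > 0" using x by (simp add: r_def)
  have [measurable]: "ball x 1 \<in> sets borel" by simp
  have pt: "hgreen x y * g y \<le> indicator (ball x 1) y * hgreen x y * g y + r * (g y + snd y * g y)" for y
  proof (cases "y \<in> ball x 1 \<or> snd y \<le> 0")
    case True
    have "0 \<le> r * (g y + snd y * g y)"
      by (intro mult_nonneg_nonneg add_nonneg_nonneg vorticity_height_nonneg[OF g] vorticity_nonneg[OF g] less_imp_le[OF r])
    then show ?thesis using True vorticity_zero[OF g, of y] by (cases "y \<in> ball x 1") auto
  next
    case False
    then have y: "0 < snd y" "1 \<le> dist x y" by auto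
    have "hratio x y \<le> sqrt (snd x * snd y) / 1"
      unfolding hratio_def using y x by (intro divide_left_mono) auto
    also have "\<dots> \<le> sqrt ((1 + snd x) * (1 + snd y)\<^sup>2)"
    proof -
      have "snd x * snd y \<le> (1 + snd x) * (1 + snd y)\<^sup>2"
      proof (rule mult_mono)
        show "snd y \<le> (1 + snd y)\<^sup>2" using y by (simp add: power2_sum)
      qed (use x y in auto)
      then show ?thesis by simp
    qed
    also have "\<dots> = r * (1 + snd y)" using y by (simp add: real_sqrt_mult r_def)
    finally have "hgreen x y \<le> r * (1 + snd y)"
      using hgreen_le_hratio[OF x y(1)] by simp
    then have "hgreen x y * g y \<le> r * (1 + snd y) * g y"
      by (intro mult_right_mono vorticity_nonneg[OF g])
    then show ?thesis using False by (simp add: algebra_simps)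
  qed
  have "(\<integral>\<^sup>+y. ennreal (hgreen x y * g y) \<partial>lborel)
     \<le> (\<integral>\<^sup>+y. ennreal (indicator (ball x 1) y * hgreen x y * g y) + ennreal (r * (g y + snd y * g y)) \<partial>lborel)"
    using pt r hgreen_nonneg vorticity_nonneg[OF g] vorticity_height_nonneg[OF g]
    by (intro nn_integral_mono) (simp add: ennreal_plus[symmetric] ennreal_leI del: ennreal_plus)
  also have "\<dots> = (\<integral>\<^sup>+y. ennreal (indicator (ball x 1) y * hgreen x y * g y) \<partial>lborel)
      + (\<integral>\<^sup>+y. ennreal (r * (g y + snd y * g y)) \<partial>lborel)"
    by (rule nn_integral_add) measurable
  also have "(\<integral>\<^sup>+y. ennreal (r * (g y + snd y * g y)) \<partial>lborel) = ennreal (r * (mass g + impulse g))"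
    using r vorticity_nonneg[OF g] vorticity_height_nonneg[OF g] unfolding mass_def impulse_def
    by (subst nn_integral_eq_integral)
      (auto simp: vorticity_integrable[OF g] vorticity_impulse_integrable[OF g])
  also have "(\<integral>\<^sup>+y. ennreal (indicator (ball x 1) y * hgreen x y * g y) \<partial>lborel)
      + ennreal (r * (mass g + impulse g))
      \<le> ennreal (r * (8 * s * 1 + enstrophy g / (2 * s))) + ennreal (r * (mass g + impulse g))"
    unfolding r_def by (intro add_right_mono near_potential_le g x s) auto
  also have "\<dots> = ennreal (r * (8 * s + enstrophy g / (2 * s) + mass g + impulse g))"
    using r s mass_nonneg[OF g] impulse_nonneg[OF g] enstrophy_nonneg[of g]
    by (subst ennreal_plus[symmetric]) (auto simp: algebra_simps)
  finally show ?thesis using x by (simp add: r_def)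
qed

section \<open>The interaction energy\<close>

lemma vorticityI:
  assumes "f \<in> borel_measurable borel" "\<And>x. 0 \<le> f x" "\<And>x. snd x \<le> 0 \<Longrightarrow> f x = 0"
    "integrable lborel f" "integrable lborel (\<lambda>x. snd x * f x)" "integrable lborel (\<lambda>x. (f x)\<^sup>2)"
  shows "vorticity f"
  using assms unfolding vorticity_def by blast

lemma vorticity_square: "vorticity f \<Longrightarrow> square_integrable f"
  unfolding square_integrable_def by (blast intro: vorticity_measurable vorticity_square_integrable)

lemma vorticity_add:
  assumes f: "vorticity f" and g: "vorticity g"
  shows "vorticity (\<lambda>x. f x + g x)"
proof (rule vorticityI)
  note [measurable] = vorticity_measurable[OF f] vorticity_measurable[OF g]
  show "(\<lambda>x. f x + g x) \<in> borel_measurable borel" by measurable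
  show "0 \<le> f x + g x" for x by (intro add_nonneg_nonneg vorticity_nonneg f g)
  show "f x + g x = 0" if "snd x \<le> 0" for x
    by (simp add: vorticity_zero[OF f that] vorticity_zero[OF g that])
  show "integrable lborel (\<lambda>x. f x + g x)"
    by (intro Bochner_Integration.integrable_add vorticity_integrable f g)
  show "integrable lborel (\<lambda>x. snd x * (f x + g x))"
    unfolding distrib_left by (intro Bochner_Integration.integrable_add vorticity_impulse_integrable f g)
  show "integrable lborel (\<lambda>x. (f x + g x)\<^sup>2)"
    using square_integrable_add[OF vorticity_square[OF f] vorticity_square[OF g]]
    by (simp add: square_integrable_def)
qed

lemma vorticity_cmult:
  assumes f: "vorticity f" and c: "0 \<le> c"
  shows "vorticity (\<lambda>x. c * f x)"
proof (rule vorticityI)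
  note [measurable] = vorticity_measurable[OF f]
  show "(\<lambda>x. c * f x) \<in> borel_measurable borel" by measurable
  show "0 \<le> c * f x" for x by (intro mult_nonneg_nonneg vorticity_nonneg f c)
  show "c * f x = 0" if "snd x \<le> 0" for x by (simp add: vorticity_zero[OF f that])
  show "integrable lborel (\<lambda>x. c * f x)" by (intro integrable_mult_right vorticity_integrable f)
  show "integrable lborel (\<lambda>x. snd x * (c * f x))"
    using vorticity_impulse_integrable[OF f] by (simp add: mult.left_commute)
  show "integrable lborel (\<lambda>x. (c * f x)\<^sup>2)"
    using vorticity_square_integrable[OF f] by (simp add: power_mult_distrib)
qed

definition cutoff :: "(real \<times> real) set \<Rightarrow> (real \<times> real \<Rightarrow> real) \<Rightarrow> real \<times> real \<Rightarrow> real" where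
  "cutoff A f x = indicator A x * f x"

lemma cutoff_le: "0 \<le> f x \<Longrightarrow> cutoff A f x \<le> f x"
  by (simp add: cutoff_def indicator_def)

lemma vorticity_le:
  assumes f: "vorticity f" and [measurable]: "g \<in> borel_measurable borel"
    and g: "\<And>x. 0 \<le> g x" "\<And>x. g x \<le> f x"
  shows "vorticity g"
proof (rule vorticityI)
  note [measurable] = vorticity_measurable[OF f]
  show "g \<in> borel_measurable borel" by fact
  show "0 \<le> g x" for x by (rule g)
  show z: "g x = 0" if "snd x \<le> 0" for x
    using g(1)[of x] g(2)[of x] vorticity_zero[OF f that] by linarith
  show "integrable lborel g"
    by (rule Bochner_Integration.integrable_bound[OF vorticity_integrable[OF f]])
      (auto intro!: AE_I2 simp: abs_of_nonneg g order_trans[OF g(2) abs_ge_self])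
  have "\<bar>snd x * g x\<bar> \<le> \<bar>snd x * f x\<bar>" for x
    using g(1)[of x] g(2)[of x] by (simp add: abs_mult mult_left_mono)
  then show "integrable lborel (\<lambda>x. snd x * g x)"
    by (intro Bochner_Integration.integrable_bound[OF vorticity_impulse_integrable[OF f]]) (auto intro!: AE_I2)
  have "(g x)\<^sup>2 \<le> (f x)\<^sup>2" for x using g(1)[of x] g(2)[of x] by (intro power_mono)
  then show "integrable lborel (\<lambda>x. (g x)\<^sup>2)"
    by (intro Bochner_Integration.integrable_bound[OF vorticity_square_integrable[OF f]]) (auto intro!: AE_I2)
qed

lemma vorticity_cutoff:
  assumes f: "vorticity f" and [measurable]: "A \<in> sets borel"
  shows "vorticity (cutoff A f)"
proof (rule vorticity_le[OF f])
  note [measurable] = vorticity_measurable[OF f]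
  show "cutoff A f \<in> borel_measurable borel" unfolding cutoff_def by measurable
  show "0 \<le> cutoff A f x" for x by (simp add: cutoff_def vorticity_nonneg[OF f])
  show "cutoff A f x \<le> f x" for x by (intro cutoff_le vorticity_nonneg f)
qed

text \<open>Adding \<open>(a, - h)\<close> to the argument moves the profile up by \<open>h\<close>.
  Only upward moves keep the support in the half plane, hence \<open>0 \<le> h\<close>, and each
  unit of mass gains impulse \<open>h\<close>.\<close>

lemma vorticity_translate:
  assumes f: "vorticity f" and h: "0 \<le> h"
  shows "vorticity (\<lambda>x. f (x + (a, - h)))"
    and "mass (\<lambda>x. f (x + (a, - h))) = mass f"
    and "enstrophy (\<lambda>x. f (x + (a, - h))) = enstrophy f"
    and "impulse (\<lambda>x. f (x + (a, - h))) = impulse f + h * mass f"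
proof -
  note [measurable] = vorticity_measurable[OF f]
  have 1: "integrable lborel (\<lambda>x. f (x + (a, - h)))"
    by (intro integrable_lborel_translate vorticity_integrable f) measurable
  have 2: "integrable lborel (\<lambda>x. (snd x + h) * f x)"
    using vorticity_integrable[OF f] vorticity_impulse_integrable[OF f] by (simp add: distrib_right)
  have eq: "(snd (x + (a, - h)) + h) * f (x + (a, - h)) = snd x * f (x + (a, - h))" for x
    by (simp add: snd_add)
  have 3: "integrable lborel (\<lambda>x. snd x * f (x + (a, - h)))"
    using integrable_lborel_translate[OF _ 2, of "(a, - h)"] unfolding eq by simp
  show "vorticity (\<lambda>x. f (x + (a, - h)))"
  proof (rule vorticityI)
    show "(\<lambda>x. f (x + (a, - h))) \<in> borel_measurable borel" by measurable
    show "0 \<le> f (x + (a, - h))" for x by (rule vorticity_nonneg[OF f])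
    show "f (x + (a, - h)) = 0" if "snd x \<le> 0" for x
      by (rule vorticity_zero[OF f]) (use that h in \<open>simp add: snd_add\<close>)
    show "integrable lborel (\<lambda>x. (f (x + (a, - h)))\<^sup>2)"
      by (rule integrable_lborel_translate[of "\<lambda>x. (f x)\<^sup>2"]) (auto intro: vorticity_square_integrable[OF f])
  qed fact+
  show "mass (\<lambda>x. f (x + (a, - h))) = mass f"
    unfolding mass_def by (intro integral_lborel_translate) measurable
  show "enstrophy (\<lambda>x. f (x + (a, - h))) = enstrophy f"
    unfolding enstrophy_def by (rule integral_lborel_translate[of "\<lambda>x. (f x)\<^sup>2"]) measurable
  have "impulse (\<lambda>x. f (x + (a, - h))) = (\<integral>x. (snd x + h) * f x \<partial>lborel)"
    unfolding impulse_def eq[symmetric] by (rule integral_lborel_translate[of "\<lambda>x. (snd x + h) * f x"]) measurable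
  also have "\<dots> = impulse f + h * mass f"
    unfolding impulse_def mass_def distrib_right
    using vorticity_integrable[OF f] vorticity_impulse_integrable[OF f] by simp
  finally show "impulse (\<lambda>x. f (x + (a, - h))) = impulse f + h * mass f" .
qed

lemma sqrt_weight:
  assumes f: "vorticity f"
  shows "integrable lborel (\<lambda>x. sqrt (1 + max 0 (snd x)) * f x)"
    and "(\<integral>x. sqrt (1 + max 0 (snd x)) * f x \<partial>lborel) \<le> mass f + impulse f"
proof -
  note [measurable] = vorticity_measurable[OF f]
  have le: "sqrt (1 + max 0 (snd x)) * f x \<le> f x + snd x * f x" for x
  proof (cases "0 < snd x")
    case True
    have "1 + snd x \<le> (1 + snd x)\<^sup>2" using True by (simp add: power2_sum)
    then have "sqrt (1 + snd x) \<le> 1 + snd x" using True by (intro real_le_lsqrt) auto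
    from mult_right_mono[OF this vorticity_nonneg[OF f, of x]] True show ?thesis
      by (simp add: distrib_right)
  next
    case False
    then show ?thesis using vorticity_zero[OF f, of x] by simp
  qed
  have int: "integrable lborel (\<lambda>x. f x + snd x * f x)"
    by (intro Bochner_Integration.integrable_add vorticity_integrable vorticity_impulse_integrable f)
  show i: "integrable lborel (\<lambda>x. sqrt (1 + max 0 (snd x)) * f x)"
  proof (rule Bochner_Integration.integrable_bound[OF int])
    show "AE x in lborel. norm (sqrt (1 + max 0 (snd x)) * f x) \<le> norm (f x + snd x * f x)"
      using le vorticity_nonneg[OF f] by (intro AE_I2) (auto simp: abs_mult intro: order_trans[OF le abs_ge_self])
  qed measurable
  have "(\<integral>x. sqrt (1 + max 0 (snd x)) * f x \<partial>lborel) \<le> (\<integral>x. f x + snd x * f x \<partial>lborel)"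
    by (rule integral_mono[OF i int]) (rule le)
  also have "\<dots> = mass f + impulse f"
    unfolding mass_def impulse_def
    by (rule Bochner_Integration.integral_add[OF vorticity_integrable[OF f] vorticity_impulse_integrable[OF f]])
  finally show "(\<integral>x. sqrt (1 + max 0 (snd x)) * f x \<partial>lborel) \<le> mass f + impulse f" .
qed

section \<open>Integrability and algebra of the pairing\<close>

lemma pairing_measurable:
  assumes "kernel k" "f \<in> borel_measurable borel" "g \<in> borel_measurable borel"
  shows "(\<lambda>z. k (fst z) (snd z) * f (fst z) * g (snd z)) \<in> borel_measurable (lborel \<Otimes>\<^sub>M lborel)"
proof -
  note [measurable] = kernel_measurable[OF assms(1)] assms(2,3)
  show ?thesis by measurable
qed

text \<open>Tonelli: a pointwise bound \<open>w\<close> for the potential of \<open>g\<close>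
  becomes a bound for the pairing once it is integrated against \<open>f\<close>. Since
  \<open>f\<close> vanishes below the boundary, \<open>w\<close> has to be controlled in the open
  half plane only. The kernel estimates that follow are instances that differ in the choice of
  \<open>w\<close>.\<close>

lemma pairing_bound:
  assumes k: "kernel k" and f: "vorticity f" and g: "vorticity g"
    and b: "\<And>x. 0 < snd x \<Longrightarrow> (\<integral>\<^sup>+y. ennreal (k x y * g y) \<partial>lborel) \<le> ennreal (w x)"
    and wi: "integrable lborel (\<lambda>x. w x * f x)" and w0: "\<And>x. 0 < snd x \<Longrightarrow> 0 \<le> w x"
  shows pairing_bound_integrable: "integrable (lborel \<Otimes>\<^sub>M lborel) (\<lambda>z. k (fst z) (snd z) * f (fst z) * g (snd z))"
    and pairing_bound_le: "pairing k f g \<le> (\<integral>x. w x * f x \<partial>lborel)"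
proof -
  note [measurable] = pairing_measurable[OF k vorticity_measurable[OF f] vorticity_measurable[OF g]]
    kernel_measurable_right[OF k] vorticity_measurable[OF g] vorticity_measurable[OF f]
  have nn: "0 \<le> k x y * f x * g y" for x y
    by (intro mult_nonneg_nonneg vorticity_nonneg f g kernel_nonneg[OF k])
  have wf: "0 \<le> w x * f x" for x
    using w0[of x] vorticity_nonneg[OF f, of x] vorticity_zero[OF f, of x] by (cases "0 < snd x") auto
  have "(\<integral>\<^sup>+z. ennreal (k (fst z) (snd z) * f (fst z) * g (snd z)) \<partial>(lborel \<Otimes>\<^sub>M lborel))
      = (\<integral>\<^sup>+x. \<integral>\<^sup>+y. ennreal (k x y * f x * g y) \<partial>lborel \<partial>lborel)"
    by (subst lborel.nn_integral_fst[symmetric]) auto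
  also have "\<dots> \<le> (\<integral>\<^sup>+x. ennreal (w x * f x) \<partial>lborel)"
  proof (rule nn_integral_mono)
    fix x :: "real \<times> real"
    show "(\<integral>\<^sup>+y. ennreal (k x y * f x * g y) \<partial>lborel) \<le> ennreal (w x * f x)"
    proof (cases "0 < snd x")
      case True
      have "(\<integral>\<^sup>+y. ennreal (k x y * f x * g y) \<partial>lborel) = (\<integral>\<^sup>+y. ennreal (f x) * ennreal (k x y * g y) \<partial>lborel)"
        using vorticity_nonneg[OF f] vorticity_nonneg[OF g] kernel_nonneg[OF k]
        by (simp only: ennreal_mult[symmetric] mult_nonneg_nonneg) (simp only: mult_ac)
      also have "\<dots> = ennreal (f x) * (\<integral>\<^sup>+y. ennreal (k x y * g y) \<partial>lborel)"
        by (rule nn_integral_cmult) measurable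
      also have "\<dots> \<le> ennreal (f x) * ennreal (w x)"
        by (intro mult_left_mono b True) simp
      also have "\<dots> = ennreal (w x * f x)"
        using vorticity_nonneg[OF f, of x] w0[OF True] by (simp add: ennreal_mult[symmetric] mult.commute)
      finally show ?thesis .
    next
      case False
      then have "f x = 0" by (intro vorticity_zero[OF f]) simp
      then show ?thesis by simp
    qed
  qed
  also have "\<dots> = ennreal (\<integral>x. w x * f x \<partial>lborel)"
    by (rule nn_integral_eq_integral[OF wi]) (simp add: wf)
  finally have le: "(\<integral>\<^sup>+z. ennreal (k (fst z) (snd z) * f (fst z) * g (snd z)) \<partial>(lborel \<Otimes>\<^sub>M lborel))
      \<le> ennreal (\<integral>x. w x * f x \<partial>lborel)" .
  show int: "integrable (lborel \<Otimes>\<^sub>M lborel) (\<lambda>z. k (fst z) (snd z) * f (fst z) * g (snd z))"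
  proof (rule integrableI_bounded)
    show "(\<integral>\<^sup>+z. ennreal (norm (k (fst z) (snd z) * f (fst z) * g (snd z))) \<partial>(lborel \<Otimes>\<^sub>M lborel)) < \<infinity>"
      using le_less_trans[OF le, of \<infinity>] by (simp only: real_norm_def abs_of_nonneg[OF nn] ennreal_less_top infinity_ennreal_def)
  qed measurable
  have "ennreal (pairing k f g) \<le> ennreal (\<integral>x. w x * f x \<partial>lborel)"
    using le unfolding pairing_def by (subst (asm) nn_integral_eq_integral[OF int]) (auto simp: nn)
  then show "pairing k f g \<le> (\<integral>x. w x * f x \<partial>lborel)"
    by (subst (asm) ennreal_le_iff) (auto intro!: integral_nonneg_AE AE_I2 wf)
qed

definition interaction :: "(real \<times> real \<Rightarrow> real) \<Rightarrow> (real \<times> real \<Rightarrow> real) \<Rightarrow> real" where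
  "interaction = pairing hgreen"

text \<open>Domination by \<open>hgreen\<close> is what makes pairings integrable; the truncated
  kernels and the error kernels below are all restrictions of \<open>hgreen\<close> and share its
  integrability in this way.\<close>

definition subkernel :: "(real \<times> real \<Rightarrow> real \<times> real \<Rightarrow> real) \<Rightarrow> bool" where
  "subkernel k \<longleftrightarrow> kernel k \<and> (\<forall>x y. k x y \<le> hgreen x y)"

lemma subkernel_hgreen: "subkernel hgreen"
  by (simp add: subkernel_def kernel_hgreen)

lemma interaction_le:
  assumes f: "vorticity f" and g: "vorticity g" and s: "0 < s"
  shows "interaction f g \<le> (8 * s + enstrophy g / (2 * s) + mass g + impulse g) * (mass f + impulse f)"
    (is "_ \<le> ?N * _")
proof -
  have N: "0 \<le> ?N"
    using s mass_nonneg[OF g] impulse_nonneg[OF g] enstrophy_nonneg[of g] by simp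
  have "interaction f g \<le> (\<integral>x. sqrt (1 + max 0 (snd x)) * ?N * f x \<partial>lborel)"
    unfolding interaction_def
  proof (rule pairing_bound_le[OF kernel_hgreen f g])
    show "integrable lborel (\<lambda>x. sqrt (1 + max 0 (snd x)) * ?N * f x)"
      using sqrt_weight(1)[OF f] by (simp add: mult.assoc mult.left_commute[of _ ?N])
    show "0 \<le> sqrt (1 + max 0 (snd x)) * ?N" for x by (intro mult_nonneg_nonneg N) simp
  qed (rule potential_le[OF g s])
  also have "\<dots> = ?N * (\<integral>x. sqrt (1 + max 0 (snd x)) * f x \<partial>lborel)"
    by (simp add: mult.assoc mult.left_commute[of _ ?N])
  also have "\<dots> \<le> ?N * (mass f + impulse f)"
    by (intro mult_left_mono sqrt_weight f N)
  finally show ?thesis .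
qed

lemma pairing_integrable:
  assumes k: "subkernel k" and f: "vorticity f" and g: "vorticity g"
  shows "integrable (lborel \<Otimes>\<^sub>M lborel) (\<lambda>z. k (fst z) (snd z) * f (fst z) * g (snd z))"
proof -
  have k': "kernel k" and le: "\<And>x y. k x y \<le> hgreen x y" using k by (auto simp: subkernel_def)
  let ?N = "8 + enstrophy g / 2 + mass g + impulse g"
  have N: "0 \<le> ?N"
    using mass_nonneg[OF g] impulse_nonneg[OF g] enstrophy_nonneg[of g] by simp
  show ?thesis
  proof (rule pairing_bound_integrable[OF k' f g])
    show "integrable lborel (\<lambda>x. (sqrt (1 + max 0 (snd x)) * ?N) * f x)"
      using sqrt_weight(1)[OF f] by (simp add: mult.assoc mult.left_commute[of _ ?N])
    show "0 \<le> sqrt (1 + max 0 (snd x)) * ?N" for x by (intro mult_nonneg_nonneg N) simp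
    show "(\<integral>\<^sup>+y. ennreal (k x y * g y) \<partial>lborel) \<le> ennreal (sqrt (1 + max 0 (snd x)) * ?N)" for x
    proof -
      have "(\<integral>\<^sup>+y. ennreal (k x y * g y) \<partial>lborel) \<le> (\<integral>\<^sup>+y. ennreal (hgreen x y * g y) \<partial>lborel)"
        by (intro nn_integral_mono ennreal_leI mult_right_mono le vorticity_nonneg g)
      also have "\<dots> \<le> ennreal (sqrt (1 + max 0 (snd x)) * ?N)"
        using potential_le[OF g, of 1 x] by simp
      finally show ?thesis .
    qed
  qed
qed

lemma pairing_nonneg: "kernel k \<Longrightarrow> vorticity f \<Longrightarrow> vorticity g \<Longrightarrow> 0 \<le> pairing k f g"
  unfolding pairing_def
  by (intro integral_nonneg_AE AE_I2 mult_nonneg_nonneg vorticity_nonneg kernel_nonneg)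

lemma pairing_mono:
  assumes k: "subkernel k" "subkernel k'" and f: "vorticity f" "vorticity f'" and g: "vorticity g" "vorticity g'"
    and le: "\<And>x y. k x y \<le> k' x y" "\<And>x. f x \<le> f' x" "\<And>x. g x \<le> g' x"
  shows "pairing k f g \<le> pairing k' f' g'"
  unfolding pairing_def
proof (rule integral_mono[OF pairing_integrable[OF k(1) f(1) g(1)] pairing_integrable[OF k(2) f(2) g(2)]])
  fix z :: "(real \<times> real) \<times> real \<times> real"
  have "0 \<le> k' (fst z) (snd z)" using k(2) by (auto simp: subkernel_def kernel_nonneg)
  then show "k (fst z) (snd z) * f (fst z) * g (snd z) \<le> k' (fst z) (snd z) * f' (fst z) * g' (snd z)"
    using vorticity_nonneg[OF f(1), of "fst z"] vorticity_nonneg[OF f(2), of "fst z"]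
      vorticity_nonneg[OF g(1), of "snd z"]
    by (intro mult_mono le mult_nonneg_nonneg) auto
qed

lemma pairing_add_left:
  assumes "subkernel k" "vorticity f" "vorticity f'" "vorticity g"
  shows "pairing k (\<lambda>x. f x + f' x) g = pairing k f g + pairing k f' g"
  unfolding pairing_def using pairing_integrable[OF assms(1,2,4)] pairing_integrable[OF assms(1,3,4)]
  by (simp add: distrib_left distrib_right)

lemma pairing_add_right:
  assumes "subkernel k" "vorticity f" "vorticity g" "vorticity g'"
  shows "pairing k f (\<lambda>x. g x + g' x) = pairing k f g + pairing k f g'"
  unfolding pairing_def using pairing_integrable[OF assms(1,2,3)] pairing_integrable[OF assms(1,2,4)]
  by (simp add: distrib_left distrib_right)

lemma pairing_cmult_left: "pairing k (\<lambda>x. c * f x) g = c * pairing k f g"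
  unfolding pairing_def by (simp add: mult.left_commute[of _ c] mult.assoc)

lemma pairing_cmult_right: "pairing k f (\<lambda>x. c * g x) = c * pairing k f g"
  unfolding pairing_def by (simp add: mult.left_commute[of _ c] mult.assoc)

lemma pairing_swap:
  assumes "kernel k" "f \<in> borel_measurable borel" "g \<in> borel_measurable borel"
  shows "pairing k f g = pairing (\<lambda>x y. k y x) g f"
proof -
  show ?thesis
    unfolding pairing_def using lborel_pair.integral_product_swap[OF pairing_measurable[OF assms]]
    by (simp add: split_beta' mult.commute mult.left_commute)
qed

lemma interaction_sym:
  assumes "vorticity f" "vorticity g"
  shows "interaction f g = interaction g f"
  unfolding interaction_def
  using pairing_swap[OF kernel_hgreen vorticity_measurable[OF assms(1)] vorticity_measurable[OF assms(2)]]
  by (simp add: hgreen_sym[symmetric])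

section \<open>The potential (stream function) of a vorticity\<close>

definition potential :: "(real \<times> real \<Rightarrow> real) \<Rightarrow> real \<times> real \<Rightarrow> real" where
  "potential g x = (\<integral>y. hgreen x y * g y \<partial>lborel)"

lemma potential_integrable:
  assumes g: "vorticity g"
  shows "integrable lborel (\<lambda>y. hgreen x y * g y)"
proof (rule integrableI_bounded)
  note [measurable] = vorticity_measurable[OF g] kernel_measurable_right[OF kernel_hgreen, of x]
  show "(\<lambda>y. hgreen x y * g y) \<in> borel_measurable lborel" by measurable
  have "(\<integral>\<^sup>+y. ennreal (hgreen x y * g y) \<partial>lborel) < \<infinity>"
    by (rule le_less_trans[OF potential_le[OF g, of 1]]) auto
  then show "(\<integral>\<^sup>+y. ennreal (norm (hgreen x y * g y)) \<partial>lborel) < \<infinity>"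
    by (simp add: hgreen_nonneg vorticity_nonneg[OF g] del: ennreal_mult)
qed

lemma potential_measurable [measurable]:
  assumes g: "vorticity g"
  shows "potential g \<in> borel_measurable borel"
proof -
  note [measurable] = vorticity_measurable[OF g]
  have "(\<lambda>x. \<integral>y. hgreen (fst (x, y)) (snd (x, y)) * g y \<partial>lborel) \<in> borel_measurable borel"
    by measurable
  then show ?thesis by (simp add: potential_def[abs_def])
qed

lemma interaction_potential:
  assumes f: "vorticity f" and g: "vorticity g"
  shows "interaction f g = (\<integral>x. f x * potential g x \<partial>lborel)"
    and interaction_potential_integrable: "integrable lborel (\<lambda>x. f x * potential g x)"
proof -
  have eq: "(\<integral>y. hgreen x y * f x * g y \<partial>lborel) = f x * potential g x" for x
    unfolding potential_def by (simp add: mult.commute[of _ "f x"] mult.assoc)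
  note int = pairing_integrable[OF subkernel_hgreen f g]
  show "interaction f g = (\<integral>x. f x * potential g x \<partial>lborel)"
    unfolding interaction_def pairing_def using lborel_pair.integral_fst'[OF int] by (simp add: eq)
  show "integrable lborel (\<lambda>x. f x * potential g x)"
    using lborel_pair.integrable_fst'[OF int] by (simp add: eq)
qed

section \<open>Truncation of the kernel\<close>

definition hcut :: "((real \<times> real) \<times> real \<times> real) set \<Rightarrow> real \<times> real \<Rightarrow> real \<times> real \<Rightarrow> real" where
  "hcut A x y = indicator A (x, y) * hgreen x y"

lemma subkernel_hcut:
  assumes [measurable]: "A \<in> sets (borel \<Otimes>\<^sub>M borel)"
  shows "subkernel (hcut A)"
proof -
  have "(\<lambda>z. hcut A (fst z) (snd z)) \<in> borel_measurable (borel \<Otimes>\<^sub>M borel)"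
    unfolding hcut_def by simp
  moreover have "0 \<le> hcut A x y \<and> hcut A x y \<le> hgreen x y" for x y
    by (simp add: hcut_def hgreen_nonneg indicator_def)
  ultimately show ?thesis by (simp only: subkernel_def kernel_def) blast
qed

lemma kernel_hcut: "A \<in> sets (borel \<Otimes>\<^sub>M borel) \<Longrightarrow> kernel (hcut A)"
  using subkernel_hcut by (simp add: subkernel_def)

lemma borel_pair: "borel \<Otimes>\<^sub>M borel = (borel :: ((real \<times> real) \<times> real \<times> real) measure)"
  by (rule borel_prod)

lemma borel_pair_open: "open A \<Longrightarrow> A \<in> sets (borel \<Otimes>\<^sub>M borel)"
  for A :: "((real \<times> real) \<times> real \<times> real) set"
  unfolding borel_pair by simp

lemma borel_pair_closed: "closed A \<Longrightarrow> A \<in> sets (borel \<Otimes>\<^sub>M borel)"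
  for A :: "((real \<times> real) \<times> real \<times> real) set"
  unfolding borel_pair by simp

lemma borel_pair_height_dist:
  fixes c :: real
  shows "{z::(real \<times> real) \<times> real \<times> real. c < snd (fst z)} \<in> sets (borel \<Otimes>\<^sub>M borel)"
    and "{z::(real \<times> real) \<times> real \<times> real. c < snd (snd z)} \<in> sets (borel \<Otimes>\<^sub>M borel)"
    and "{z::(real \<times> real) \<times> real \<times> real. dist (fst z) (snd z) < c} \<in> sets (borel \<Otimes>\<^sub>M borel)"
    and "{z::(real \<times> real) \<times> real \<times> real. c < dist (fst z) (snd z)} \<in> sets (borel \<Otimes>\<^sub>M borel)"
  by - (rule borel_pair_open, intro open_Collect_less continuous_intros)+

text \<open>At distance more than \<open>R\<close> the bound by t^2 gives at most
  \<open>snd x * snd y / R\<^sup>2\<close>, which separates the variables and leaves the product of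
  the impulses.\<close>

lemma far_pairing_le:
  assumes f: "vorticity f" and g: "vorticity g" and R: "0 < R"
  shows "pairing (hcut {z. R < dist (fst z) (snd z)}) f g \<le> impulse f * impulse g / R\<^sup>2"
    (is "pairing ?k f g \<le> _")
proof -
  note [measurable] = vorticity_measurable[OF g]
  have "pairing ?k f g \<le> (\<integral>x. (snd x * impulse g / R\<^sup>2) * f x \<partial>lborel)"
  proof (rule pairing_bound_le[OF kernel_hcut f g])
    show "{z::(real \<times> real) \<times> real \<times> real. R < dist (fst z) (snd z)} \<in> sets (borel \<Otimes>\<^sub>M borel)"
      by (rule borel_pair_height_dist)
    show "integrable lborel (\<lambda>x. snd x * impulse g / R\<^sup>2 * f x)"
      using integrable_mult_right[OF vorticity_impulse_integrable[OF f], of "impulse g / R\<^sup>2"]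
      by (simp add: mult_ac)
    fix x :: "real \<times> real" assume x: "0 < snd x"
    show "0 \<le> snd x * impulse g / R\<^sup>2" using x impulse_nonneg[OF g] by simp
    have "?k x y * g y \<le> (snd x / R\<^sup>2) * (snd y * g y)" for y
    proof (cases "R < dist x y \<and> 0 < snd y")
      case True
      have "hgreen x y \<le> snd x * snd y / (dist x y)\<^sup>2"
        using hgreen_le_hratio_sq[of x y] x True by (simp add: hratio_def power_divide)
      also have "\<dots> \<le> snd x * snd y / R\<^sup>2"
        using True R x by (intro divide_left_mono power_mono mult_pos_pos) auto
      finally have "hgreen x y * g y \<le> snd x * snd y / R\<^sup>2 * g y"
        by (rule mult_right_mono[OF _ vorticity_nonneg[OF g]])
      then show ?thesis using True by (simp add: hcut_def)
    next
      case False
      then have "?k x y * g y = 0" using vorticity_zero[OF g, of y] by (auto simp: hcut_def not_less)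
      moreover have "0 \<le> (snd x / R\<^sup>2) * (snd y * g y)"
        using x by (intro mult_nonneg_nonneg vorticity_height_nonneg[OF g]) auto
      ultimately show ?thesis by (simp only:)
    qed
    then have "(\<integral>\<^sup>+y. ennreal (?k x y * g y) \<partial>lborel) \<le> (\<integral>\<^sup>+y. ennreal ((snd x / R\<^sup>2) * (snd y * g y)) \<partial>lborel)"
      by (intro nn_integral_mono ennreal_leI)
    also have "\<dots> = ennreal (\<integral>y. (snd x / R\<^sup>2) * (snd y * g y) \<partial>lborel)"
      using x by (intro nn_integral_eq_integral integrable_mult_right vorticity_impulse_integrable g
          AE_I2 mult_nonneg_nonneg vorticity_height_nonneg[OF g]) auto
    also have "(\<integral>y. (snd x / R\<^sup>2) * (snd y * g y) \<partial>lborel) = snd x * impulse g / R\<^sup>2"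
      unfolding impulse_def by simp
    finally show "(\<integral>\<^sup>+y. ennreal (?k x y * g y) \<partial>lborel) \<le> ennreal (snd x * impulse g / R\<^sup>2)" .
  qed
  also have "\<dots> = (\<integral>x. (impulse g / R\<^sup>2) * (snd x * f x) \<partial>lborel)"
    by (rule Bochner_Integration.integral_cong) (simp_all add: mult_ac)
  also have "\<dots> = impulse f * impulse g / R\<^sup>2"
    unfolding impulse_def[of f] by simp
  finally show ?thesis .
qed

text \<open>The potential grows like the square root of the height while the impulse weighs
  linearly. Above height \<open>k\<close> one has sqrt(1 + x2) \<le> 2 x2 / sqrt k, so the impulse
  pays for the potential with a factor \<open>1 / sqrt k\<close> to spare.\<close>

lemma high_pairing_le:
  assumes f: "vorticity f" and g: "vorticity g" and k: "1 \<le> k"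
  shows "pairing (hcut {z. k < snd (fst z)}) f g
    \<le> 2 * (8 + enstrophy g / 2 + mass g + impulse g) / sqrt k * impulse f" (is "pairing ?k f g \<le> _")
proof -
  note [measurable] = vorticity_measurable[OF g]
  define N where "N = 8 + enstrophy g / 2 + mass g + impulse g"
  have N: "0 \<le> N" unfolding N_def using mass_nonneg[OF g] impulse_nonneg[OF g] enstrophy_nonneg[of g] by simp
  have eq: "(2 * snd x / sqrt k * N) * f x = (2 * N / sqrt k) * (snd x * f x)" for x
    by (simp add: divide_inverse mult_ac)
  have "pairing ?k f g \<le> (\<integral>x. (2 * snd x / sqrt k * N) * f x \<partial>lborel)"
  proof (rule pairing_bound_le[OF kernel_hcut f g])
    show "{z::(real \<times> real) \<times> real \<times> real. k < snd (fst z)} \<in> sets (borel \<Otimes>\<^sub>M borel)"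
      by (rule borel_pair_height_dist)
    show "integrable lborel (\<lambda>x. 2 * snd x / sqrt k * N * f x)"
      using integrable_mult_right[OF vorticity_impulse_integrable[OF f], of "2 * N / sqrt k"]
      unfolding eq .
    fix x :: "real \<times> real" assume x: "0 < snd x"
    show w0: "0 \<le> 2 * snd x / sqrt k * N" using x k N by (intro mult_nonneg_nonneg divide_nonneg_nonneg) auto
    show "(\<integral>\<^sup>+y. ennreal (?k x y * g y) \<partial>lborel) \<le> ennreal (2 * snd x / sqrt k * N)"
    proof (cases "k < snd x")
      case False
      then show ?thesis by (simp add: hcut_def)
    next
      case True
      have "1 + snd x \<le> (2 * snd x)\<^sup>2 / k"
      proof -
        have "(1 + snd x) * k \<le> (2 * snd x) * (2 * snd x)"
          using True k by (intro mult_mono) auto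
        then show ?thesis using k by (simp add: le_divide_eq power2_eq_square)
      qed
      then have "sqrt (1 + snd x) \<le> sqrt ((2 * snd x)\<^sup>2 / k)" by simp
      also have "\<dots> = 2 * snd x / sqrt k" using x by (simp add: real_sqrt_divide real_sqrt_mult)
      finally have le: "sqrt (1 + snd x) * N \<le> 2 * snd x / sqrt k * N" by (rule mult_right_mono[OF _ N])
      have "(\<integral>\<^sup>+y. ennreal (?k x y * g y) \<partial>lborel) \<le> ennreal (sqrt (1 + snd x) * N)"
        using potential_le[OF g, of 1 x] x True by (simp add: hcut_def N_def)
      then show ?thesis by (rule order_trans[OF _ ennreal_leI[OF le]])
    qed
  qed
  also have "\<dots> = (\<integral>x. (2 * N / sqrt k) * (snd x * f x) \<partial>lborel)"
    unfolding eq ..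
  also have "\<dots> = 2 * N / sqrt k * impulse f"
    unfolding impulse_def[of f] by (rule integral_mult_right_zero)
  finally show ?thesis unfolding N_def .
qed

text \<open>For radius \<open>1 / k\<close> the free parameter of the near-field estimate is taken
  as \<open>sqrt k\<close>: then the singular term \<open>8 * s * e\<close> and the enstrophy term
  \<open>enstrophy g / (2 * s)\<close> both decay like \<open>1 / sqrt k\<close>.\<close>

lemma near_pairing_le:
  assumes f: "vorticity f" and g: "vorticity g" and k: "1 \<le> k"
  shows "pairing (hcut {z. dist (fst z) (snd z) < 1 / k}) f g
    \<le> (8 + enstrophy g / 2) / sqrt k * (mass f + impulse f)" (is "pairing ?k f g \<le> _")
proof -
  note [measurable] = vorticity_measurable[OF g]
  define N where "N = (8 + enstrophy g / 2) / sqrt k"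
  have N: "0 \<le> N" unfolding N_def using enstrophy_nonneg[of g] k by simp
  have N': "8 * sqrt k * (1 / k) + enstrophy g / (2 * sqrt k) = N"
  proof -
    have "sqrt k * (1 / k) = 1 / sqrt k"
      using k by (simp add: real_div_sqrt divide_simps)
    then have "8 * sqrt k * (1 / k) = 8 / sqrt k" by simp
    then show ?thesis by (simp add: N_def add_divide_distrib)
  qed
  have "pairing ?k f g \<le> (\<integral>x. (sqrt (1 + max 0 (snd x)) * N) * f x \<partial>lborel)"
  proof (rule pairing_bound_le[OF kernel_hcut f g])
    show "{z::(real \<times> real) \<times> real \<times> real. dist (fst z) (snd z) < 1 / k} \<in> sets (borel \<Otimes>\<^sub>M borel)"
      by (rule borel_pair_height_dist)
    show "integrable lborel (\<lambda>x. sqrt (1 + max 0 (snd x)) * N * f x)"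
      using integrable_mult_right[OF sqrt_weight(1)[OF f], of N] by (simp add: mult_ac)
    fix x :: "real \<times> real" assume x: "0 < snd x"
    show "0 \<le> sqrt (1 + max 0 (snd x)) * N" by (intro mult_nonneg_nonneg N) simp
    have "?k x y = indicator (ball x (1/k)) y * hgreen x y" for y
      by (simp add: hcut_def indicator_def)
    then show "(\<integral>\<^sup>+y. ennreal (?k x y * g y) \<partial>lborel) \<le> ennreal (sqrt (1 + max 0 (snd x)) * N)"
      using near_potential_le[OF g x, of "1/k" "sqrt k"] k x unfolding N' by simp
  qed
  also have "\<dots> = N * (\<integral>x. sqrt (1 + max 0 (snd x)) * f x \<partial>lborel)"
    by (subst integral_mult_right_zero[symmetric]) (simp add: mult_ac)
  also have "\<dots> \<le> N * (mass f + impulse f)"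
    by (intro mult_left_mono sqrt_weight f N)
  finally show ?thesis unfolding N_def .
qed

definition trunc_set :: "real \<Rightarrow> ((real \<times> real) \<times> real \<times> real) set" where
  "trunc_set k = {z. snd (fst z) \<le> k \<and> snd (snd z) \<le> k \<and> 1 / k \<le> dist (fst z) (snd z) \<and> dist (fst z) (snd z) \<le> k}"

abbreviation htrunc :: "real \<Rightarrow> real \<times> real \<Rightarrow> real \<times> real \<Rightarrow> real" where
  "htrunc k \<equiv> hcut (trunc_set k)"

lemma trunc_set_measurable: "trunc_set k \<in> sets (borel \<Otimes>\<^sub>M borel)"
  unfolding trunc_set_def
  by (intro borel_pair_closed closed_Collect_conj closed_Collect_le continuous_intros)

lemma htrunc_le:
  assumes k: "1 \<le> k"
  shows "htrunc k x y \<le> k\<^sup>2"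
proof (cases "(x, y) \<in> trunc_set k \<and> 0 < snd x \<and> 0 < snd y")
  case True
  then have xy: "snd x \<le> k" "snd y \<le> k" "1 / k \<le> dist x y" "0 < snd x" "0 < snd y"
    by (auto simp: trunc_set_def)
  have d: "0 < dist x y" using xy(3) k by (smt (verit) divide_pos_pos)
  have "snd x * snd y \<le> k * k" using xy by (intro mult_mono) auto
  then have "sqrt (snd x * snd y) \<le> k"
    using k by (intro real_le_lsqrt) (auto simp: power2_eq_square)
  then have "hratio x y \<le> k / (1 / k)"
    unfolding hratio_def using xy k d by (intro frac_le) auto
  then have "hgreen x y \<le> k\<^sup>2" using hgreen_le_hratio[OF xy(4,5)] by (simp add: power2_eq_square)
  then show ?thesis using True by (simp add: hcut_def)
next
  case False
  then have "htrunc k x y = 0" using hgreen_eq_0[of x y] by (auto simp: hcut_def not_less)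
  then show ?thesis by simp
qed

definition bounded_vorticity :: "real \<Rightarrow> (real \<times> real \<Rightarrow> real) \<Rightarrow> bool" where
  "bounded_vorticity K f \<longleftrightarrow> vorticity f \<and> mass f \<le> K \<and> impulse f \<le> K \<and> enstrophy f \<le> K"

lemma bounded_vorticityD: "bounded_vorticity K f \<Longrightarrow> vorticity f"
  by (simp add: bounded_vorticity_def)

text \<open>The complement of \<open>trunc_set k\<close> is covered by four regions: either point
  high, points too close, points too far apart. Overlaps do no harm because everything is
  nonnegative. The two high regions contribute \<open>2 * (8 + 3 * K) * K\<close> each, the near one
  \<open>(8 + K) * (2 * K)\<close>, the far one \<open>K * K\<close>, all over
  \<open>sqrt k\<close>; this adds up to the stated constant. The error depends on \<open>f\<close>
  and \<open>g\<close> through \<open>K\<close> alone.\<close>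

lemma interaction_trunc:
  assumes fK: "bounded_vorticity K f" and gK: "bounded_vorticity K g" and k: "1 \<le> k"
  shows "interaction f g \<le> pairing (htrunc k) f g + K * (48 + 15 * K) / sqrt k"
proof -
  have f: "vorticity f" and g: "vorticity g" using fK gK by (auto simp: bounded_vorticity_def)
  let ?A1 = "{z::(real \<times> real) \<times> real \<times> real. k < snd (fst z)}"
  let ?A2 = "{z::(real \<times> real) \<times> real \<times> real. k < snd (snd z)}"
  let ?A3 = "{z::(real \<times> real) \<times> real \<times> real. dist (fst z) (snd z) < 1 / k}"
  let ?A4 = "{z::(real \<times> real) \<times> real \<times> real. k < dist (fst z) (snd z)}"
  let ?F = "\<lambda>A z. hcut A (fst z) (snd z) * f (fst z) * g (snd z)"
  have s: "A \<in> {trunc_set k, ?A1, ?A2, ?A3, ?A4} \<Longrightarrow> A \<in> sets (borel \<Otimes>\<^sub>M borel)" for A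
    using trunc_set_measurable borel_pair_height_dist by blast
  have i: "A \<in> {trunc_set k, ?A1, ?A2, ?A3, ?A4} \<Longrightarrow> integrable (lborel \<Otimes>\<^sub>M lborel) (?F A)" for A
    by (intro pairing_integrable subkernel_hcut f g s)
  have "interaction f g \<le> (\<integral>z. ?F (trunc_set k) z + (?F ?A1 z + (?F ?A2 z + (?F ?A3 z + ?F ?A4 z))) \<partial>(lborel \<Otimes>\<^sub>M lborel))"
    unfolding interaction_def pairing_def
  proof (rule integral_mono[OF pairing_integrable[OF subkernel_hgreen f g]])
    show "integrable (lborel \<Otimes>\<^sub>M lborel) (\<lambda>z. ?F (trunc_set k) z + (?F ?A1 z + (?F ?A2 z + (?F ?A3 z + ?F ?A4 z))))"
      by (intro Bochner_Integration.integrable_add i) auto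
    fix z :: "(real \<times> real) \<times> real \<times> real"
    have "0 \<le> hgreen (fst z) (snd z) * f (fst z) * g (snd z)"
      by (intro mult_nonneg_nonneg hgreen_nonneg vorticity_nonneg f g)
    moreover have "1 \<le> indicator (trunc_set k) z + (indicator ?A1 z + (indicator ?A2 z + (indicator ?A3 z + indicator ?A4 z :: real)))"
      by (auto simp: indicator_def trunc_set_def)
    ultimately have "1 * (hgreen (fst z) (snd z) * f (fst z) * g (snd z)) \<le>
      (indicator (trunc_set k) z + (indicator ?A1 z + (indicator ?A2 z + (indicator ?A3 z + indicator ?A4 z))))
      * (hgreen (fst z) (snd z) * f (fst z) * g (snd z))"
      by (intro mult_right_mono)
    then show "hgreen (fst z) (snd z) * f (fst z) * g (snd z) \<le> ?F (trunc_set k) z + (?F ?A1 z + (?F ?A2 z + (?F ?A3 z + ?F ?A4 z)))"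
      unfolding hcut_def by (simp only: distrib_right mult_1 prod.collapse mult.assoc)
  qed
  also have "\<dots> = pairing (htrunc k) f g + (pairing (hcut ?A1) f g + (pairing (hcut ?A2) f g
      + (pairing (hcut ?A3) f g + pairing (hcut ?A4) f g)))"
    unfolding pairing_def
    by (subst Bochner_Integration.integral_add, (intro Bochner_Integration.integrable_add i; simp)+)+ (rule refl)
  finally have main: "interaction f g \<le> \<dots>" .
  define r where "r = sqrt k"
  have r: "1 \<le> r" using k by (simp add: r_def)
  have K: "mass f \<le> K" "impulse f \<le> K" "mass g \<le> K" "impulse g \<le> K" "enstrophy f \<le> K" "enstrophy g \<le> K"
    using fK gK by (auto simp: bounded_vorticity_def)
  have K0: "0 \<le> K" using K(1) mass_nonneg[OF f] by linarith
  note nn = mass_nonneg[OF f] mass_nonneg[OF g] impulse_nonneg[OF f] impulse_nonneg[OF g]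
    enstrophy_nonneg[of f] enstrophy_nonneg[of g]
  have high: "2 * (8 + enstrophy v / 2 + mass v + impulse v) / r * impulse u \<le> 2 * (8 + 3 * K) / r * K"
    if "mass v \<le> K" "impulse v \<le> K" "enstrophy v \<le> K" "impulse u \<le> K" "0 \<le> impulse u"
      "0 \<le> mass v" "0 \<le> impulse v" "0 \<le> enstrophy v" for u v
    using that r K0 by (intro mult_mono divide_right_mono) auto
  have 1: "pairing (hcut ?A1) f g \<le> 2 * (8 + 3 * K) / r * K"
    using high_pairing_le[OF f g k] high[of g f] K nn unfolding r_def by linarith
  \<comment> \<open>The kernel is symmetric, so exchanging the arguments reduces a high second point
    to a high first point.\<close>
  have "pairing (hcut ?A2) f g = pairing (hcut ?A1) g f"
    by (subst pairing_swap[OF kernel_hcut]) (auto simp: hcut_def[abs_def] hgreen_sym indicator_def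
        intro!: s vorticity_measurable f g arg_cong[where f = "\<lambda>k. pairing k g f"])
  then have 2: "pairing (hcut ?A2) f g \<le> 2 * (8 + 3 * K) / r * K"
    using high_pairing_le[OF g f k] high[of f g] K nn unfolding r_def by linarith
  have "(8 + enstrophy g / 2) / r * (mass f + impulse f) \<le> (8 + K) / r * (2 * K)"
    using K nn r K0 by (intro mult_mono divide_right_mono) auto
  then have 3: "pairing (hcut ?A3) f g \<le> (8 + K) / r * (2 * K)"
    using near_pairing_le[OF f g k] unfolding r_def by linarith
  have "impulse f * impulse g / k\<^sup>2 \<le> K * K / r"
  proof (rule frac_le)
    have "k * 1 \<le> k * k" using k by (intro mult_left_mono) auto
    moreover have "r * 1 \<le> r * r" using r by (intro mult_left_mono) auto
    moreover have "r * r = k" using k by (simp add: r_def)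
    ultimately show "r \<le> k\<^sup>2" by (simp add: power2_eq_square)
  qed (use K nn r K0 in \<open>auto intro: mult_mono\<close>)
  moreover have "pairing (hcut ?A4) f g \<le> impulse f * impulse g / k\<^sup>2"
    by (rule far_pairing_le[OF f g]) (use k in simp)
  ultimately have 4: "pairing (hcut ?A4) f g \<le> K * K / r" by simp
  have "K * (48 + 15 * K) / r = 2 * (8 + 3 * K) / r * K + (2 * (8 + 3 * K) / r * K + ((8 + K) / r * (2 * K) + K * K / r))"
    using r by (simp add: field_simps)
  then show ?thesis using main 1 2 3 4 unfolding r_def by linarith
qed

definition slab :: "real \<Rightarrow> real \<Rightarrow> (real \<times> real) set" where
  "slab k a = {x. \<bar>fst x - a\<bar> \<le> k \<and> snd x \<le> k}"

lemma slab_closed: "closed (slab k a)"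
  unfolding slab_def by (intro closed_Collect_conj closed_Collect_le continuous_intros)

lemma slab_borel [measurable]: "slab k a \<in> sets borel"
  by (intro borel_closed slab_closed)

text \<open>Seen from \<open>x\<close>, the truncated kernel is at most \<open>k\<^sup>2\<close> and
  vanishes outside the slab centred at \<open>fst x\<close>. If no slab contains more mass than
  \<open>c\<close>, the truncated potential is at most \<open>k\<^sup>2 * c\<close> everywhere, so a
  profile that spreads out has little energy.\<close>

lemma pairing_trunc_le:
  assumes f: "vorticity f" and g: "vorticity g" and k: "1 \<le> k"
    and c: "\<And>a. mass (cutoff (slab k a) g) \<le> c"
  shows "pairing (htrunc k) f g \<le> k\<^sup>2 * c * mass f"
proof -
  have c0: "0 \<le> c"
    using c[of 0] mass_nonneg[OF vorticity_cutoff[OF g slab_borel[of k 0]]] by linarith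
  have "pairing (htrunc k) f g \<le> (\<integral>x. (k\<^sup>2 * c) * f x \<partial>lborel)"
  proof (rule pairing_bound_le[OF kernel_hcut[OF trunc_set_measurable] f g])
    show "integrable lborel (\<lambda>x. k\<^sup>2 * c * f x)"
      by (intro integrable_mult_right vorticity_integrable f)
    show "0 \<le> k\<^sup>2 * c" using c0 by simp
    fix x :: "real \<times> real"
    note h = vorticity_cutoff[OF g slab_borel[of k "fst x"]]
    have "htrunc k x y * g y \<le> k\<^sup>2 * cutoff (slab k (fst x)) g y" for y
    proof (cases "(x, y) \<in> trunc_set k")
      case True
      have "\<bar>fst y - fst x\<bar> \<le> dist x y"
        using dist_fst_le[of y x] by (simp add: dist_real_def dist_commute)
      then have "y \<in> slab k (fst x)"
        using True by (auto simp: slab_def trunc_set_def)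
      then show ?thesis
        using mult_right_mono[OF htrunc_le[OF k, of x y] vorticity_nonneg[OF g, of y]]
        by (simp add: cutoff_def)
    next
      case False
      then have "htrunc k x y * g y = 0" by (simp add: hcut_def)
      moreover have "0 \<le> k\<^sup>2 * cutoff (slab k (fst x)) g y"
        by (intro mult_nonneg_nonneg vorticity_nonneg[OF h]) simp
      ultimately show ?thesis by (simp only:)
    qed
    then have "(\<integral>\<^sup>+y. ennreal (htrunc k x y * g y) \<partial>lborel)
        \<le> (\<integral>\<^sup>+y. ennreal (k\<^sup>2 * cutoff (slab k (fst x)) g y) \<partial>lborel)"
      by (intro nn_integral_mono ennreal_leI)
    also have "\<dots> = ennreal (\<integral>y. k\<^sup>2 * cutoff (slab k (fst x)) g y \<partial>lborel)"
      by (intro nn_integral_eq_integral integrable_mult_right vorticity_integrable h AE_I2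
          mult_nonneg_nonneg vorticity_nonneg[OF h]) auto
    also have "(\<integral>y. k\<^sup>2 * cutoff (slab k (fst x)) g y \<partial>lborel) \<le> k\<^sup>2 * c"
      using c[of "fst x"] unfolding mass_def by (simp add: mult_left_mono)
    finally show "(\<integral>\<^sup>+y. ennreal (htrunc k x y * g y) \<partial>lborel) \<le> ennreal (k\<^sup>2 * c)"
      by (simp add: ennreal_leI)
  qed
  also have "\<dots> = k\<^sup>2 * c * mass f" unfolding mass_def by (rule integral_mult_right_zero)
  finally show ?thesis .
qed

section \<open>Weak convergence of vorticities\<close>

definition weakly :: "(nat \<Rightarrow> real \<times> real \<Rightarrow> real) \<Rightarrow> (real \<times> real \<Rightarrow> real) \<Rightarrow> bool" where
  "weakly f g \<longleftrightarrow> (\<forall>\<phi>. square_integrable \<phi> \<longrightarrow>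
     (\<lambda>n. \<integral>x. f n x * \<phi> x \<partial>lborel) \<longlonglongrightarrow> (\<integral>x. g x * \<phi> x \<partial>lborel))"

lemma weaklyD:
  "weakly f g \<Longrightarrow> square_integrable \<phi> \<Longrightarrow>
    (\<lambda>n. \<integral>x. f n x * \<phi> x \<partial>lborel) \<longlonglongrightarrow> (\<integral>x. g x * \<phi> x \<partial>lborel)"
  by (simp add: weakly_def)

lemma square_integrable_cutoff:
  assumes f: "square_integrable f" and [measurable]: "A \<in> sets borel"
  shows "square_integrable (\<lambda>x. indicator A x * f x)"
proof -
  have [measurable]: "f \<in> borel_measurable borel" using f by (simp add: square_integrable_def)
  have "integrable lborel (\<lambda>x. (indicator A x * f x)\<^sup>2)"
  proof (rule Bochner_Integration.integrable_bound)
    show "integrable lborel (\<lambda>x. (f x)\<^sup>2)" using f by (simp add: square_integrable_def)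
    show "AE x in lborel. norm ((indicator A x * f x)\<^sup>2) \<le> norm ((f x)\<^sup>2)"
      by (auto simp: indicator_def)
  qed measurable
  then show ?thesis by (simp add: square_integrable_def)
qed

lemma weakly_cutoff:
  assumes "weakly f g" and A: "A \<in> sets borel"
  shows "weakly (\<lambda>n. cutoff A (f n)) (cutoff A g)"
  unfolding weakly_def
proof (intro allI impI)
  fix \<phi> :: "real \<times> real \<Rightarrow> real" assume \<phi>: "square_integrable \<phi>"
  have eq: "cutoff A h x * \<phi> x = h x * (indicator A x * \<phi> x)" for h x
    by (simp add: cutoff_def)
  show "(\<lambda>n. \<integral>x. cutoff A (f n) x * \<phi> x \<partial>lborel) \<longlonglongrightarrow> (\<integral>x. cutoff A g x * \<phi> x \<partial>lborel)"
    unfolding eq by (intro weaklyD assms square_integrable_cutoff \<phi>)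
qed

lemma square_integrable_bounded_support:
  fixes \<phi> :: "'a::euclidean_space \<Rightarrow> real"
  assumes [measurable]: "\<phi> \<in> borel_measurable borel" "A \<in> sets borel" and A: "bounded A"
    and le: "\<And>x. \<bar>\<phi> x\<bar> \<le> C * indicator A x"
  shows "square_integrable \<phi>"
proof -
  have "emeasure lborel A < \<infinity>" by (rule emeasure_bounded_finite[OF A])
  then have int: "integrable lborel (\<lambda>x. C\<^sup>2 * indicator A x :: real)"
    by (intro integrable_mult_right integrable_real_indicator) auto
  have "integrable lborel (\<lambda>x. (\<phi> x)\<^sup>2)"
  proof (rule Bochner_Integration.integrable_bound[OF int])
    have "norm ((\<phi> x)\<^sup>2) \<le> norm (C\<^sup>2 * indicator A x :: real)" for x
      using power_mono[OF le[of x] abs_ge_zero, of 2] by (cases "x \<in> A") (auto simp: power_mult_distrib)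
    then show "AE x in lborel. norm ((\<phi> x)\<^sup>2) \<le> norm (C\<^sup>2 * indicator A x :: real)" by simp
  qed measurable
  then show ?thesis by (simp add: square_integrable_def)
qed

lemma integral_Cauchy_Schwarz:
  assumes "square_integrable f" "square_integrable g"
  shows "\<bar>\<integral>x. f x * g x \<partial>lborel\<bar> \<le> sqrt (\<integral>x. (f x)\<^sup>2 \<partial>lborel) * sqrt (\<integral>x. (g x)\<^sup>2 \<partial>lborel)"
proof -
  have "norm (abs_l2 h) = sqrt (\<integral>x. (h x)\<^sup>2 \<partial>lborel)" if "square_integrable h" for h :: "'a \<Rightarrow> real"
    unfolding norm_l2_abs_l2[OF that, symmetric] by simp
  then show ?thesis
    using Cauchy_Schwarz_ineq2[of "abs_l2 f" "abs_l2 g"] assms by (simp add: inner_abs_l2)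
qed

text \<open>An exhaustion of the plane on which a given weight is a square integrable test function.\<close>

definition level :: "(real \<times> real \<Rightarrow> real) \<Rightarrow> nat \<Rightarrow> (real \<times> real) set" where
  "level W j = {x. norm x \<le> real j \<and> W x \<le> real j}"

lemma level_borel:
  assumes [measurable]: "W \<in> borel_measurable borel"
  shows "level W j \<in> sets borel"
proof -
  have "{x \<in> space borel. norm x \<le> real j \<and> W x \<le> real j} \<in> sets borel" by measurable
  then show ?thesis by (simp add: level_def)
qed

lemma level_bounded: "bounded (level W j)"
  by (rule bounded_subset[OF bounded_cball[of 0 "real j"]]) (auto simp: level_def)

lemma level_test:
  assumes [measurable]: "W \<in> borel_measurable borel" and W: "\<And>x. 0 \<le> W x"
  shows "square_integrable (\<lambda>x. indicator (level W j) x * W x)"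
proof (rule square_integrable_bounded_support[OF _ level_borel level_bounded])
  note [measurable] = level_borel[OF assms(1)]
  show "(\<lambda>x. indicator (level W j) x * W x) \<in> borel_measurable borel" by measurable
  show "\<bar>indicator (level W j) x * W x\<bar> \<le> real j * indicator (level W j) x" for x
    using W[of x] by (auto simp: indicator_def level_def)
qed fact

lemma level_tendsto: "(\<lambda>j. indicator (level W j) x * c) \<longlonglongrightarrow> (c :: real)"
proof (rule tendsto_eventually)
  obtain N where N: "max (norm x) (W x) \<le> real N" using real_arch_simple by blast
  show "eventually (\<lambda>j. indicator (level W j) x * c = c) sequentially"
  proof (rule eventually_sequentiallyI)
    fix j assume "N \<le> j"
    then have "real N \<le> real j" by simp
    then have "x \<in> level W j" using N by (auto simp: level_def)
    then show "indicator (level W j) x * c = c" by simp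
  qed
qed

text \<open>Lower semicontinuity of weighted integrals of nonnegative functions. A weight such as 1,
  the height or a potential is in general not a test function, but its restriction to
  \<open>level W j\<close> is, and these sets exhaust the plane; on the remaining part the integrand
  only adds.\<close>

lemma weak_weight_lower:
  assumes w: "weakly f g" and [measurable]: "W \<in> borel_measurable borel" and W: "\<And>x. 0 \<le> W x"
    and fi: "\<And>n. integrable lborel (\<lambda>x. f n x * W x)" and f0: "\<And>n x. 0 \<le> f n x"
    and gi: "integrable lborel (\<lambda>x. g x * W x)" and g0: "\<And>x. 0 \<le> g x" and d: "0 < d"
  shows "eventually (\<lambda>n. (\<integral>x. g x * W x \<partial>lborel) - d < (\<integral>x. f n x * W x \<partial>lborel)) sequentially"
proof -
  note [measurable] = level_borel[OF assms(2)] borel_measurable_integrable[OF gi, simplified]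
  have "(\<lambda>j. \<integral>x. indicator (level W j) x * (g x * W x) \<partial>lborel) \<longlonglongrightarrow> (\<integral>x. g x * W x \<partial>lborel)"
  proof (rule integral_dominated_convergence[OF _ _ gi])
    show "AE x in lborel. (\<lambda>j. indicator (level W j) x * (g x * W x)) \<longlonglongrightarrow> g x * W x"
      by (intro AE_I2 level_tendsto)
    show "AE x in lborel. norm (indicator (level W j) x * (g x * W x)) \<le> g x * W x" for j
      using W g0 by (intro AE_I2) (simp add: indicator_def)
  qed measurable
  then have "eventually (\<lambda>j. (\<integral>x. g x * W x \<partial>lborel) - d < (\<integral>x. indicator (level W j) x * (g x * W x) \<partial>lborel)) sequentially"
    using d by (intro order_tendstoD) auto
  then obtain j where j: "(\<integral>x. g x * W x \<partial>lborel) - d < (\<integral>x. indicator (level W j) x * (g x * W x) \<partial>lborel)"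
    by (auto simp: eventually_sequentially)
  have "(\<lambda>n. \<integral>x. f n x * (indicator (level W j) x * W x) \<partial>lborel) \<longlonglongrightarrow> (\<integral>x. g x * (indicator (level W j) x * W x) \<partial>lborel)"
    by (intro weaklyD w level_test assms)
  then have "eventually (\<lambda>n. (\<integral>x. g x * W x \<partial>lborel) - d < (\<integral>x. f n x * (indicator (level W j) x * W x) \<partial>lborel)) sequentially"
    using j by (intro order_tendstoD) (auto simp: mult.left_commute)
  then show ?thesis
  proof eventually_elim
    case (elim n)
    have [measurable]: "(\<lambda>x. f n x * W x) \<in> borel_measurable borel"
      using borel_measurable_integrable[OF fi[of n]] by simp
    have le: "f n x * (indicator (level W j) x * W x) \<le> f n x * W x" for x
      using W f0 by (simp add: indicator_def)
    have "integrable lborel (\<lambda>x. f n x * (indicator (level W j) x * W x))"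
    proof (rule Bochner_Integration.integrable_bound[OF fi[of n]])
      have "(\<lambda>x. indicator (level W j) x * (f n x * W x)) \<in> borel_measurable lborel" by measurable
      then show "(\<lambda>x. f n x * (indicator (level W j) x * W x)) \<in> borel_measurable lborel"
        by (simp only: mult.left_commute)
      show "AE x in lborel. norm (f n x * (indicator (level W j) x * W x)) \<le> norm (f n x * W x)"
        by (intro AE_I2) (simp add: indicator_def)
    qed
    then have "(\<integral>x. f n x * (indicator (level W j) x * W x) \<partial>lborel) \<le> (\<integral>x. f n x * W x \<partial>lborel)"
      by (intro integral_mono fi le)
    then show ?case using elim by linarith
  qed
qed

text \<open>The same exhaustion, but with Fatou's lemma in place of dominated convergence, because
  the integrability of \<open>g x * W x\<close> is now part of the conclusion.\<close>

lemma weak_weight_bound: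
  assumes w: "weakly f g" and [measurable]: "W \<in> borel_measurable borel" and W: "\<And>x. 0 \<le> W x"
    and fi: "\<And>n. integrable lborel (\<lambda>x. f n x * W x)" and f0: "\<And>n x. 0 \<le> f n x"
    and fK: "\<And>n. (\<integral>x. f n x * W x \<partial>lborel) \<le> K"
    and g: "square_integrable g" and g0: "\<And>x. 0 \<le> g x"
  shows "integrable lborel (\<lambda>x. g x * W x)" "(\<integral>x. g x * W x \<partial>lborel) \<le> K"
proof -
  have [measurable]: "g \<in> borel_measurable borel" using g by (simp add: square_integrable_def)
  note [measurable] = level_borel[OF assms(2)]
  have K0: "0 \<le> K" using fK[of 0] W f0 by (smt (verit) integral_nonneg_AE AE_I2 mult_nonneg_nonneg)
  have gj: "(\<integral>\<^sup>+x. ennreal (indicator (level W j) x * (g x * W x)) \<partial>lborel) \<le> ennreal K" for j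
  proof -
    have int: "integrable lborel (\<lambda>x. g x * (indicator (level W j) x * W x))"
      by (intro square_integrable_mult g level_test W) measurable
    have "(\<lambda>n. \<integral>x. f n x * (indicator (level W j) x * W x) \<partial>lborel) \<longlonglongrightarrow> (\<integral>x. g x * (indicator (level W j) x * W x) \<partial>lborel)"
      by (intro weaklyD w level_test assms)
    moreover have "(\<integral>x. f n x * (indicator (level W j) x * W x) \<partial>lborel) \<le> K" for n
    proof -
      have [measurable]: "(\<lambda>x. f n x * W x) \<in> borel_measurable borel"
        using borel_measurable_integrable[OF fi[of n]] by simp
      have "integrable lborel (\<lambda>x. f n x * (indicator (level W j) x * W x))"
      proof (rule Bochner_Integration.integrable_bound[OF fi[of n]])
        have "(\<lambda>x. indicator (level W j) x * (f n x * W x)) \<in> borel_measurable lborel" by measurable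
        then show "(\<lambda>x. f n x * (indicator (level W j) x * W x)) \<in> borel_measurable lborel"
          by (simp only: mult.left_commute)
        show "AE x in lborel. norm (f n x * (indicator (level W j) x * W x)) \<le> norm (f n x * W x)"
          by (intro AE_I2) (simp add: indicator_def)
      qed
      then have "(\<integral>x. f n x * (indicator (level W j) x * W x) \<partial>lborel) \<le> (\<integral>x. f n x * W x \<partial>lborel)"
        using W f0 by (intro integral_mono fi) (auto simp: indicator_def)
      then show ?thesis using fK[of n] by linarith
    qed
    ultimately have "(\<integral>x. g x * (indicator (level W j) x * W x) \<partial>lborel) \<le> K"
      by (intro LIMSEQ_le_const2) auto
    then have "ennreal (\<integral>x. g x * (indicator (level W j) x * W x) \<partial>lborel) \<le> ennreal K"
      by (rule ennreal_leI)
    moreover have "(\<integral>\<^sup>+x. ennreal (g x * (indicator (level W j) x * W x)) \<partial>lborel)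
        = ennreal (\<integral>x. g x * (indicator (level W j) x * W x) \<partial>lborel)"
      by (rule nn_integral_eq_integral[OF int]) (use W g0 in auto)
    ultimately show ?thesis by (simp only: mult.left_commute)
  qed
  have "(\<integral>\<^sup>+x. ennreal (g x * W x) \<partial>lborel)
      = (\<integral>\<^sup>+x. liminf (\<lambda>j. ennreal (indicator (level W j) x * (g x * W x))) \<partial>lborel)"
  proof (rule nn_integral_cong)
    fix x
    have "(\<lambda>j. ennreal (indicator (level W j) x * (g x * W x))) \<longlonglongrightarrow> ennreal (g x * W x)"
      by (intro tendsto_ennrealI level_tendsto)
    from lim_imp_Liminf[OF trivial_limit_sequentially this]
    show "ennreal (g x * W x) = liminf (\<lambda>j. ennreal (indicator (level W j) x * (g x * W x)))" by (rule sym)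
  qed
  also have "\<dots> \<le> liminf (\<lambda>j. \<integral>\<^sup>+x. ennreal (indicator (level W j) x * (g x * W x)) \<partial>lborel)"
    by (rule nn_integral_liminf) measurable
  also have "\<dots> \<le> ennreal K"
    by (rule order_trans[OF Liminf_le_Limsup[OF trivial_limit_sequentially] Limsup_bounded[OF always_eventually]])
      (intro allI gj)
  finally have le: "(\<integral>\<^sup>+x. ennreal (g x * W x) \<partial>lborel) \<le> ennreal K" .
  show int: "integrable lborel (\<lambda>x. g x * W x)"
  proof (rule integrableI_bounded)
    show "(\<integral>\<^sup>+x. ennreal (norm (g x * W x)) \<partial>lborel) < \<infinity>"
      using le_less_trans[OF le, of \<infinity>] W g0 by simp
  qed measurable
  show "(\<integral>x. g x * W x \<partial>lborel) \<le> K"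
    using le W g0 K0 by (subst (asm) nn_integral_eq_integral[OF int]) (auto simp: ennreal_le_iff)
qed

lemma integral_square_diff:
  assumes "square_integrable f" "square_integrable g"
  shows "(\<integral>x. (f x - g x)\<^sup>2 \<partial>lborel)
    = (\<integral>x. (f x)\<^sup>2 \<partial>lborel) - 2 * (\<integral>x. f x * g x \<partial>lborel) + (\<integral>x. (g x)\<^sup>2 \<partial>lborel)"
proof -
  have i: "integrable lborel (\<lambda>x. (f x)\<^sup>2)" "integrable lborel (\<lambda>x. (g x)\<^sup>2)" "integrable lborel (\<lambda>x. 2 * (f x * g x))"
    using assms square_integrable_mult[OF assms] by (auto simp: square_integrable_def)
  have "(\<integral>x. (f x - g x)\<^sup>2 \<partial>lborel) = (\<integral>x. (f x)\<^sup>2 - 2 * (f x * g x) + (g x)\<^sup>2 \<partial>lborel)"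
    by (rule Bochner_Integration.integral_cong) (simp_all add: power2_diff)
  also have "\<dots> = (\<integral>x. (f x)\<^sup>2 \<partial>lborel) - (\<integral>x. 2 * (f x * g x) \<partial>lborel) + (\<integral>x. (g x)\<^sup>2 \<partial>lborel)"
    by (simp only: Bochner_Integration.integral_add[OF Bochner_Integration.integrable_diff[OF i(1,3)] i(2)]
        Bochner_Integration.integral_diff[OF i(1,3)])
  finally show ?thesis by simp
qed

text \<open>Expand the nonnegative integral of \<open>(f n x - g x)\<^sup>2\<close>: the cross term
  is a weak limit with \<open>g\<close> itself as test function and tends to
  \<open>2 * enstrophy g\<close>.\<close>

lemma weak_enstrophy_lower:
  assumes w: "weakly f g" and f: "\<And>n. square_integrable (f n)" and g: "square_integrable g" and d: "0 < d"
  shows "eventually (\<lambda>n. enstrophy g - d < enstrophy (f n)) sequentially"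
proof -
  have "(\<lambda>n. \<integral>x. f n x * g x \<partial>lborel) \<longlonglongrightarrow> enstrophy g"
    using weaklyD[OF w g] by (simp add: enstrophy_def power2_eq_square)
  then have "eventually (\<lambda>n. enstrophy g - d / 2 < (\<integral>x. f n x * g x \<partial>lborel)) sequentially"
    using d by (intro order_tendstoD) auto
  then show ?thesis
  proof eventually_elim
    case (elim n)
    have "0 \<le> (\<integral>x. (f n x - g x)\<^sup>2 \<partial>lborel)" by (intro integral_nonneg_AE) simp
    then show ?case
      using elim integral_square_diff[OF f[of n] g] by (simp add: enstrophy_def)
  qed
qed

text \<open>A weak limit is known only up to null sets, so it is replaced by a representative
  \<open>h\<close> with the right sign and support at every point. Testing with the difference
  \<phi> = g - h shows that nothing changes: each \<open>f n x * \<phi> x\<close> is at most 0,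
  while \<open>g x * \<phi> x\<close> is the square of \<phi>, so \<phi> vanishes almost everywhere.
  The bounds pass to the limit with the weights 1 and \<open>max 0 (snd x)\<close>.\<close>

lemma weak_limit_vorticity:
  assumes f: "\<And>n. bounded_vorticity K (f n)" and w: "weakly f g" and g: "square_integrable g"
  shows "\<exists>h. bounded_vorticity K h \<and> weakly f h"
proof -
  have [measurable]: "g \<in> borel_measurable borel" using g by (simp add: square_integrable_def)
  have fv: "vorticity (f n)" for n using f by (simp add: bounded_vorticity_def)
  define h where "h = (\<lambda>x. indicator {x. 0 < snd x} x * max 0 (g x))"
  have op: "{x :: real \<times> real. 0 < snd x} \<in> sets borel"
    by (intro borel_open open_Collect_less continuous_intros)
  note [measurable] = op
  have [measurable]: "h \<in> borel_measurable borel" unfolding h_def by measurable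
  have h0: "0 \<le> h x" for x by (simp add: h_def)
  have hz: "h x = 0" if "snd x \<le> 0" for x using that by (simp add: h_def)
  have "square_integrable (\<lambda>x. max 0 (g x))"
    unfolding square_integrable_def
  proof
    show "integrable lborel (\<lambda>x. (max 0 (g x))\<^sup>2)"
      by (rule Bochner_Integration.integrable_bound[of _ "\<lambda>x. (g x)\<^sup>2"])
        (use g in \<open>auto simp: square_integrable_def max_def\<close>)
  qed measurable
  then have h: "square_integrable h"
    unfolding h_def by (rule square_integrable_cutoff[OF _ op])
  define \<phi> where "\<phi> = (\<lambda>x. g x - h x)"
  have \<phi>: "square_integrable \<phi>" unfolding \<phi>_def by (rule square_integrable_diff[OF g h])
  have "(\<integral>x. f n x * \<phi> x \<partial>lborel) \<le> 0" for n
  proof -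
    have "f n x * \<phi> x \<le> 0" for x
    proof (cases "0 < snd x")
      case True
      then have "\<phi> x \<le> 0" by (simp add: \<phi>_def h_def)
      then show ?thesis by (intro mult_nonneg_nonpos vorticity_nonneg[OF fv])
    next
      case False
      then show ?thesis using vorticity_zero[OF fv, of x n] by simp
    qed
    then have "0 \<le> (\<integral>x. - (f n x * \<phi> x) \<partial>lborel)" by (intro integral_nonneg_AE) simp
    then show ?thesis by simp
  qed
  then have "(\<integral>x. g x * \<phi> x \<partial>lborel) \<le> 0"
    using weaklyD[OF w \<phi>] by (intro LIMSEQ_le_const2) auto
  moreover have "g x * \<phi> x = (\<phi> x)\<^sup>2" for x
    by (cases "0 < snd x"; cases "0 \<le> g x") (auto simp: \<phi>_def h_def power2_eq_square max_def)
  ultimately have "(\<integral>x. (\<phi> x)\<^sup>2 \<partial>lborel) \<le> 0" by simp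
  moreover have "0 \<le> (\<integral>x. (\<phi> x)\<^sup>2 \<partial>lborel)" by (intro integral_nonneg_AE) simp
  ultimately have "(\<integral>x. (\<phi> x)\<^sup>2 \<partial>lborel) = 0" by simp
  then have "AE x in lborel. (\<phi> x)\<^sup>2 = 0"
    using \<phi> by (subst (asm) integral_nonneg_eq_0_iff_AE) (auto simp: square_integrable_def)
  then have ae: "AE x in lborel. g x = h x"
    by eventually_elim (simp add: \<phi>_def)
  have "(\<integral>x. g x * \<psi> x \<partial>lborel) = (\<integral>x. h x * \<psi> x \<partial>lborel)" if "square_integrable \<psi>" for \<psi>
  proof -
    have [measurable]: "\<psi> \<in> borel_measurable borel" using that by (simp add: square_integrable_def)
    show ?thesis by (rule integral_cong_AE) (use ae in \<open>auto elim: AE_mp\<close>)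
  qed
  then have wh: "weakly f h" using w unfolding weakly_def by simp
  have mh: "integrable lborel (\<lambda>x. h x * 1) \<and> (\<integral>x. h x * 1 \<partial>lborel) \<le> K"
    using f vorticity_integrable[OF fv] vorticity_nonneg[OF fv]
    by (intro conjI weak_weight_bound[OF wh _ _ _ _ _ h h0])
      (auto simp: bounded_vorticity_def mass_def)
  have fW: "f n x * max 0 (snd x) = snd x * f n x" for n x
    using vorticity_zero[OF fv, of x n] by (cases "0 < snd x") auto
  have hW: "h x * max 0 (snd x) = snd x * h x" for x
    using hz[of x] by (cases "0 < snd x") auto
  have ph: "integrable lborel (\<lambda>x. h x * max 0 (snd x)) \<and> (\<integral>x. h x * max 0 (snd x) \<partial>lborel) \<le> K"
    using f vorticity_impulse_integrable[OF fv] vorticity_nonneg[OF fv]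
    by (intro conjI weak_weight_bound[OF wh _ _ _ _ _ h h0])
      (auto simp: bounded_vorticity_def impulse_def fW)
  have hv: "vorticity h"
    using h0 hz mh ph h unfolding hW square_integrable_def by (intro vorticityI) auto
  have "enstrophy h \<le> K"
  proof (rule field_le_epsilon)
    fix e :: real assume "0 < e"
    have "eventually (\<lambda>n. enstrophy h - e < enstrophy (f n)) sequentially"
      by (rule weak_enstrophy_lower[OF wh vorticity_square[OF fv] h]) fact
    then obtain n where "enstrophy h - e < enstrophy (f n)" by (auto simp: eventually_sequentially)
    moreover have "enstrophy (f n) \<le> K" using f[of n] by (simp add: bounded_vorticity_def)
    ultimately show "enstrophy h \<le> K + e" by simp
  qed
  then have "bounded_vorticity K h"
    using hv mh ph unfolding hW by (simp add: bounded_vorticity_def mass_def impulse_def)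
  then show ?thesis using wh by blast
qed

lemma bounded_vorticity_weakly_compact:
  fixes f :: "nat \<Rightarrow> real \<times> real \<Rightarrow> real"
  assumes f: "\<And>n. bounded_vorticity K (f n)"
  shows "\<exists>r g. strict_mono r \<and> bounded_vorticity K g \<and> weakly (\<lambda>n. f (r n)) g"
proof -
  have "\<And>n. square_integrable (f n)" using f by (simp add: bounded_vorticity_def vorticity_square)
  moreover have "\<And>n. (\<integral>x. (f n x)\<^sup>2 \<partial>lborel) \<le> K"
    using f by (simp add: bounded_vorticity_def enstrophy_def)
  ultimately obtain r g where r: "strict_mono r" and g: "square_integrable g" and w: "weakly (\<lambda>n. f (r n)) g"
    using square_integrable_weakly_convergent_subsequence[of f K] unfolding weakly_def by blast
  from weak_limit_vorticity[of K "\<lambda>n. f (r n)", OF f w g] r show ?thesis by blast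
qed

text \<open>On horizontally bounded supports the truncated kernel is a bounded kernel on a bounded
  box, so its integral operator \<open>H\<close> is compact. For fixed \<open>x\<close> the kernel
  \<open>q x\<close> is a test function, which gives pointwise convergence of
  \<open>H (g n)\<close>; a common bound supported in \<open>B\<close> turns it into strong
  convergence, and strong against weak convergence passes to the limit.\<close>

lemma pairing_trunc_weak_continuous:
  assumes fK: "\<And>n. bounded_vorticity K (f n)" and gK: "\<And>n. bounded_vorticity K (g n)"
    and wf: "weakly f f'" and wg: "weakly g g'"
    and f': "bounded_vorticity K f'" and g': "bounded_vorticity K g'"
    and supp: "\<And>n x. R < \<bar>fst x\<bar> \<Longrightarrow> f n x = 0 \<and> g n x = 0"
    and supp': "\<And>x. R < \<bar>fst x\<bar> \<Longrightarrow> f' x = 0 \<and> g' x = 0"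
    and k: "1 \<le> k"
  shows "(\<lambda>n. pairing (htrunc k) (f n) (g n)) \<longlonglongrightarrow> pairing (htrunc k) f' g'"
proof -
  note fv = bounded_vorticityD[OF fK] and gv = bounded_vorticityD[OF gK]
    and f'v = bounded_vorticityD[OF f'] and g'v = bounded_vorticityD[OF g']
  note ht = trunc_set_measurable[of k]
  have [measurable]: "(\<lambda>z. htrunc k (fst z) (snd z)) \<in> borel_measurable (borel \<Otimes>\<^sub>M borel)"
    by (rule kernel_measurable[OF kernel_hcut[OF ht]])
  \<comment> \<open>The horizontal range of the box comes from the supports, the vertical one from
    the truncation and from the vanishing below the boundary.\<close>
  define B :: "(real \<times> real) set" where "B = cbox (- R, 0) (R, k)"
  have [measurable]: "B \<in> sets borel" by (simp add: B_def)
  have B: "bounded B" by (simp add: B_def)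
  have Bm: "emeasure lborel B < \<infinity>" by (rule emeasure_bounded_finite[OF B])
  define q where "q = (\<lambda>x y. indicator B x * (indicator B y * htrunc k x y))"
  have [measurable]: "(\<lambda>z. q (fst z) (snd z)) \<in> borel_measurable (borel \<Otimes>\<^sub>M borel)"
    unfolding q_def by measurable
  have q0: "0 \<le> q x y" for x y
    unfolding q_def by (intro mult_nonneg_nonneg kernel_nonneg[OF kernel_hcut[OF ht]]) auto
  have qk: "q x y \<le> k\<^sup>2 * (indicator B x * indicator B y)" for x y
    using htrunc_le[OF k, of x y] by (simp add: q_def indicator_def)
  have eq: "htrunc k x y * u x * v y = u x * (q x y * v y)"
    if u: "vorticity u" "\<And>x. R < \<bar>fst x\<bar> \<Longrightarrow> u x = 0" and v: "vorticity v" "\<And>x. R < \<bar>fst x\<bar> \<Longrightarrow> v x = 0" for u v x y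
  proof (cases "x \<in> B \<and> y \<in> B")
    case True
    then show ?thesis by (simp add: q_def)
  next
    case False
    have in_B: "z \<in> B" if "\<bar>fst z\<bar> \<le> R" "0 < snd z" "snd z \<le> k" for z
      using that by (cases z) (auto simp: B_def abs_le_iff)
    have "u x = 0 \<or> v y = 0 \<or> htrunc k x y = 0"
    proof (rule ccontr)
      assume "\<not> (u x = 0 \<or> v y = 0 \<or> htrunc k x y = 0)"
      then have "u x \<noteq> 0" "v y \<noteq> 0" and t: "(x, y) \<in> trunc_set k"
        by (auto simp: hcut_def indicator_def split: if_splits)
      then have "\<bar>fst x\<bar> \<le> R" "0 < snd x" "\<bar>fst y\<bar> \<le> R" "0 < snd y"
        using u(2)[of x] v(2)[of y] vorticity_zero[OF u(1), of x] vorticity_zero[OF v(1), of y] by force+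
      then show False using False t in_B[of x] in_B[of y] by (auto simp: trunc_set_def)
    qed
    moreover have "q x y = 0" using False by (auto simp: q_def)
    ultimately show ?thesis by auto
  qed
  define H where "H = (\<lambda>v x. \<integral>y. q x y * v y \<partial>lborel)"
  have [measurable]: "H v \<in> borel_measurable borel" if "vorticity v" for v
  proof -
    note [measurable] = vorticity_measurable[OF that]
    have "(\<lambda>x. \<integral>y. q (fst (x, y)) (snd (x, y)) * v y \<partial>lborel) \<in> borel_measurable borel" by measurable
    then show ?thesis by (simp add: H_def[abs_def])
  qed
  note Hm = this
  have pair: "pairing (htrunc k) u v = (\<integral>x. u x * H v x \<partial>lborel)"
    if u: "vorticity u" "\<And>x. R < \<bar>fst x\<bar> \<Longrightarrow> u x = 0" and v: "vorticity v" "\<And>x. R < \<bar>fst x\<bar> \<Longrightarrow> v x = 0" for u v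
  proof -
    have "pairing (htrunc k) u v = (\<integral>x. \<integral>y. htrunc k x y * u x * v y \<partial>lborel \<partial>lborel)"
      unfolding pairing_def using lborel_pair.integral_fst'[OF pairing_integrable[OF subkernel_hcut[OF ht] u(1) v(1)]]
      by simp
    also have "\<dots> = (\<integral>x. u x * H v x \<partial>lborel)"
    proof -
      have "(\<integral>y. htrunc k x y * u x * v y \<partial>lborel) = (\<integral>y. u x * (q x y * v y) \<partial>lborel)" for x
        by (rule Bochner_Integration.integral_cong[OF refl eq[OF u v]])
      then show ?thesis by (simp add: H_def)
    qed
    finally show ?thesis .
  qed
  have Hb: "\<bar>H v x\<bar> \<le> (k\<^sup>2 * K) * indicator B x" if v: "bounded_vorticity K v" for v x
  proof -
    note vv = bounded_vorticityD[OF v]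
    have 0: "0 \<le> H v x"
      unfolding H_def by (intro integral_nonneg_AE AE_I2 mult_nonneg_nonneg q0 vorticity_nonneg[OF vv])
    have i: "integrable lborel (\<lambda>y. k\<^sup>2 * indicator B x * v y)"
      by (intro integrable_mult_right vorticity_integrable vv)
    have "H v x \<le> (\<integral>y. k\<^sup>2 * indicator B x * v y \<partial>lborel)"
      unfolding H_def
    proof (rule integral_mono_AE'[OF i])
      have "q x y * v y \<le> k\<^sup>2 * indicator B x * v y" for y
      proof (rule mult_right_mono[OF _ vorticity_nonneg[OF vv]])
        show "q x y \<le> k\<^sup>2 * indicator B x"
          using order_trans[OF qk[of x y], of "k\<^sup>2 * indicator B x"] by (simp add: indicator_def)
      qed
      then show "AE y in lborel. q x y * v y \<le> k\<^sup>2 * indicator B x * v y" by simp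
      have "0 \<le> k\<^sup>2 * indicator B x * v y" for y
        by (intro mult_nonneg_nonneg vorticity_nonneg[OF vv]) auto
      then show "AE y in lborel. 0 \<le> k\<^sup>2 * indicator B x * v y" by simp
    qed
    also have "\<dots> = k\<^sup>2 * indicator B x * mass v" unfolding mass_def by simp
    also have "\<dots> \<le> k\<^sup>2 * indicator B x * K"
      using v by (intro mult_left_mono) (auto simp: bounded_vorticity_def)
    finally show ?thesis using 0 by (simp add: mult_ac)
  qed
  have Hs: "square_integrable (H v)" if v: "bounded_vorticity K v" for v
    by (rule square_integrable_bounded_support[OF Hm[OF bounded_vorticityD[OF v]] _ B Hb[OF v]]) measurable
  have Hlim: "(\<lambda>n. H (g n) x) \<longlonglongrightarrow> H g' x" for x
  proof -
    have "(\<lambda>y. q (fst (x, y)) (snd (x, y))) \<in> borel_measurable borel" by measurable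
    then have [measurable]: "q x \<in> borel_measurable borel" by simp
    have "\<bar>q x y\<bar> \<le> k\<^sup>2 * indicator B y" for y
      using q0[of x y] qk[of x y] by (cases "y \<in> B"; cases "x \<in> B") auto
    then have "square_integrable (q x)"
      by (intro square_integrable_bounded_support[OF _ _ B]) auto
    from weaklyD[OF wg this] show ?thesis by (simp add: H_def mult.commute)
  qed
  define D where "D = (\<lambda>n. \<integral>x. (H (g n) x - H g' x)\<^sup>2 \<partial>lborel)"
  have D: "D \<longlonglongrightarrow> 0"
  proof -
    have "D \<longlonglongrightarrow> (\<integral>x. 0 \<partial>(lborel :: (real \<times> real) measure))"
      unfolding D_def
    proof (rule integral_dominated_convergence)
      show "integrable lborel (\<lambda>x. (2 * (k\<^sup>2 * K))\<^sup>2 * indicator B x :: real)"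
        using Bm by (intro integrable_mult_right integrable_real_indicator) auto
      note [measurable] = Hm[OF gv] Hm[OF g'v]
      show "(\<lambda>x. (H (g n) x - H g' x)\<^sup>2) \<in> borel_measurable lborel" for n by measurable
      have "(\<lambda>n. (H (g n) x - H g' x)\<^sup>2) \<longlonglongrightarrow> (H g' x - H g' x)\<^sup>2" for x
        by (intro tendsto_intros Hlim)
      then show "AE x in lborel. (\<lambda>n. (H (g n) x - H g' x)\<^sup>2) \<longlonglongrightarrow> 0" by simp
      have "(H (g n) x - H g' x)\<^sup>2 \<le> (2 * (k\<^sup>2 * K))\<^sup>2 * indicator B x" for n x
      proof -
        have "\<bar>H (g n) x - H g' x\<bar> \<le> 2 * (k\<^sup>2 * K) * indicator B x"
          using Hb[OF gK, of n x] Hb[OF g', of x] by linarith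
        from power_mono[OF this abs_ge_zero, of 2] show ?thesis
          by (cases "x \<in> B") auto
      qed
      then show "AE x in lborel. norm ((H (g n) x - H g' x)\<^sup>2) \<le> (2 * (k\<^sup>2 * K))\<^sup>2 * indicator B x" for n
        by simp
    qed simp
    then show ?thesis by simp
  qed
  have K0: "0 \<le> K" using f' enstrophy_nonneg[of f'] by (simp add: bounded_vorticity_def)
  have e1: "\<bar>\<integral>x. f n x * (H (g n) x - H g' x) \<partial>lborel\<bar> \<le> sqrt K * sqrt (D n)" for n
  proof -
    have "\<bar>\<integral>x. f n x * (H (g n) x - H g' x) \<partial>lborel\<bar> \<le> sqrt (\<integral>x. (f n x)\<^sup>2 \<partial>lborel) * sqrt (D n)"
      unfolding D_def by (intro integral_Cauchy_Schwarz vorticity_square fv square_integrable_diff Hs gK g')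
    also have "\<dots> \<le> sqrt K * sqrt (D n)"
      using fK[of n] by (intro mult_right_mono)
        (auto simp: bounded_vorticity_def enstrophy_def D_def intro!: integral_nonneg_AE)
    finally show ?thesis .
  qed
  have D0: "(\<lambda>n. sqrt K * sqrt (D n)) \<longlonglongrightarrow> 0"
    using tendsto_mult[OF tendsto_const[of "sqrt K"] tendsto_real_sqrt[OF D]] by simp
  have "eventually (\<lambda>n. norm (\<integral>x. f n x * (H (g n) x - H g' x) \<partial>lborel) \<le> sqrt K * sqrt (D n)) sequentially"
    unfolding real_norm_def by (rule always_eventually, rule allI, rule e1)
  from Lim_null_comparison[OF this D0]
  have "(\<lambda>n. (\<integral>x. f n x * (H (g n) x - H g' x) \<partial>lborel) + (\<integral>x. f n x * H g' x \<partial>lborel))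
      \<longlonglongrightarrow> 0 + (\<integral>x. f' x * H g' x \<partial>lborel)"
    by (intro tendsto_add weaklyD[OF wf] Hs g')
  moreover have "(\<integral>x. f n x * (H (g n) x - H g' x) \<partial>lborel) + (\<integral>x. f n x * H g' x \<partial>lborel)
      = pairing (htrunc k) (f n) (g n)" for n
  proof -
    have "integrable lborel (\<lambda>x. f n x * H (g n) x)" "integrable lborel (\<lambda>x. f n x * H g' x)"
      by (intro square_integrable_mult vorticity_square fv Hs gK g')+
    then show ?thesis
      using pair[OF fv _ gv, of n n] supp by (simp add: right_diff_distrib)
  qed
  ultimately show ?thesis
    using pair[OF f'v _ g'v] supp' by simp
qed

text \<open>The truncation error is uniform over the sequence and its limit, because all of them
  share the bound \<open>K\<close>. So \<open>k\<close> can be fixed first, to make the error at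
  most \<open>e / 4\<close>, and the limit taken afterwards for the truncated kernel.\<close>

lemma interaction_weak_continuous:
  assumes fK: "\<And>n. bounded_vorticity K (f n)" and gK: "\<And>n. bounded_vorticity K (g n)"
    and wf: "weakly f f'" and wg: "weakly g g'"
    and f': "bounded_vorticity K f'" and g': "bounded_vorticity K g'"
    and supp: "\<And>n x. R < \<bar>fst x\<bar> \<Longrightarrow> f n x = 0 \<and> g n x = 0"
    and supp': "\<And>x. R < \<bar>fst x\<bar> \<Longrightarrow> f' x = 0 \<and> g' x = 0"
  shows "(\<lambda>n. interaction (f n) (g n)) \<longlonglongrightarrow> interaction f' g'"
proof (rule LIMSEQ_I)
  fix e :: real assume e: "0 < e"
  have K0: "0 \<le> K" using f' enstrophy_nonneg[of f'] by (simp add: bounded_vorticity_def)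
  define C where "C = K * (48 + 15 * K)"
  have C0: "0 \<le> C" using K0 by (simp add: C_def)
  define k where "k = max 1 ((4 * C / e)\<^sup>2)"
  have k: "1 \<le> k" by (simp add: k_def)
  have "4 * C / e \<le> sqrt k"
    by (rule real_le_rsqrt) (simp add: k_def)
  moreover have "0 < sqrt k" using k by simp
  ultimately have Ck: "C / sqrt k \<le> e / 4"
    using e by (simp add: field_simps)
  have tr: "\<bar>interaction u v - pairing (htrunc k) u v\<bar> \<le> e / 4" if "bounded_vorticity K u" "bounded_vorticity K v" for u v
  proof -
    have "pairing (htrunc k) u v \<le> interaction u v"
      unfolding interaction_def using that subkernel_hcut[OF trunc_set_measurable, of k]
      by (intro pairing_mono subkernel_hgreen) (auto simp: bounded_vorticity_def subkernel_def)
    then show ?thesis using interaction_trunc[OF that k] Ck unfolding C_def by linarith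
  qed
  have "(\<lambda>n. pairing (htrunc k) (f n) (g n)) \<longlonglongrightarrow> pairing (htrunc k) f' g'"
    by (rule pairing_trunc_weak_continuous[OF fK gK wf wg f' g' supp supp' k])
  then obtain N where N: "\<And>n. n \<ge> N \<Longrightarrow> \<bar>pairing (htrunc k) (f n) (g n) - pairing (htrunc k) f' g'\<bar> < e / 2"
    using LIMSEQ_D[of _ _ "e/2"] e by fastforce
  have "norm (interaction (f n) (g n) - interaction f' g') < e" if "n \<ge> N" for n
    using N[OF that] tr[OF fK[of n] gK[of n]] tr[OF f' g'] unfolding real_norm_def by linarith
  then show "\<exists>no. \<forall>n\<ge>no. norm (interaction (f n) (g n) - interaction f' g') < e" by blast
qed

section \<open>The penalized energy and vertical shifts\<close>

definition penalized :: "real \<Rightarrow> (real \<times> real \<Rightarrow> real) \<Rightarrow> real" where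
  "penalized l f = interaction f f / 2 - enstrophy f / (2 * l)"

text \<open>With the free parameter \<open>l * M\<close> the enstrophy enters the energy with the
  coefficient \<open>1 / (4 * l)\<close>, exactly half of the penalty. The other half stays on the
  left, so the estimate bounds the functional from above and, for sequences with bounded values,
  also the enstrophy.\<close>

lemma penalized_le:
  assumes f: "vorticity f" and l: "0 < l" and M: "mass f + impulse f \<le> M" "0 < M"
  shows "penalized l f + enstrophy f / (4 * l) \<le> (8 * l * M + M) * M / 2"
proof -
  let ?N = "8 * (l * M) + enstrophy f / (2 * (l * M)) + mass f + impulse f"
  have N: "0 \<le> ?N" using l M mass_nonneg[OF f] impulse_nonneg[OF f] enstrophy_nonneg[of f] by simp
  have "interaction f f \<le> ?N * (mass f + impulse f)"
    by (rule interaction_le[OF f f]) (use l M in simp)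
  also have "\<dots> \<le> ?N * M" by (rule mult_left_mono[OF M(1) N])
  also have "\<dots> \<le> (8 * (l * M) + enstrophy f / (2 * (l * M)) + M) * M"
    using M by (intro mult_right_mono) auto
  also have "\<dots> = (8 * l * M + M) * M + enstrophy f / (2 * l)"
    using l M by (simp add: field_simps)
  finally have "interaction f f / 2 \<le> (8 * l * M + M) * M / 2 + enstrophy f / (4 * l)"
    by (simp add: field_simps)
  moreover have "enstrophy f / (2 * l) = enstrophy f / (4 * l) + enstrophy f / (4 * l)"
    by (simp add: field_simps)
  ultimately show ?thesis unfolding penalized_def by linarith
qed

lemma integral_mult_pos:
  fixes u v :: "'a \<Rightarrow> real"
  assumes u: "integrable M u" "\<And>x. 0 \<le> u x" "0 < (\<integral>x. u x \<partial>M)"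
    and uv: "integrable M (\<lambda>x. u x * v x)" and v0: "\<And>x. 0 \<le> v x"
    and v: "AE x in M. 0 < u x \<longrightarrow> 0 < v x"
  shows "0 < (\<integral>x. u x * v x \<partial>M)"
proof (rule ccontr)
  assume "\<not> 0 < (\<integral>x. u x * v x \<partial>M)"
  moreover have "0 \<le> (\<integral>x. u x * v x \<partial>M)" using u v0 by (intro integral_nonneg_AE) simp
  ultimately have "(\<integral>x. u x * v x \<partial>M) = 0" by simp
  then have "AE x in M. u x * v x = 0"
    using u v0 by (subst (asm) integral_nonneg_eq_0_iff_AE[OF uv]) auto
  then have "AE x in M. u x = 0"
    using v
  proof eventually_elim
    case (elim x)
    then show ?case using u(2)[of x] by (cases "u x = 0") auto
  qed
  then have "(\<integral>x. u x \<partial>M) = 0" by (rule integral_eq_zero_AE)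
  then show False using u(3) by simp
qed

lemma potential_pos:
  assumes f: "vorticity f" and m: "0 < mass f" and x: "0 < snd x"
  shows "0 < potential f x"
proof -
  have "0 < (\<integral>y. f y * hgreen x y \<partial>lborel)"
  proof (rule integral_mult_pos[OF vorticity_integrable[OF f] vorticity_nonneg[OF f]])
    show "0 < (\<integral>y. f y \<partial>lborel)" using m by (simp add: mass_def)
    show "integrable lborel (\<lambda>y. f y * hgreen x y)"
      using potential_integrable[OF f, of x] by (simp add: mult.commute)
    show "AE y in lborel. 0 < f y \<longrightarrow> 0 < hgreen x y"
      using AE_lborel_singleton[of x]
    proof eventually_elim
      case (elim y)
      then show ?case using vorticity_zero[OF f, of y] hgreen_pos[OF x, of y] by force
    qed
  qed (rule hgreen_nonneg)
  then show ?thesis by (simp add: potential_def mult.commute)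
qed

text \<open>A lower bound for the growth of the kernel per unit of lift. For heights a, b and
  squared distance d, raising both points by h multiplies 1 + 4ab/d by at least 1 + hw with w = 4(a
  + b) / (d + 4ab), and the formula is w / (1 + w) divided by 4 pi. This form, unlike the logarithm,
  is bounded by 1. It is set to 0 on the diagonal because there \<open>hgreen\<close> is 0 before
  and after the lift, by division by zero.\<close>

definition lift_kernel :: "real \<times> real \<Rightarrow> real \<times> real \<Rightarrow> real" where
  "lift_kernel x y = (if x = y then 0 else
     (max 0 (snd x) + max 0 (snd y)) / (pi * ((dist x y)\<^sup>2 + 4 * max 0 (snd x) * max 0 (snd y)
        + 4 * (max 0 (snd x) + max 0 (snd y)))))"

lemma lift_kernel_bounds: "0 \<le> lift_kernel x y" "lift_kernel x y \<le> 1"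
proof -
  define a b d where "a = max 0 (snd x)" and "b = max 0 (snd y)" and "d = (dist x y)\<^sup>2"
  have nn: "0 \<le> a" "0 \<le> b" "0 \<le> d" by (auto simp: a_def b_def d_def)
  show "0 \<le> lift_kernel x y"
    unfolding lift_kernel_def a_def[symmetric] b_def[symmetric] d_def[symmetric] using nn by simp
  show "lift_kernel x y \<le> 1"
  proof (cases "x = y")
    case False
    then have d: "0 < d" by (simp add: d_def)
    have "1 * (a + b) \<le> pi * (d + 4 * a * b + 4 * (a + b))"
      using nn pi_gt3 d by (intro mult_mono) auto
    moreover have "0 < pi * (d + 4 * a * b + 4 * (a + b))"
      using nn d by (intro mult_pos_pos add_pos_nonneg) auto
    ultimately have "(a + b) / (pi * (d + 4 * a * b + 4 * (a + b))) \<le> 1" by (simp add: divide_le_eq)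
    then show ?thesis
      unfolding lift_kernel_def a_def[symmetric] b_def[symmetric] d_def[symmetric] using False by simp
  qed (simp add: lift_kernel_def)
qed

lemma lift_kernel_pos:
  assumes "0 < snd x" "0 < snd y" "x \<noteq> y"
  shows "0 < lift_kernel x y"
proof -
  have "0 < (dist x y)\<^sup>2" using assms by simp
  then have "0 < pi * ((dist x y)\<^sup>2 + 4 * snd x * snd y + 4 * (snd x + snd y))"
    using assms by (intro mult_pos_pos add_pos_pos) auto
  then show ?thesis unfolding lift_kernel_def using assms by (simp add: max_def)
qed

lemma lift_kernel_measurable:
  "(\<lambda>z. lift_kernel (fst z) (snd z)) \<in> borel_measurable (borel \<Otimes>\<^sub>M borel)"
proof -
  have [measurable]: "(\<lambda>z::(real \<times> real) \<times> real \<times> real. snd (fst z)) \<in> borel_measurable (borel \<Otimes>\<^sub>M borel)"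
    by (rule measurable_compose[OF measurable_fst snd_borel])
  have [measurable]: "(\<lambda>z::(real \<times> real) \<times> real \<times> real. snd (snd z)) \<in> borel_measurable (borel \<Otimes>\<^sub>M borel)"
    by (rule measurable_compose[OF measurable_snd snd_borel])
  have "{z::(real \<times> real) \<times> real \<times> real. fst z = snd z} \<in> sets (borel \<Otimes>\<^sub>M borel)"
    by (rule borel_pair_closed) (intro closed_Collect_eq continuous_intros)
  then have [measurable]: "Measurable.pred (borel \<Otimes>\<^sub>M borel) (\<lambda>z::(real \<times> real) \<times> real \<times> real. fst z = snd z)"
    by (simp add: pred_def space_pair_measure)
  show ?thesis unfolding lift_kernel_def by measurable
qed

lemma kernel_lift: "kernel lift_kernel"
  unfolding kernel_def using lift_kernel_measurable lift_kernel_bounds(1) by blast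

text \<open>The logarithm of the quotient is estimated by \<open>ln (1 + w) \<ge> w / (1 + w)\<close>.\<close>

lemma hgreen_lift:
  assumes x: "0 < snd x" and y: "0 < snd y" and h: "0 \<le> h"
  shows "hgreen x y + min 1 h * lift_kernel x y \<le> hgreen (x + (0, h)) (y + (0, h))"
proof (cases "x = y")
  case True
  then show ?thesis by (simp add: hgreen_def lift_kernel_def)
next
  case False
  define a b d t where "a = snd x" and "b = snd y" and "d = (dist x y)\<^sup>2" and "t = min 1 h"
  have d: "0 < d" and a: "0 < a" and b: "0 < b" using False x y by (auto simp: a_def b_def d_def)
  have t: "0 \<le> t" "t \<le> 1" "t \<le> h" using h by (auto simp: t_def)
  define D where "D = d + 4 * a * b"
  have D: "0 < D" using d a b by (simp add: D_def add_pos_pos)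
  define w where "w = 4 * (a + b) / D"
  have w: "0 \<le> w" using a b D by (simp add: w_def)
  have g: "hgreen x y = 1 / (4 * pi) * ln (1 + 4 * a * b / d)"
    using a b by (simp add: hgreen_def a_def b_def d_def max_def)
  have "dist (x + (0, h)) (y + (0, h)) = dist x y" by (simp add: dist_norm)
  then have gh: "hgreen (x + (0, h)) (y + (0, h)) = 1 / (4 * pi) * ln (1 + 4 * (a + h) * (b + h) / d)"
    using a b h by (simp add: hgreen_def a_def b_def d_def max_def)
  have lk: "lift_kernel x y = 1 / (4 * pi) * (w / (1 + w))"
  proof -
    define E where "E = D + 4 * (a + b)"
    have E: "0 < E" using D a b by (simp add: E_def add_pos_pos)
    have "w / (1 + w) = 4 * ((a + b) / E)"
      using D w a b by (simp add: w_def E_def divide_simps add_pos_pos)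
    moreover have "lift_kernel x y = (a + b) / (pi * E)"
      using False a b by (simp add: lift_kernel_def a_def b_def d_def D_def E_def max_def)
    moreover have "1 / (4 * pi) * (4 * (r / E)) = r / (pi * E)" for r by simp
    ultimately show ?thesis by (simp only:)
  qed
  \<comment> \<open>The cap \<open>t \<le> 1\<close> makes the denominator with \<open>t * w\<close>
    the smaller one; without it the bound could not be linear in the height.\<close>
  have "t * (w / (1 + w)) \<le> t * w / (1 + t * w)"
  proof -
    have "t * w / (1 + w) \<le> t * w / (1 + t * w)"
      using t w mult_right_mono[OF t(2) w] by (intro divide_left_mono mult_nonneg_nonneg mult_pos_pos add_pos_nonneg) auto
    then show ?thesis by simp
  qed
  also have "\<dots> \<le> ln (1 + t * w)"
  proof -
    have p: "0 < 1 + t * w" using t w by (simp add: add_pos_nonneg)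
    then have "ln (1 / (1 + t * w)) \<le> 1 / (1 + t * w) - 1" by (intro ln_le_minus_one) simp
    then show ?thesis using p by (simp add: ln_div field_simps)
  qed
  finally have "ln (1 + 4 * a * b / d) + t * (w / (1 + w)) \<le> ln (1 + 4 * a * b / d) + ln (1 + t * w)" by simp
  also have "\<dots> = ln ((1 + 4 * a * b / d) * (1 + t * w))"
    using a b d t w by (intro ln_mult_pos[symmetric] add_pos_nonneg) auto
  \<comment> \<open>The factor \<open>1 + 4 * a * b / d\<close> is \<open>D / d\<close>, which
    cancels the denominator of \<open>w\<close>. It remains to compare with (a + h)(b + h) = ab +
    h(a + b) + h^2, where the square is dropped and \<open>t \<le> h\<close>.\<close>
  also have "\<dots> \<le> ln (1 + 4 * (a + h) * (b + h) / d)"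
  proof (subst ln_le_cancel_iff)
    show "0 < (1 + 4 * a * b / d) * (1 + t * w)"
      using a b d t w by (intro mult_pos_pos add_pos_nonneg) auto
    show "0 < 1 + 4 * (a + h) * (b + h) / d" using a b d h by (intro add_pos_nonneg) auto
    have "(1 + 4 * a * b / d) = D / d" using d by (simp add: D_def add_divide_distrib)
    moreover have "D / d * (1 + t * (r / D)) = (D + t * r) / d" for r
      using D by (simp add: distrib_left add_divide_distrib)
    ultimately have "(1 + 4 * a * b / d) * (1 + t * w) = (D + t * (4 * (a + b))) / d"
      by (simp only: w_def)
    also have "\<dots> \<le> (d + 4 * (a + h) * (b + h)) / d"
    proof (rule divide_right_mono)
      have "t * (4 * (a + b)) \<le> h * (4 * (a + b))" using t a b by (intro mult_right_mono) auto
      moreover have "0 \<le> h * h" by simp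
      moreover have "4 * (a + h) * (b + h) = 4 * a * b + h * (4 * (a + b)) + 4 * (h * h)"
        by (simp add: algebra_simps)
      ultimately show "D + t * (4 * (a + b)) \<le> d + 4 * (a + h) * (b + h)"
        unfolding D_def by linarith
    qed (use d in simp)
    also have "\<dots> = 1 + 4 * (a + h) * (b + h) / d" using d by (simp add: add_divide_distrib)
    finally show "(1 + 4 * a * b / d) * (1 + t * w) \<le> 1 + 4 * (a + h) * (b + h) / d" .
  qed
  finally have "1 / (4 * pi) * (ln (1 + 4 * a * b / d) + t * (w / (1 + w)))
      \<le> 1 / (4 * pi) * ln (1 + 4 * (a + h) * (b + h) / d)"
    by (rule mult_left_mono) simp
  then show ?thesis unfolding g gh lk t_def[symmetric] by (simp add: algebra_simps)
qed

text \<open>The translation is moved from the two functions to the kernel, so that the energies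
  before and after a shift are integrals against the same densities and can be compared kernel by
  kernel. For a purely horizontal shift the kernel does not change at all.\<close>

lemma interaction_translate:
  assumes f: "vorticity f" and g: "vorticity g" and h: "0 \<le> h"
  shows "interaction (\<lambda>x. f (x + (a, - h))) (\<lambda>x. g (x + (a, - h)))
    = (\<integral>x. f x * (\<integral>y. hgreen (x + (- a, h)) (y + (- a, h)) * g y \<partial>lborel) \<partial>lborel)" (is ?eq)
    and "integrable lborel (\<lambda>x. f x * (\<integral>y. hgreen (x + (- a, h)) (y + (- a, h)) * g y \<partial>lborel))" (is ?int)
    and "integrable lborel (\<lambda>y. hgreen (x + (- a, h)) (y + (- a, h)) * g y)" (is ?int2)
proof -
  note [measurable] = vorticity_measurable[OF f] vorticity_measurable[OF g]
  let ?f = "\<lambda>x. f (x + (a, - h))" and ?g = "\<lambda>x. g (x + (a, - h))" and ?z = "(- a, h)"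
  have fv: "vorticity ?f" and gv: "vorticity ?g"
    by (intro vorticity_translate(1) f g h)+
  note [measurable] = vorticity_measurable[OF fv] vorticity_measurable[OF gv]
  have can: "x + ?z + (a, - h) = x" for x :: "real \<times> real"
    by (cases x) simp
  have [measurable]: "hgreen x \<in> borel_measurable borel" for x
    by (rule kernel_measurable_right[OF kernel_hgreen])
  have "integrable lborel (\<lambda>y. hgreen (x + ?z) (y + ?z) * ?g (y + ?z))" for x
    by (rule integrable_lborel_translate[of "\<lambda>y. hgreen (x + ?z) y * ?g y"])
      (auto intro: potential_integrable gv)
  then show ?int2 unfolding can .
  have pot: "potential ?g (x + ?z) = (\<integral>y. hgreen (x + ?z) (y + ?z) * g y \<partial>lborel)" for x
  proof -
    have "potential ?g (x + ?z) = (\<integral>y. hgreen (x + ?z) (y + ?z) * ?g (y + ?z) \<partial>lborel)"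
      unfolding potential_def
      by (rule integral_lborel_translate[of "\<lambda>y. hgreen (x + ?z) y * ?g y", symmetric]) measurable
    then show ?thesis unfolding can .
  qed
  note [measurable] = potential_measurable[OF gv]
  have "(\<integral>x. ?f (x + ?z) * potential ?g (x + ?z) \<partial>lborel) = interaction ?f ?g"
    unfolding interaction_potential(1)[OF fv gv]
    by (rule integral_lborel_translate[of "\<lambda>x. ?f x * potential ?g x"]) measurable
  then show ?eq unfolding can pot by (rule sym)
  have "integrable lborel (\<lambda>x. ?f (x + ?z) * potential ?g (x + ?z))"
    by (rule integrable_lborel_translate[of "\<lambda>x. ?f x * potential ?g x"])
      (auto intro: interaction_potential_integrable fv gv)
  then show ?int unfolding can pot .
qed

lemma interaction_translate_horizontal:
  assumes f: "vorticity f" and g: "vorticity g"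
  shows "interaction (\<lambda>x. f (x + (a, 0))) (\<lambda>x. g (x + (a, 0))) = interaction f g"
proof -
  have "hgreen (x + (- a, 0)) (y + (- a, 0)) = hgreen x y" for x y
    by (simp add: hgreen_def dist_norm)
  then show ?thesis
    using interaction_translate(1)[OF f g, of 0 a]
    by (simp add: interaction_potential(1)[OF f g] potential_def)
qed

lemma bounded_kernel_integrable:
  assumes f: "vorticity f" and g: "vorticity g"
  shows "integrable lborel (\<lambda>y. lift_kernel x y * g y)"
    and "integrable lborel (\<lambda>x. f x * (\<integral>y. lift_kernel x y * g y \<partial>lborel))"
proof -
  note [measurable] = vorticity_measurable[OF f] vorticity_measurable[OF g] lift_kernel_measurable
    kernel_measurable_right[OF kernel_lift]
  have le: "lift_kernel x y * g y \<le> g y" "0 \<le> lift_kernel x y * g y" for x y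
    using lift_kernel_bounds[of x y] vorticity_nonneg[OF g, of y] mult_right_mono[of "lift_kernel x y" 1 "g y"] by auto
  have i: "integrable lborel (\<lambda>y. lift_kernel x y * g y)" for x
  proof (rule Bochner_Integration.integrable_bound[OF vorticity_integrable[OF g]])
    have "norm (lift_kernel x y * g y) \<le> norm (g y)" for y
      unfolding real_norm_def abs_of_nonneg[OF le(2)] by (rule order_trans[OF le(1) abs_ge_self])
    then show "AE y in lborel. norm (lift_kernel x y * g y) \<le> norm (g y)" by simp
  qed measurable
  then show "integrable lborel (\<lambda>y. lift_kernel x y * g y)" .
  have b: "0 \<le> (\<integral>y. lift_kernel x y * g y \<partial>lborel)" "(\<integral>y. lift_kernel x y * g y \<partial>lborel) \<le> mass g" for x
    unfolding mass_def
    by (intro integral_nonneg_AE AE_I2 le) (intro integral_mono i vorticity_integrable g le)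
  have "(\<lambda>x. \<integral>y. lift_kernel (fst (x, y)) (snd (x, y)) * g y \<partial>lborel) \<in> borel_measurable borel" by measurable
  then have [measurable]: "(\<lambda>x. \<integral>y. lift_kernel x y * g y \<partial>lborel) \<in> borel_measurable borel" by simp
  show "integrable lborel (\<lambda>x. f x * (\<integral>y. lift_kernel x y * g y \<partial>lborel))"
  proof (rule Bochner_Integration.integrable_bound)
    show "integrable lborel (\<lambda>x. mass g * f x)" by (intro integrable_mult_right vorticity_integrable f)
    have "norm (f x * (\<integral>y. lift_kernel x y * g y \<partial>lborel)) \<le> norm (mass g * f x)" for x
      using mult_left_mono[OF b(2)[of x] vorticity_nonneg[OF f, of x]] b(1)[of x]
        vorticity_nonneg[OF f, of x] mass_nonneg[OF g]
      by (simp add: abs_mult mult.commute[of "mass g" "f x"])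
    then show "AE x in lborel. norm (f x * (\<integral>y. lift_kernel x y * g y \<partial>lborel)) \<le> norm (mass g * f x)" by simp
  qed measurable
qed

definition lift_gain :: "(real \<times> real \<Rightarrow> real) \<Rightarrow> real" where
  "lift_gain f = (\<integral>x. f x * (\<integral>y. lift_kernel x y * f y \<partial>lborel) \<partial>lborel)"

lemma lift_inner_nonneg: "vorticity f \<Longrightarrow> 0 \<le> (\<integral>y. lift_kernel x y * f y \<partial>lborel)"
  by (intro integral_nonneg_AE AE_I2 mult_nonneg_nonneg lift_kernel_bounds vorticity_nonneg)

lemma lift_gain_nonneg: "vorticity f \<Longrightarrow> 0 \<le> lift_gain f"
  unfolding lift_gain_def
  by (intro integral_nonneg_AE AE_I2 mult_nonneg_nonneg lift_inner_nonneg vorticity_nonneg)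

lemma lift_gain_pos:
  assumes f: "vorticity f" and m: "0 < mass f"
  shows "0 < lift_gain f"
  unfolding lift_gain_def
proof (rule integral_mult_pos[OF vorticity_integrable[OF f] vorticity_nonneg[OF f]])
  show m': "0 < (\<integral>x. f x \<partial>lborel)" using m by (simp add: mass_def)
  show "0 \<le> (\<integral>y. lift_kernel x y * f y \<partial>lborel)" for x by (rule lift_inner_nonneg[OF f])
  show "integrable lborel (\<lambda>x. f x * (\<integral>y. lift_kernel x y * f y \<partial>lborel))"
    by (rule bounded_kernel_integrable[OF f f])
  have "0 < (\<integral>y. lift_kernel x y * f y \<partial>lborel)" if "0 < f x" for x
  proof -
    have x: "0 < snd x" using that vorticity_zero[OF f, of x] by force
    have "0 < (\<integral>y. f y * lift_kernel x y \<partial>lborel)"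
    proof (rule integral_mult_pos[OF vorticity_integrable[OF f] vorticity_nonneg[OF f] m'])
      show "integrable lborel (\<lambda>y. f y * lift_kernel x y)"
        using bounded_kernel_integrable(1)[OF f f, of x] by (simp add: mult.commute)
      show "AE y in lborel. 0 < f y \<longrightarrow> 0 < lift_kernel x y"
        using AE_lborel_singleton[of x]
      proof eventually_elim
        case (elim y)
        then show ?case using vorticity_zero[OF f, of y] lift_kernel_pos[OF x, of y] by force
      qed
    qed (rule lift_kernel_bounds)
    then show ?thesis by (simp add: mult.commute)
  qed
  then show "AE x in lborel. 0 < f x \<longrightarrow> 0 < (\<integral>y. lift_kernel x y * f y \<partial>lborel)" by simp
qed

lemma lift_gain_mono:
  assumes f: "vorticity f" and g: "vorticity g" and le: "\<And>x. f x \<le> g x"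
  shows "lift_gain f \<le> lift_gain g"
  unfolding lift_gain_def
proof (rule integral_mono[OF bounded_kernel_integrable(2)[OF f f] bounded_kernel_integrable(2)[OF g g]])
  fix x
  have "(\<integral>y. lift_kernel x y * f y \<partial>lborel) \<le> (\<integral>y. lift_kernel x y * g y \<partial>lborel)"
    by (intro integral_mono bounded_kernel_integrable(1)[OF f f] bounded_kernel_integrable(1)[OF g g]
        mult_left_mono le lift_kernel_bounds)
  then show "f x * (\<integral>y. lift_kernel x y * f y \<partial>lborel) \<le> g x * (\<integral>y. lift_kernel x y * g y \<partial>lborel)"
    by (rule mult_mono[OF le _ vorticity_nonneg[OF g] lift_inner_nonneg[OF f]])
qed

lemma lift_gain_cmult: "lift_gain (\<lambda>x. c * f x) = c\<^sup>2 * lift_gain f"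
proof -
  have "c * f x * (\<integral>y. lift_kernel x y * (c * f y) \<partial>lborel) = c\<^sup>2 * (f x * (\<integral>y. lift_kernel x y * f y \<partial>lborel))" for x
    by (simp add: mult.left_commute[of _ c] power2_eq_square)
  then have "lift_gain (\<lambda>x. c * f x) = (\<integral>x. c\<^sup>2 * (f x * (\<integral>y. lift_kernel x y * f y \<partial>lborel)) \<partial>lborel)"
    unfolding lift_gain_def by (rule Bochner_Integration.integral_cong[OF refl])
  then show ?thesis unfolding lift_gain_def by simp
qed

text \<open>A shift leaves the enstrophy unchanged, so the whole gain comes from the kernel.
  Integrating the pointwise estimate \<open>hgreen_lift\<close> against \<open>f\<close> in both
  variables produces \<open>lift_gain f\<close>.\<close>

lemma penalized_lift:
  assumes f: "vorticity f" and h: "0 \<le> h"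
  shows "penalized l f + min 1 h * lift_gain f / 2 \<le> penalized l (\<lambda>x. f (x + (0, - h)))"
proof -
  have tr1: "interaction (\<lambda>x. f (x + (0, - h))) (\<lambda>x. f (x + (0, - h)))
      = (\<integral>x. f x * (\<integral>y. hgreen (x + (0, h)) (y + (0, h)) * f y \<partial>lborel) \<partial>lborel)"
    using interaction_translate(1)[OF f f h, where a = 0] by simp
  have tr2: "integrable lborel (\<lambda>x. f x * (\<integral>y. hgreen (x + (0, h)) (y + (0, h)) * f y \<partial>lborel))"
    using interaction_translate(2)[OF f f h, where a = 0] by simp
  have tr3: "integrable lborel (\<lambda>y. hgreen (x + (0, h)) (y + (0, h)) * f y)" for x
    using interaction_translate(3)[OF f f h, where a = 0] by simp
  have inner: "potential f x + min 1 h * (\<integral>y. lift_kernel x y * f y \<partial>lborel)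
     \<le> (\<integral>y. hgreen (x + (0, h)) (y + (0, h)) * f y \<partial>lborel)" if x: "0 < snd x" for x
  proof -
    have "potential f x + min 1 h * (\<integral>y. lift_kernel x y * f y \<partial>lborel)
      = (\<integral>y. hgreen x y * f y + min 1 h * (lift_kernel x y * f y) \<partial>lborel)"
      unfolding potential_def
      by (subst Bochner_Integration.integral_add)
        (auto intro: potential_integrable bounded_kernel_integrable(1)[OF f f] f)
    also have "\<dots> \<le> (\<integral>y. hgreen (x + (0, h)) (y + (0, h)) * f y \<partial>lborel)"
    proof (rule integral_mono[OF _ tr3])
      show "integrable lborel (\<lambda>y. hgreen x y * f y + min 1 h * (lift_kernel x y * f y))"
        by (intro Bochner_Integration.integrable_add potential_integrable integrable_mult_right
            bounded_kernel_integrable(1)[OF f f] f)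
      show "hgreen x y * f y + min 1 h * (lift_kernel x y * f y) \<le> hgreen (x + (0, h)) (y + (0, h)) * f y" for y
      proof (cases "0 < snd y")
        case True
        from mult_right_mono[OF hgreen_lift[OF x True h] vorticity_nonneg[OF f, of y]]
        show ?thesis by (simp add: distrib_right)
      next
        case False
        then have "f y = 0" by (intro vorticity_zero[OF f]) simp
        then show ?thesis by simp
      qed
    qed
    finally show ?thesis .
  qed
  have "interaction f f + min 1 h * lift_gain f
     = (\<integral>x. f x * potential f x + min 1 h * (f x * (\<integral>y. lift_kernel x y * f y \<partial>lborel)) \<partial>lborel)"
    unfolding lift_gain_def interaction_potential(1)[OF f f]
    by (subst Bochner_Integration.integral_add)
      (auto intro: interaction_potential_integrable bounded_kernel_integrable f)
  also have "\<dots> \<le> (\<integral>x. f x * (\<integral>y. hgreen (x + (0, h)) (y + (0, h)) * f y \<partial>lborel) \<partial>lborel)"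
  proof (rule integral_mono[OF _ tr2])
    show "integrable lborel (\<lambda>x. f x * potential f x + min 1 h * (f x * (\<integral>y. lift_kernel x y * f y \<partial>lborel)))"
      by (intro Bochner_Integration.integrable_add integrable_mult_right
          interaction_potential_integrable bounded_kernel_integrable f)
    show "f x * potential f x + min 1 h * (f x * (\<integral>y. lift_kernel x y * f y \<partial>lborel))
        \<le> f x * (\<integral>y. hgreen (x + (0, h)) (y + (0, h)) * f y \<partial>lborel)" for x
    proof (cases "0 < snd x")
      case True
      from mult_left_mono[OF inner[OF True] vorticity_nonneg[OF f, of x]]
      show ?thesis by (simp add: distrib_left mult.left_commute)
    next
      case False
      then have "f x = 0" by (intro vorticity_zero[OF f]) simp
      then show ?thesis by simp
    qed
  qed
  also have "\<dots> = interaction (\<lambda>x. f (x + (0, - h))) (\<lambda>x. f (x + (0, - h)))"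
    by (rule tr1[symmetric])
  finally show ?thesis
    unfolding penalized_def vorticity_translate(3)[OF f h] by (simp add: add_divide_distrib)
qed

section \<open>Behaviour of the functionals under multiples and sums\<close>

lemma enstrophy_cmult: "enstrophy (\<lambda>x. c * f x) = c\<^sup>2 * enstrophy f"
  unfolding enstrophy_def by (simp add: power_mult_distrib)

lemma mass_cmult: "mass (\<lambda>x. c * f x) = c * mass f"
  unfolding mass_def by simp

lemma impulse_cmult: "impulse (\<lambda>x. c * f x) = c * impulse f"
  unfolding impulse_def by (simp add: mult.left_commute[of _ c])

lemma mass_add: "vorticity f \<Longrightarrow> vorticity g \<Longrightarrow> mass (\<lambda>x. f x + g x) = mass f + mass g"
  unfolding mass_def by (intro Bochner_Integration.integral_add vorticity_integrable)

lemma impulse_add: "vorticity f \<Longrightarrow> vorticity g \<Longrightarrow> impulse (\<lambda>x. f x + g x) = impulse f + impulse g"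
  unfolding impulse_def distrib_left
  by (intro Bochner_Integration.integral_add vorticity_impulse_integrable)

lemma enstrophy_add:
  assumes f: "vorticity f" and g: "vorticity g"
  shows "enstrophy (\<lambda>x. f x + g x) = enstrophy f + enstrophy g + 2 * (\<integral>x. f x * g x \<partial>lborel)"
proof -
  have i: "integrable lborel (\<lambda>x. 2 * (f x * g x))"
    by (intro integrable_mult_right square_integrable_mult vorticity_square f g)
  have "enstrophy (\<lambda>x. f x + g x) = (\<integral>x. ((f x)\<^sup>2 + (g x)\<^sup>2) + 2 * (f x * g x) \<partial>lborel)"
    unfolding enstrophy_def
    by (rule Bochner_Integration.integral_cong) (simp_all add: power2_sum)
  also have "\<dots> = (\<integral>x. (f x)\<^sup>2 + (g x)\<^sup>2 \<partial>lborel) + (\<integral>x. 2 * (f x * g x) \<partial>lborel)"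
    by (intro Bochner_Integration.integral_add Bochner_Integration.integrable_add
        vorticity_square_integrable f g i)
  also have "(\<integral>x. (f x)\<^sup>2 + (g x)\<^sup>2 \<partial>lborel) = enstrophy f + enstrophy g"
    unfolding enstrophy_def
    by (intro Bochner_Integration.integral_add vorticity_square_integrable f g)
  finally show ?thesis by simp
qed

lemma interaction_add:
  assumes f: "vorticity f" and g: "vorticity g"
  shows "interaction (\<lambda>x. f x + g x) (\<lambda>x. f x + g x) = interaction f f + interaction g g + 2 * interaction f g"
proof -
  note fg = vorticity_add[OF f g]
  have "interaction (\<lambda>x. f x + g x) (\<lambda>x. f x + g x)
      = (interaction f f + interaction f g) + (interaction g f + interaction g g)"
    unfolding interaction_def
    by (simp only: pairing_add_left[OF subkernel_hgreen f g fg] pairing_add_right[OF subkernel_hgreen f f g]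
        pairing_add_right[OF subkernel_hgreen g f g])
  then show ?thesis using interaction_sym[OF f g] by simp
qed

text \<open>Polarization of a quadratic functional. The last term is the one that decides whether
  superposing two profiles pays off; it is the integral of \<open>g\<close> against the potential of
  \<open>f\<close> minus \<open>f / l\<close>.\<close>

lemma penalized_add:
  assumes f: "vorticity f" and g: "vorticity g"
  shows "penalized l (\<lambda>x. f x + g x)
    = penalized l f + penalized l g + (interaction f g - (\<integral>x. f x * g x \<partial>lborel) / l)"
  unfolding penalized_def interaction_add[OF f g] enstrophy_add[OF f g]
  by (simp add: add_divide_distrib)

lemma penalized_cmult: "penalized l (\<lambda>x. c * f x) = c\<^sup>2 * penalized l f"
  unfolding penalized_def enstrophy_cmult interaction_def pairing_cmult_left pairing_cmult_right
  by (simp add: power2_eq_square right_diff_distrib)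

section \<open>The Euler--Lagrange inequality\<close>

text \<open>On the set \<open>A\<close> where \<open>G\<omega> \<le> \<omega> / l\<close>, lowering \<open>\<omega>\<close> by the factor \<open>1 - \<epsilon>\<close> costs only \<open>O(\<epsilon>\<^sup>2)\<close>,
  but frees an amount of impulse proportional to \<open>\<epsilon>\<close>, which an upward shift converts into a
  first-order gain. So \<open>A\<close> is null.\<close>

lemma maximizer_potential_gt:
  assumes w: "vorticity w" and m: "0 < mass w" and l: "0 < l"
    and max: "\<And>f. vorticity f \<Longrightarrow> impulse f \<le> impulse w \<Longrightarrow> mass f \<le> mass w \<Longrightarrow> penalized l f \<le> penalized l w"
  shows "AE x in lborel. 0 < snd x \<longrightarrow> w x / l < potential w x"
proof -
  note [measurable] = vorticity_measurable[OF w] potential_measurable[OF w]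
  define A where "A = {x. 0 < snd x \<and> potential w x \<le> w x / l}"
  have "{x \<in> space borel. 0 < snd x \<and> potential w x \<le> w x / l} \<in> sets borel" by measurable
  then have A: "A \<in> sets borel" by (simp add: A_def)
  have A': "- A \<in> sets borel" using A by (rule borel_comp)
  define t where "t = cutoff A w"
  define v where "v = cutoff (- A) w"
  have t: "vorticity t" and v: "vorticity v" unfolding t_def v_def by (intro vorticity_cutoff w A A')+
  have wtv: "w = (\<lambda>x. t x + v x)" by (auto simp: t_def v_def cutoff_def indicator_def)
  define d where "d = impulse t"
  have d0: "0 \<le> d" unfolding d_def by (rule impulse_nonneg[OF t])
  have "d = 0"
  proof (rule ccontr)
    assume "d \<noteq> 0"
    then have d: "0 < d" using d0 by simp
    \<comment> \<open>Lowering \<open>w\<close> on \<open>A\<close> by the fraction \<open>e\<close>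
      frees the impulse \<open>e * d\<close>, and a lift by \<open>h\<close> consumes at most
      \<open>h * mass w\<close>; so \<open>a\<close> is the height affordable per unit of
      \<open>e\<close>.\<close>
    define a where "a = d / mass w"
    define g where "g = lift_gain w"
    define b where "b = enstrophy t / (2 * l)"
    have a: "0 < a" using d m by (simp add: a_def)
    have g: "0 < g" unfolding g_def by (rule lift_gain_pos[OF w m])
    have b: "0 \<le> b" using l enstrophy_nonneg[of t] by (simp add: b_def)
    \<comment> \<open>The bound 1/2 keeps \<open>u\<close> above half of \<open>w\<close>, so that
      its lift gain stays at least \<open>g / 4\<close>; \<open>1 / a\<close> keeps the lift height
      at most 1; the last bound makes the cost \<open>e\<^sup>2 * b\<close> smaller than the gain
      \<open>e * a * g / 8\<close>.\<close>
    define e where "e = min (1/2) (min (1 / a) (a * g / (16 * (b + 1))))"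
    have e: "0 < e" "e \<le> 1/2" "e \<le> 1 / a" "e \<le> a * g / (16 * (b + 1))"
    proof -
      show "0 < e" using a b g by (simp add: e_def)
      show "e \<le> 1/2" unfolding e_def by (rule min.cobounded1)
      show "e \<le> 1 / a" unfolding e_def by (rule min.coboundedI2, rule min.cobounded1)
      show "e \<le> a * g / (16 * (b + 1))" unfolding e_def by (rule min.coboundedI2, rule min.cobounded2)
    qed
    define u where "u = (\<lambda>x. (1 - e) * t x + v x)"
    have u: "vorticity u" unfolding u_def using e by (intro vorticity_add vorticity_cmult t v) auto
    have et: "vorticity (\<lambda>x. e * t x)" using e by (intro vorticity_cmult t) auto
    have wu: "w = (\<lambda>x. u x + e * t x)" unfolding wtv u_def by (auto simp: algebra_simps)
    have pw: "penalized l w = penalized l u + penalized l (\<lambda>x. e * t x)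
        + (interaction u (\<lambda>x. e * t x) - (\<integral>x. u x * (e * t x) \<partial>lborel) / l)"
      by (subst wu) (rule penalized_add[OF u et])
    have iw: "interaction t w = interaction t u + e * interaction t t"
      unfolding interaction_def
      by (subst wu) (simp only: pairing_add_right[OF subkernel_hgreen t u et] pairing_cmult_right)
    have iut: "interaction u (\<lambda>x. e * t x) = e * interaction t u"
      using interaction_sym[OF u t] by (simp add: interaction_def pairing_cmult_right)
    have ut: "u x * (e * t x) = (e * (1 - e)) * (t x)\<^sup>2" for x
      by (auto simp: u_def t_def v_def cutoff_def indicator_def power2_eq_square)
    have "(\<integral>x. u x * (e * t x) \<partial>lborel) = e * (1 - e) * enstrophy t"
      unfolding ut enstrophy_def by simp
    then have "penalized l w = penalized l u + e\<^sup>2 * penalized l t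
        + (e * (interaction t w - e * interaction t t) - e * (1 - e) * enstrophy t / l)"
      unfolding pw iut iw by (simp add: penalized_cmult)
    \<comment> \<open>Collected by powers of \<open>e\<close>. The linear term is at most 0 because
      on \<open>A\<close> the potential is at most \<open>w / l\<close>, so passing from
      \<open>w\<close> to \<open>u\<close> loses no more than \<open>e\<^sup>2 * b\<close>.\<close>
    also have "\<dots> = penalized l u + e * (interaction t w - enstrophy t / l) - e\<^sup>2 * (interaction t t / 2) + e\<^sup>2 * b"
      unfolding penalized_def b_def using l by (simp add: field_simps power2_eq_square)
    finally have pwu: "penalized l w = \<dots>" .
    have itw: "interaction t w \<le> enstrophy t / l"
    proof -
      have "interaction t w = (\<integral>x. t x * potential w x \<partial>lborel)" by (rule interaction_potential[OF t w])
      also have "\<dots> \<le> (\<integral>x. (t x)\<^sup>2 / l \<partial>lborel)"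
      proof (rule integral_mono[OF interaction_potential_integrable[OF t w]])
        show "integrable lborel (\<lambda>x. (t x)\<^sup>2 / l)" using vorticity_square_integrable[OF t] by simp
        show "t x * potential w x \<le> (t x)\<^sup>2 / l" for x
        proof (cases "x \<in> A")
          case True
          then have "potential w x \<le> t x / l" by (simp add: A_def t_def cutoff_def)
          from mult_left_mono[OF this vorticity_nonneg[OF t, of x]] show ?thesis
            by (simp add: power2_eq_square)
        qed (simp add: t_def cutoff_def)
      qed
      finally show ?thesis by (simp add: enstrophy_def)
    qed
    have itt: "0 \<le> interaction t t" unfolding interaction_def by (rule pairing_nonneg[OF kernel_hgreen t t])
    have pu: "penalized l w - e\<^sup>2 * b \<le> penalized l u"
    proof -
      have "e * (interaction t w - enstrophy t / l) \<le> 0" using itw e by (intro mult_nonneg_nonpos) auto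
      moreover have "0 \<le> e\<^sup>2 * (interaction t t / 2)" using itt by simp
      ultimately show ?thesis using pwu by linarith
    qed
    define h where "h = e * a"
    have h: "0 \<le> h" "h \<le> 1" using e a by (auto simp: h_def field_simps)
    have mw: "mass w = mass u + e * mass t"
      by (subst wu) (simp only: mass_add[OF u et] mass_cmult)
    have mu: "mass u \<le> mass w" using mw e mass_nonneg[OF t] by simp
    have "impulse w = impulse u + e * d"
      unfolding d_def by (subst wu) (simp only: impulse_add[OF u et] impulse_cmult)
    moreover have "h * mass u \<le> h * mass w" by (rule mult_left_mono[OF mu h(1)])
    moreover have "h * mass w = e * d" using m by (simp add: h_def a_def)
    ultimately have iu: "impulse u + h * mass u \<le> impulse w" by simp
    have "penalized l (\<lambda>x. u (x + (0, - h))) \<le> penalized l w"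
      using iu mu vorticity_translate[OF u h(1), of 0] by (intro max) auto
    then have "penalized l u + min 1 h * lift_gain u / 2 \<le> penalized l w"
      using penalized_lift[OF u h(1), of l] by linarith
    \<comment> \<open>The lifted \<open>u\<close> obeys the constraints of \<open>w\<close>, so its
      gain cannot exceed what the lowering has cost. The left side is of first order in
      \<open>e\<close>, the right side of second order.\<close>
    then have 1: "h * lift_gain u / 2 \<le> e\<^sup>2 * b" using pu h by (simp add: min_def split: if_splits)
    have "lift_gain (\<lambda>x. (1/2) * w x) \<le> lift_gain u"
    proof (rule lift_gain_mono[OF vorticity_cmult[OF w] u])
      show "(1/2) * w x \<le> u x" for x
        using e vorticity_nonneg[OF t, of x] vorticity_nonneg[OF v, of x] mult_right_mono[of "1/2" "1 - e" "t x"]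
        by (simp add: wtv u_def)
    qed simp
    moreover have "lift_gain (\<lambda>x. (1/2) * w x) = g / 4"
      by (simp only: lift_gain_cmult g_def) (simp add: power2_eq_square)
    ultimately have "g / 4 \<le> lift_gain u" by simp
    then have "h * (g / 4) \<le> h * lift_gain u" by (rule mult_left_mono[OF _ h(1)])
    then have "e * (a * g / 8) \<le> e * (e * b)" using 1 by (simp add: h_def power2_eq_square)
    then have "a * g / 8 \<le> e * b" using e by simp
    also have "\<dots> \<le> a * g / (16 * (b + 1)) * b" by (rule mult_right_mono[OF e(4) b])
    also have "\<dots> = a * g / 16 * (b / (b + 1))" using b by (simp add: field_simps)
    also have "\<dots> \<le> a * g / 16 * 1" using a g b by (intro mult_left_mono) auto
    finally show False using a g by simp
  qed
  \<comment> \<open>So \<open>w\<close> vanishes almost everywhere on \<open>A\<close>. At a point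
    of \<open>A\<close> where \<open>w\<close> is 0 the potential would be at most 0, but it is
    positive throughout the half plane.\<close>
  then have "AE x in lborel. snd x * t x = 0"
    unfolding d_def impulse_def
    by (subst (asm) integral_nonneg_eq_0_iff_AE[OF vorticity_impulse_integrable[OF t]])
      (auto intro: vorticity_height_nonneg t)
  then show ?thesis
  proof eventually_elim
    case (elim x)
    show ?case
    proof (intro impI, rule ccontr)
      assume x: "0 < snd x" and n: "\<not> w x / l < potential w x"
      then have "x \<in> A" by (simp add: A_def)
      then have "w x = 0" using elim x by (simp add: t_def cutoff_def)
      then show False using n potential_pos[OF w m x] by simp
    qed
  qed
qed

section \<open>The relaxed variational problem\<close>

text \<open>\<open>S\<close> plays the part of the negative of \<open>min_value\<close>. The locale
  records only that it is a positive upper bound; that it is approached enters through the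
  maximizing sequences in the individual lemmas.\<close>

locale variational =
  fixes \<mu> \<nu> l S :: real
  assumes pos: "0 < \<mu>" "0 < \<nu>" "0 < l" "0 < S"
    and upper: "\<And>f. vorticity f \<Longrightarrow> impulse f = \<mu> \<Longrightarrow> mass f \<le> \<nu> \<Longrightarrow> penalized l f \<le> S"
begin

text \<open>Lifting \<open>f\<close> by the missing impulse divided by its mass restores impulse
  \<mu> exactly, keeps mass and enstrophy, and increases the energy, strictly if some impulse was
  missing. A profile without mass cannot be lifted to that impulse, but its value is at most 0,
  which is less than \<open>S\<close>. The strict version later excludes that impulse escapes
  upward.\<close>

lemma relaxed:
  assumes f: "vorticity f" and i: "impulse f \<le> \<mu>" and m: "mass f \<le> \<nu>"
  shows relaxed_le: "penalized l f \<le> S"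
    and relaxed_less: "impulse f < \<mu> \<Longrightarrow> penalized l f < S"
proof -
  have "penalized l f \<le> S \<and> (impulse f < \<mu> \<longrightarrow> penalized l f < S)"
  proof (cases "mass f = 0")
    case True
    then have "AE x in lborel. f x = 0"
      unfolding mass_def using vorticity_nonneg[OF f]
      by (subst (asm) integral_nonneg_eq_0_iff_AE[OF vorticity_integrable[OF f]]) auto
    then have "AE x in lborel. snd x * f x = 0" by eventually_elim simp
    then have "impulse f = 0" unfolding impulse_def by (rule integral_eq_zero_AE)
    then have "interaction f f \<le> 0" using interaction_le[OF f f, of 1] True by simp
    moreover have "0 \<le> enstrophy f / (2 * l)" using enstrophy_nonneg[of f] pos(3) by simp
    ultimately have "penalized l f \<le> 0" unfolding penalized_def by linarith
    then show ?thesis using pos(4) by simp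
  next
    case False
    then have m0: "0 < mass f" using mass_nonneg[OF f] by simp
    define h where "h = (\<mu> - impulse f) / mass f"
    have h: "0 \<le> h" using i m0 by (simp add: h_def)
    note tr = vorticity_translate[OF f h, of 0]
    have "h * mass f = \<mu> - impulse f" using m0 by (simp add: h_def)
    then have "penalized l (\<lambda>x. f (x + (0, - h))) \<le> S"
      using tr m by (intro upper) auto
    then have le: "penalized l f + min 1 h * lift_gain f / 2 \<le> S"
      using penalized_lift[OF f h, of l] by linarith
    have "0 \<le> min 1 h * lift_gain f" using h lift_gain_nonneg[OF f] by (intro mult_nonneg_nonneg) auto
    moreover have "0 < min 1 h * lift_gain f" if "impulse f < \<mu>"
    proof (rule mult_pos_pos[OF _ lift_gain_pos[OF f m0]])
      have "0 < h" unfolding h_def using that m0 by (intro divide_pos_pos) auto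
      then show "0 < min 1 h" by simp
    qed
    ultimately show ?thesis using le by auto
  qed
  then show "penalized l f \<le> S" "impulse f < \<mu> \<Longrightarrow> penalized l f < S" by auto
qed

text \<open>Both constraints are linear and the functional is quadratic, so dividing
  \<open>f\<close> by \<theta> leads back to the relaxed problem. In this way a small violation of
  the constraints costs only a factor close to 1.\<close>

lemma relaxed_scaled:
  assumes f: "vorticity f" and th: "1 \<le> \<theta>" and i: "impulse f \<le> \<theta> * \<mu>" and m: "mass f \<le> \<theta> * \<nu>"
  shows "penalized l f \<le> \<theta>\<^sup>2 * S"
proof -
  have "penalized l (\<lambda>x. (1 / \<theta>) * f x) \<le> S"
  proof (rule relaxed_le)
    show "vorticity (\<lambda>x. (1 / \<theta>) * f x)" using th by (intro vorticity_cmult f) auto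
    show "impulse (\<lambda>x. (1 / \<theta>) * f x) \<le> \<mu>"
      unfolding impulse_cmult using th i by (simp add: divide_le_eq mult.commute)
    show "mass (\<lambda>x. (1 / \<theta>) * f x) \<le> \<nu>"
      unfolding mass_cmult using th m by (simp add: divide_le_eq mult.commute)
  qed
  then have "(1 / \<theta>)\<^sup>2 * penalized l f \<le> S" unfolding penalized_cmult .
  then have "\<theta>\<^sup>2 * ((1 / \<theta>)\<^sup>2 * penalized l f) \<le> \<theta>\<^sup>2 * S" by (intro mult_left_mono) auto
  then show ?thesis using th by (simp add: power_divide)
qed

end

text \<open>A square of side \<open>b\<close> placed at height \<open>b\<close>: any two of its
  points have squared distance at most \<open>2 * b\<^sup>2\<close> and product of heights at least
  \<open>b\<^sup>2\<close>, so the argument of the logarithm is at least 3 and the kernel at least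
  \<open>1 / (4 * pi)\<close>, independently of \<open>b\<close>.\<close>

lemma box_vorticity:
  fixes a :: real
  assumes a: "0 \<le> a" and b: "0 < b"
  defines "f \<equiv> \<lambda>x. a * indicator (cbox (0, b) (b, 2 * b)) x"
  shows "vorticity f" "mass f = a * b\<^sup>2" "enstrophy f = a\<^sup>2 * b\<^sup>2"
    "a * b ^ 3 \<le> impulse f" "b ^ 4 * a\<^sup>2 / (4 * pi) \<le> interaction f f"
proof -
  let ?B = "cbox (0, b) (b, 2 * b) :: (real \<times> real) set"
  have Bmem: "x \<in> ?B \<longleftrightarrow> 0 \<le> fst x \<and> fst x \<le> b \<and> b \<le> snd x \<and> snd x \<le> 2 * b" for x
    by (cases x) auto
  have cont: "measure lborel ?B = b\<^sup>2"
    unfolding content_Pair using b by (simp add: power2_eq_square)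
  have fin: "emeasure lborel ?B < \<infinity>" by (rule emeasure_bounded_finite[OF bounded_cbox])
  then have iB: "integrable lborel (indicator ?B :: real \<times> real \<Rightarrow> real)"
    by (intro integrable_real_indicator) auto
  have [measurable]: "?B \<in> sets borel" by simp
  have [measurable]: "f \<in> borel_measurable borel" unfolding f_def by measurable
  have si: "integrable lborel (\<lambda>x. snd x * indicator ?B x)"
  proof (rule Bochner_Integration.integrable_bound)
    show "integrable lborel (\<lambda>x. 2 * b * indicator ?B x :: real)" by (intro integrable_mult_right iB)
    have "norm (snd x * indicator ?B x) \<le> norm (2 * b * indicator ?B x :: real)" for x
      using b Bmem[of x] by (simp add: indicator_def)
    then show "AE x in lborel. norm (snd x * indicator ?B x) \<le> norm (2 * b * indicator ?B x :: real)" by simp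
  qed measurable
  show fv: "vorticity f"
  proof (rule vorticityI)
    show "0 \<le> f x" for x using a by (simp add: f_def)
    show "f x = 0" if "snd x \<le> 0" for x using that Bmem[of x] b by (auto simp: f_def indicator_def)
    show "integrable lborel f" unfolding f_def by (intro integrable_mult_right iB)
    show "integrable lborel (\<lambda>x. snd x * f x)"
      using integrable_mult_right[OF si, of a] by (simp add: f_def mult.left_commute)
    have "(f x)\<^sup>2 = a\<^sup>2 * indicator ?B x" for x by (simp add: f_def indicator_def)
    then show "integrable lborel (\<lambda>x. (f x)\<^sup>2)" by (simp add: iB)
  qed measurable
  have intB: "(\<integral>x. indicator ?B x \<partial>lborel) = b\<^sup>2" using cont by simp
  show "mass f = a * b\<^sup>2" unfolding mass_def f_def using intB by simp
  have "(f x)\<^sup>2 = a\<^sup>2 * indicator ?B x" for x by (simp add: f_def indicator_def)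
  then show "enstrophy f = a\<^sup>2 * b\<^sup>2" unfolding enstrophy_def using intB by simp
  have "a * b ^ 3 = (\<integral>x. (a * b) * indicator ?B x \<partial>lborel)"
    using intB by (simp add: power2_eq_square power3_eq_cube)
  also have "\<dots> \<le> impulse f"
    unfolding impulse_def
  proof (rule integral_mono[OF _ vorticity_impulse_integrable[OF fv]])
    show "integrable lborel (\<lambda>x. (a * b) * indicator ?B x :: real)" by (intro integrable_mult_right iB)
    show "(a * b) * indicator ?B x \<le> snd x * f x" for x
      using a Bmem[of x] by (simp add: f_def indicator_def mult.commute mult_left_mono)
  qed
  finally show "a * b ^ 3 \<le> impulse f" .
  have green: "1 / (4 * pi) \<le> hgreen x y" if "x \<in> ?B" "y \<in> ?B" "y \<noteq> x" for x y
  proof -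
    have "(dist x y)\<^sup>2 = (fst x - fst y)\<^sup>2 + (snd x - snd y)\<^sup>2"
      by (simp add: dist_prod_def dist_real_def)
    also have "\<dots> \<le> b\<^sup>2 + b\<^sup>2"
      using that Bmem[of x] Bmem[of y] b by (intro add_mono abs_le_square_iff[THEN iffD1]) auto
    finally have d: "(dist x y)\<^sup>2 \<le> 2 * b\<^sup>2" by simp
    have d0: "0 < (dist x y)\<^sup>2" using that by simp
    have "4 * (b * b) \<le> 4 * (snd x * snd y)"
      using that Bmem[of x] Bmem[of y] b by (intro mult_left_mono mult_mono) auto
    then have "2 * (dist x y)\<^sup>2 \<le> 4 * snd x * snd y" using d by (simp add: power2_eq_square)
    then have "2 \<le> 4 * snd x * snd y / (dist x y)\<^sup>2" using d0 by (simp add: le_divide_eq)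
    then have "ln 3 \<le> ln (1 + 4 * snd x * snd y / (dist x y)\<^sup>2)" by (subst ln_le_cancel_iff) auto
    moreover have "1 \<le> ln (3 :: real)" using exp_le by (subst ln_ge_iff) auto
    ultimately have "1 \<le> ln (1 + 4 * snd x * snd y / (dist x y)\<^sup>2)" by linarith
    then have "1 / (4 * pi) * 1 \<le> 1 / (4 * pi) * ln (1 + 4 * snd x * snd y / (dist x y)\<^sup>2)"
      by (intro mult_left_mono) auto
    moreover have "hgreen x y = 1 / (4 * pi) * ln (1 + 4 * snd x * snd y / (dist x y)\<^sup>2)"
      using that Bmem[of x] Bmem[of y] b by (simp add: hgreen_def max_def)
    ultimately show ?thesis by simp
  qed
  have pot: "a * b\<^sup>2 / (4 * pi) \<le> potential f x" if x: "x \<in> ?B" for x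
  proof -
    have "a * b\<^sup>2 / (4 * pi) = (\<integral>y. (1 / (4 * pi) * a) * indicator ?B y \<partial>lborel)" using intB by simp
    also have "\<dots> \<le> potential f x"
      unfolding potential_def
    proof (rule integral_mono_AE[OF _ potential_integrable[OF fv]])
      show "integrable lborel (\<lambda>y. (1 / (4 * pi) * a) * indicator ?B y :: real)" by (intro integrable_mult_right iB)
      show "AE y in lborel. (1 / (4 * pi) * a) * indicator ?B y \<le> hgreen x y * f y"
        using AE_lborel_singleton[of x]
      proof eventually_elim
        case (elim y)
        show ?case
        proof (cases "y \<in> ?B")
          case True
          from mult_right_mono[OF green[OF x True elim] a] show ?thesis using True by (simp add: f_def)
        qed (simp add: f_def)
      qed
    qed
    finally show ?thesis .
  qed
  have "b ^ 4 * a\<^sup>2 / (4 * pi) = (\<integral>x. (a * (a * b\<^sup>2 / (4 * pi))) * indicator ?B x \<partial>lborel)"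
    using intB by (simp add: power2_eq_square power4_eq_xxxx)
  also have "\<dots> \<le> interaction f f"
    unfolding interaction_potential(1)[OF fv fv]
  proof (rule integral_mono[OF _ interaction_potential_integrable[OF fv fv]])
    show "integrable lborel (\<lambda>x. (a * (a * b\<^sup>2 / (4 * pi))) * indicator ?B x :: real)" by (intro integrable_mult_right iB)
    show "(a * (a * b\<^sup>2 / (4 * pi))) * indicator ?B x \<le> f x * potential f x" for x
    proof (cases "x \<in> ?B")
      case True
      from mult_left_mono[OF pot[OF True] a] show ?thesis using True by (simp add: f_def)
    qed (simp add: f_def)
  qed
  finally show "b ^ 4 * a\<^sup>2 / (4 * pi) \<le> interaction f f" .
qed

text \<open>On a square of side \<open>b\<close> the interaction is of order \<open>b ^ 4\<close>
  but the enstrophy only \<open>b\<^sup>2\<close>, so the energy wins once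
  \<open>b\<^sup>2 > 4 * pi / l\<close>. Rescaling to impulse \<mu> does not affect the sign, and
  because all mass sits at height at least \<open>b\<close>, the mass is then at most
  \<open>\<mu> / b\<close>.\<close>

lemma exists_positive_energy:
  assumes p: "0 < \<mu>" "0 < \<nu>" "0 < l"
  shows "\<exists>f. vorticity f \<and> impulse f = \<mu> \<and> mass f \<le> \<nu> \<and> 0 < penalized l f"
proof -
  define b where "b = max (\<mu> / \<nu>) (sqrt (4 * pi / l) + 1)"
  have "0 \<le> sqrt (4 * pi / l)" using p by simp
  moreover have b2: "sqrt (4 * pi / l) + 1 \<le> b" unfolding b_def by (rule max.cobounded2)
  ultimately have b: "0 < b" "sqrt (4 * pi / l) < b" by linarith+
  have b1: "\<mu> / \<nu> \<le> b" unfolding b_def by (rule max.cobounded1)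
  have "sqrt (4 * pi / l) ^ 2 < b ^ 2"
    using b p by (intro power_strict_mono) auto
  then have b3: "4 * pi / l < b\<^sup>2" using p by simp
  define e where "e = (\<lambda>x::real \<times> real. 1 * indicator (cbox (0, b) (b, 2 * b)) x :: real)"
  note e = box_vorticity[of 1 b, OF _ b(1), folded e_def, simplified]
  have i: "0 < impulse e" using e(4) zero_less_power[OF b(1), of 3] by linarith
  define a where "a = \<mu> / impulse e"
  have a: "0 < a" using i p by (simp add: a_def)
  define f where "f = (\<lambda>x. a * e x)"
  have f: "vorticity f" unfolding f_def using a by (intro vorticity_cmult e) auto
  have fi: "impulse f = \<mu>" unfolding f_def impulse_cmult using i by (simp add: a_def)
  have "mass f = \<mu> * (b\<^sup>2 / impulse e)" unfolding f_def mass_cmult e(2) by (simp add: a_def)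
  also have "\<dots> \<le> \<mu> * (1 / b)"
  proof (rule mult_left_mono)
    have "b\<^sup>2 * b \<le> impulse e" using e(4) by (simp add: power2_eq_square power3_eq_cube)
    then show "b\<^sup>2 / impulse e \<le> 1 / b" using i b by (simp add: divide_le_eq le_divide_eq)
  qed (use p in simp)
  also have "\<dots> \<le> \<nu>" using b1 b p by (simp add: divide_le_eq mult.commute)
  finally have fm: "mass f \<le> \<nu>" .
  have "0 < penalized l e"
  proof -
    have "b\<^sup>2 / l * (4 * pi) < b\<^sup>2 * b\<^sup>2"
    proof -
      have "b\<^sup>2 * (4 * pi / l) < b\<^sup>2 * b\<^sup>2" by (rule mult_strict_left_mono[OF b3]) (use b in simp)
      then show ?thesis by simp
    qed
    then have "b\<^sup>2 / l < b ^ 4 / (4 * pi)"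
      by (simp add: less_divide_eq power4_eq_xxxx power2_eq_square mult.assoc)
    also have "\<dots> \<le> interaction e e" using e(5) by simp
    finally show ?thesis unfolding penalized_def e(3) by simp
  qed
  then have "0 < penalized l f" unfolding f_def penalized_cmult using a by simp
  then show ?thesis using f fi fm by blast
qed

section \<open>Non-vanishing\<close>

text \<open>Truncation at a suitable \<open>k\<close> costs at most half of \<open>s\<close>, so the
  truncated energy is at least \<open>s / 2\<close>; by \<open>pairing_trunc_le\<close> this is
  impossible if every slab has mass at most \<open>c\<close>. Both constants depend only on
  \<open>s\<close> and \<open>K\<close>.\<close>

lemma nonvanishing:
  assumes s: "0 < s" and K: "0 \<le> K"
  shows "\<exists>k c. 1 \<le> k \<and> 0 < c \<and> (\<forall>f. bounded_vorticity K f \<longrightarrow> s \<le> interaction f f \<longrightarrow>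
    (\<exists>a. c < mass (cutoff (slab k a) f)))"
proof -
  define C where "C = K * (48 + 15 * K)"
  define k where "k = max 1 ((2 * C / s)\<^sup>2)"
  have k: "1 \<le> k" by (simp add: k_def)
  have "2 * C / s \<le> sqrt k"
    by (rule real_le_rsqrt) (simp add: k_def)
  moreover have "0 < sqrt k" using k by simp
  ultimately have Ck: "C / sqrt k \<le> s / 2"
    using s by (simp add: field_simps)
  \<comment> \<open>Chosen so that \<open>k\<^sup>2 * c * (K + 1)\<close> is \<open>s / 4\<close>;
    the summand 1 keeps the denominator positive when \<open>K\<close> is 0.\<close>
  define c where "c = s / (4 * k\<^sup>2 * (K + 1))"
  have k2: "0 < k\<^sup>2" using k by simp
  have c: "0 < c" unfolding c_def using s K k2 by (intro divide_pos_pos mult_pos_pos) auto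
  have "\<exists>a. c < mass (cutoff (slab k a) f)" if f: "bounded_vorticity K f" and sf: "s \<le> interaction f f" for f
  proof (rule ccontr)
    assume "\<nexists>a. c < mass (cutoff (slab k a) f)"
    then have le: "mass (cutoff (slab k a) f) \<le> c" for a by (meson not_le)
    note fv = bounded_vorticityD[OF f]
    have "s \<le> pairing (htrunc k) f f + s / 2"
      using interaction_trunc[OF f f k] Ck sf unfolding C_def by linarith
    also have "pairing (htrunc k) f f \<le> k\<^sup>2 * c * mass f"
      by (rule pairing_trunc_le[OF fv fv k le])
    also have "\<dots> \<le> k\<^sup>2 * c * (K + 1)"
      using f c k2 by (intro mult_left_mono) (auto simp: bounded_vorticity_def)
    also have "\<dots> = s / 4" using k2 K by (simp add: c_def divide_simps)
    finally show False using s by simp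
  qed
  then show ?thesis using k c by blast
qed

section \<open>Stability of the bounds, and slabs moved to the origin\<close>

lemma bounded_vorticity_translate:
  assumes "bounded_vorticity K f"
  shows "bounded_vorticity K (\<lambda>x. f (x + (a, 0)))"
  using assms vorticity_translate[of f 0 a] by (simp add: bounded_vorticity_def)

lemma bounded_vorticity_cutoff:
  assumes f: "bounded_vorticity K f" and A: "A \<in> sets borel"
  shows "bounded_vorticity K (cutoff A f)"
proof -
  note fv = bounded_vorticityD[OF f] and rv = vorticity_cutoff[OF bounded_vorticityD[OF f] A]
  have le: "cutoff A f x \<le> f x" for x by (intro cutoff_le vorticity_nonneg fv)
  have "snd x * cutoff A f x \<le> snd x * f x" for x
    using vorticity_height_nonneg[OF fv, of x] by (simp add: cutoff_def indicator_def)
  then have "impulse (cutoff A f) \<le> impulse f"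
    unfolding impulse_def by (intro integral_mono vorticity_impulse_integrable fv rv)
  moreover have "mass (cutoff A f) \<le> mass f"
    unfolding mass_def by (intro integral_mono vorticity_integrable fv rv le)
  moreover have "enstrophy (cutoff A f) \<le> enstrophy f"
    unfolding enstrophy_def
    by (intro integral_mono vorticity_square_integrable fv rv power_mono le vorticity_nonneg rv)
  ultimately show ?thesis using f rv by (simp add: bounded_vorticity_def)
qed

lemma mass_slab_translate:
  assumes f: "vorticity f"
  shows "mass (cutoff (slab k 0) (\<lambda>x. f (x + (a, 0)))) = mass (cutoff (slab k a) f)"
proof -
  note [measurable] = vorticity_measurable[OF vorticity_cutoff[OF f slab_borel[of k a]]]
  have "cutoff (slab k 0) (\<lambda>x. f (x + (a, 0))) = (\<lambda>x. cutoff (slab k a) f (x + (a, 0)))"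
    by (rule ext) (simp add: cutoff_def indicator_def slab_def)
  then show ?thesis
    unfolding mass_def
    using integral_lborel_translate[of "cutoff (slab k a) f" "(a, 0)"] by simp
qed

text \<open>Only the part of the slab above the boundary matters, and it is bounded.\<close>

lemma weak_limit_mass_pos:
  assumes f: "\<And>n. vorticity (f n)" and g: "vorticity g" and w: "weakly f g"
    and c: "\<And>n. c \<le> mass (cutoff (slab k 0) (f n))" and c0: "0 < c"
  shows "0 < mass g"
proof -
  let ?B = "cbox (- k, 0) (k, k) :: (real \<times> real) set"
  have B: "square_integrable (indicator ?B :: real \<times> real \<Rightarrow> real)"
    by (rule square_integrable_bounded_support[of _ ?B 1]) auto
  have eq: "cutoff (slab k 0) (f n) x = f n x * indicator ?B x" for n x
    using vorticity_zero[OF f, of x n]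
    by (cases x; cases "0 < snd x") (auto simp: cutoff_def indicator_def slab_def)
  have "c \<le> (\<integral>x. g x * indicator ?B x \<partial>lborel)"
    by (rule LIMSEQ_le_const[OF weaklyD[OF w B]]) (use c in \<open>auto simp: mass_def eq\<close>)
  also have "\<dots> \<le> mass g"
    unfolding mass_def
  proof (rule integral_mono[OF _ vorticity_integrable[OF g]])
    show "integrable lborel (\<lambda>x. g x * indicator ?B x)"
      by (intro square_integrable_mult vorticity_square g B)
    show "g x * indicator ?B x \<le> g x" for x using vorticity_nonneg[OF g, of x] by (simp add: indicator_def)
  qed
  finally show ?thesis using c0 by simp
qed

section \<open>Splitting off the tail\<close>

definition strip :: "real \<Rightarrow> (real \<times> real) set" where
  "strip R = {x. \<bar>fst x\<bar> \<le> R}"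

lemma strip_borel [measurable]: "strip R \<in> sets borel"
  unfolding strip_def by (intro borel_closed closed_Collect_le continuous_intros)

lemma strip_compl_borel [measurable]: "- strip R \<in> sets borel"
  by (rule borel_comp[OF strip_borel])

lemma strip_integral_tendsto:
  fixes h :: "real \<times> real \<Rightarrow> real"
  assumes h: "integrable lborel h"
  shows "(\<lambda>j. \<integral>x. indicator (strip (real (Suc j))) x * h x \<partial>lborel) \<longlonglongrightarrow> (\<integral>x. h x \<partial>lborel)"
    and "(\<lambda>j. \<integral>x. indicator (- strip (real (Suc j))) x * h x \<partial>lborel) \<longlonglongrightarrow> 0"
proof -
  note [measurable] = borel_measurable_integrable[OF h, simplified]
  have ev: "eventually (\<lambda>j. x \<in> strip (real (Suc j))) sequentially" for x
  proof -
    obtain N where N: "\<bar>fst x\<bar> \<le> real N" using real_arch_simple by blast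
    show ?thesis
      by (rule eventually_sequentiallyI[of N]) (use N in \<open>auto simp: strip_def\<close>)
  qed
  show "(\<lambda>j. \<integral>x. indicator (strip (real (Suc j))) x * h x \<partial>lborel) \<longlonglongrightarrow> (\<integral>x. h x \<partial>lborel)"
  proof (rule integral_dominated_convergence[where w = "\<lambda>x. norm (h x)"])
    have "(\<lambda>j. indicator (strip (real (Suc j))) x * h x) \<longlonglongrightarrow> h x" for x
      by (rule tendsto_eventually, rule eventually_mono[OF ev[of x]]) simp
    then show "AE x in lborel. (\<lambda>j. indicator (strip (real (Suc j))) x * h x) \<longlonglongrightarrow> h x" by simp
    show "AE x in lborel. norm (indicator (strip (real (Suc j))) x * h x) \<le> norm (h x)" for j
      by (intro AE_I2) (simp add: indicator_def)
  qed (use h in simp_all)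
  have "(\<lambda>j. \<integral>x. indicator (- strip (real (Suc j))) x * h x \<partial>lborel) \<longlonglongrightarrow> (\<integral>x. 0 \<partial>(lborel :: (real \<times> real) measure))"
  proof (rule integral_dominated_convergence[where w = "\<lambda>x. norm (h x)"])
    have "(\<lambda>j. indicator (- strip (real (Suc j))) x * h x) \<longlonglongrightarrow> 0" for x
      by (rule tendsto_eventually, rule eventually_mono[OF ev[of x]]) simp
    then show "AE x in lborel. (\<lambda>j. indicator (- strip (real (Suc j))) x * h x) \<longlonglongrightarrow> 0" by simp
    show "AE x in lborel. norm (indicator (- strip (real (Suc j))) x * h x) \<le> norm (h x)" for j
      by (intro AE_I2) (simp add: indicator_def)
  qed (use h in simp_all)
  then show "(\<lambda>j. \<integral>x. indicator (- strip (real (Suc j))) x * h x \<partial>lborel) \<longlonglongrightarrow> 0" by simp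
qed

text \<open>The half-width is \<open>Suc j\<close> and not \<open>j\<close>, so that it is positive
  and can be divided by for every index.\<close>

abbreviation inner_part :: "nat \<Rightarrow> (real \<times> real \<Rightarrow> real) \<Rightarrow> real \<times> real \<Rightarrow> real" where
  "inner_part j \<equiv> cutoff (strip (real (Suc j)))"

abbreviation outer_part :: "nat \<Rightarrow> (real \<times> real \<Rightarrow> real) \<Rightarrow> real \<times> real \<Rightarrow> real" where
  "outer_part j \<equiv> cutoff (- strip (real (Suc j)))"

lemma inner_part_tendsto:
  assumes w: "vorticity w"
  shows "(\<lambda>j. mass (inner_part j w)) \<longlonglongrightarrow> mass w"
    and "(\<lambda>j. impulse (inner_part j w)) \<longlonglongrightarrow> impulse w"
    and "(\<lambda>j. enstrophy (inner_part j w)) \<longlonglongrightarrow> enstrophy w"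
    and "(\<lambda>j. enstrophy (outer_part j w)) \<longlonglongrightarrow> 0"
    and "(\<lambda>j. interaction (outer_part j w) w) \<longlonglongrightarrow> 0"
proof -
  have sq: "(indicator A x * w x)\<^sup>2 = indicator A x * (w x)\<^sup>2" for A :: "(real \<times> real) set" and x
    by (simp add: indicator_def)
  have lc: "snd x * (indicator A x * w x) = indicator A x * (snd x * w x)" for A :: "(real \<times> real) set" and x
    by (simp add: indicator_def)
  show "(\<lambda>j. mass (inner_part j w)) \<longlonglongrightarrow> mass w"
    unfolding mass_def cutoff_def by (rule strip_integral_tendsto[OF vorticity_integrable[OF w]])
  show "(\<lambda>j. impulse (inner_part j w)) \<longlonglongrightarrow> impulse w"
    unfolding impulse_def cutoff_def lc by (rule strip_integral_tendsto[OF vorticity_impulse_integrable[OF w]])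
  show "(\<lambda>j. enstrophy (inner_part j w)) \<longlonglongrightarrow> enstrophy w"
    unfolding enstrophy_def cutoff_def sq by (rule strip_integral_tendsto[OF vorticity_square_integrable[OF w]])
  show "(\<lambda>j. enstrophy (outer_part j w)) \<longlonglongrightarrow> 0"
    unfolding enstrophy_def cutoff_def sq by (rule strip_integral_tendsto[OF vorticity_square_integrable[OF w]])
  have "interaction (outer_part j w) w = (\<integral>x. indicator (- strip (real (Suc j))) x * (w x * potential w x) \<partial>lborel)" for j
    unfolding interaction_potential(1)[OF vorticity_cutoff[OF w strip_compl_borel] w]
    by (simp add: cutoff_def mult.assoc)
  then show "(\<lambda>j. interaction (outer_part j w) w) \<longlonglongrightarrow> 0"
    using strip_integral_tendsto(2)[OF interaction_potential_integrable[OF w w]] by simp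
qed

lemma cutoff_split:
  assumes u: "vorticity u" and A: "A \<in> sets borel"
  shows "mass u = mass (cutoff A u) + mass (cutoff (- A) u)"
    and "impulse u = impulse (cutoff A u) + impulse (cutoff (- A) u)"
    and "enstrophy u = enstrophy (cutoff A u) + enstrophy (cutoff (- A) u)"
    and "interaction u u = interaction (cutoff A u) (cutoff A u)
      + interaction (cutoff (- A) u) (cutoff (- A) u) + 2 * interaction (cutoff A u) (cutoff (- A) u)"
proof -
  have eq: "u = (\<lambda>x. cutoff A u x + cutoff (- A) u x)"
    by (rule ext) (simp add: cutoff_def indicator_def)
  note a = vorticity_cutoff[OF u A] and b = vorticity_cutoff[OF u borel_comp[OF A]]
  show "mass u = mass (cutoff A u) + mass (cutoff (- A) u)"
    by (subst eq) (rule mass_add[OF a b])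
  show "impulse u = impulse (cutoff A u) + impulse (cutoff (- A) u)"
    by (subst eq) (rule impulse_add[OF a b])
  have "(\<integral>x. cutoff A u x * cutoff (- A) u x \<partial>lborel) = 0"
    by (rule integral_eq_zero_AE, rule AE_I2) (simp add: cutoff_def indicator_def)
  moreover have "enstrophy u = enstrophy (cutoff A u) + enstrophy (cutoff (- A) u)
      + 2 * (\<integral>x. cutoff A u x * cutoff (- A) u x \<partial>lborel)"
    by (subst eq) (rule enstrophy_add[OF a b])
  ultimately show "enstrophy u = enstrophy (cutoff A u) + enstrophy (cutoff (- A) u)"
    by linarith
  show "interaction u u = interaction (cutoff A u) (cutoff A u)
      + interaction (cutoff (- A) u) (cutoff (- A) u) + 2 * interaction (cutoff A u) (cutoff (- A) u)"
    by (subst eq, subst (3) eq) (rule interaction_add[OF a b])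
qed

lemma far_interaction_le:
  assumes f: "bounded_vorticity K f" and g: "bounded_vorticity K g" and R: "0 < R"
    and fs: "\<And>x. f x \<noteq> 0 \<Longrightarrow> \<bar>fst x\<bar> \<le> R" and gs: "\<And>x. g x \<noteq> 0 \<Longrightarrow> 2 * R < \<bar>fst x\<bar>"
  shows "interaction f g \<le> K\<^sup>2 / R\<^sup>2"
proof -
  note fv = bounded_vorticityD[OF f] and gv = bounded_vorticityD[OF g]
  have eq: "hgreen x y * f x * g y = hcut {z. R < dist (fst z) (snd z)} x y * f x * g y" for x y
  proof (cases "f x = 0 \<or> g y = 0")
    case False
    have "\<bar>fst x - fst y\<bar> \<le> dist x y" using dist_fst_le[of x y] by (simp add: dist_real_def)
    then have "R < dist x y" using fs[of x] gs[of y] False by linarith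
    then show ?thesis by (simp add: hcut_def)
  qed auto
  have "interaction f g = pairing (hcut {z. R < dist (fst z) (snd z)}) f g"
    unfolding interaction_def pairing_def by (rule Bochner_Integration.integral_cong[OF refl eq])
  also have "\<dots> \<le> impulse f * impulse g / R\<^sup>2" by (rule far_pairing_le[OF fv gv R])
  also have "\<dots> \<le> K * K / R\<^sup>2"
    using f g impulse_nonneg[OF fv] impulse_nonneg[OF gv]
    by (intro divide_right_mono mult_mono) (auto simp: bounded_vorticity_def)
  finally show ?thesis by (simp add: power2_eq_square)
qed

lemma interaction_mono:
  assumes "vorticity f" "vorticity f'" "vorticity g" "vorticity g'" "\<And>x. f x \<le> f' x" "\<And>x. g x \<le> g' x"
  shows "interaction f g \<le> interaction f' g'"
  unfolding interaction_def using assms by (intro pairing_mono subkernel_hgreen) auto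

text \<open>An asymptotic bound for the interaction between the strip of half-width R =
  \<open>Suc j\<close> and its complement: the first summand accounts for the neighbouring ring up
  to 2R, the second for everything beyond.\<close>

definition tail_error :: "real \<Rightarrow> (real \<times> real \<Rightarrow> real) \<Rightarrow> nat \<Rightarrow> real" where
  "tail_error K w j = interaction (outer_part j w) w + K\<^sup>2 / (real (Suc j))\<^sup>2"

lemma tail_error_tendsto:
  assumes w: "vorticity w"
  shows "tail_error K w \<longlonglongrightarrow> 0"
proof -
  have "(\<lambda>j. K\<^sup>2 * (inverse (real (Suc j)))\<^sup>2) \<longlonglongrightarrow> K\<^sup>2 * 0\<^sup>2"
    by (intro tendsto_intros LIMSEQ_inverse_real_of_nat)
  then have "(\<lambda>j. K\<^sup>2 / (real (Suc j))\<^sup>2) \<longlonglongrightarrow> 0"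
    by (simp add: divide_inverse power_inverse)
  from tendsto_add[OF inner_part_tendsto(5)[OF w] this] show ?thesis
    by (simp add: tail_error_def[abs_def])
qed

text \<open>The plane is cut into the strip of half-width \<open>R\<close>, the ring
  \<open>M\<close> up to \<open>2 * R\<close>, and the rest. Inside the strip, and between strip and
  ring, both factors have bounded horizontal support and the interaction is weakly continuous;
  between strip and rest the distance exceeds \<open>R\<close>. The self-interaction of the outer
  part is the only term that the weak limit does not control.\<close>

lemma eventually_energy_split:
  assumes u: "\<And>n. bounded_vorticity K (u n)" and w: "bounded_vorticity K w" and uw: "weakly u w" and e: "0 < e"
  shows "eventually (\<lambda>n. interaction (u n) (u n) \<le> interaction w w + 2 * tail_error K w j + e
    + interaction (outer_part j (u n)) (outer_part j (u n))) sequentially"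
proof -
  define R where "R = real (Suc j)"
  have R: "0 < R" by (simp add: R_def)
  define q where "q = K\<^sup>2 / R\<^sup>2"
  have te: "tail_error K w j = interaction (cutoff (- strip R) w) w + q"
    by (simp add: tail_error_def R_def q_def)
  define M where "M = strip (2 * R) - strip R"
  have M: "M \<in> sets borel" unfolding M_def by measurable
  note uv = bounded_vorticityD[OF u] and wv = bounded_vorticityD[OF w]
  have sub: "cutoff A w x \<le> w x" for A x by (intro cutoff_le vorticity_nonneg wv)
  note sR = strip_borel[of R] and sR' = strip_compl_borel[of R] and s2 = strip_compl_borel[of "2 * R"]
  have aa: "(\<lambda>n. interaction (cutoff (strip R) (u n)) (cutoff (strip R) (u n)))
      \<longlonglongrightarrow> interaction (cutoff (strip R) w) (cutoff (strip R) w)"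
  proof (rule interaction_weak_continuous[where K = K and R = R])
    show "R < \<bar>fst x\<bar> \<Longrightarrow> cutoff (strip R) (u n) x = 0 \<and> cutoff (strip R) (u n) x = 0" for n x
      by (simp add: cutoff_def strip_def)
    show "R < \<bar>fst x\<bar> \<Longrightarrow> cutoff (strip R) w x = 0 \<and> cutoff (strip R) w x = 0" for x
      by (simp add: cutoff_def strip_def)
  qed (intro bounded_vorticity_cutoff u w weakly_cutoff uw sR)+
  have aM: "(\<lambda>n. interaction (cutoff (strip R) (u n)) (cutoff M (u n)))
      \<longlonglongrightarrow> interaction (cutoff (strip R) w) (cutoff M w)"
  proof (rule interaction_weak_continuous[where K = K and R = "2 * R"])
    show "2 * R < \<bar>fst x\<bar> \<Longrightarrow> cutoff (strip R) (u n) x = 0 \<and> cutoff M (u n) x = 0" for n x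
      using R by (simp add: cutoff_def strip_def M_def)
    show "2 * R < \<bar>fst x\<bar> \<Longrightarrow> cutoff (strip R) w x = 0 \<and> cutoff M w x = 0" for x
      using R by (simp add: cutoff_def strip_def M_def)
  qed (intro bounded_vorticity_cutoff u w weakly_cutoff uw sR M)+
  have "interaction (cutoff (strip R) w) (cutoff (strip R) w) \<le> interaction w w"
    by (intro interaction_mono vorticity_cutoff wv sR sub)
  then have ev1: "eventually (\<lambda>n. interaction (cutoff (strip R) (u n)) (cutoff (strip R) (u n)) < interaction w w + e / 2) sequentially"
    using e by (intro order_tendstoD(2)[OF aa]) simp
  have "interaction (cutoff (strip R) w) (cutoff M w) \<le> interaction w (outer_part j w)"
  proof (intro interaction_mono vorticity_cutoff wv sR M strip_compl_borel sub)
    show "cutoff M w x \<le> outer_part j w x" for x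
      using vorticity_nonneg[OF wv, of x] by (auto simp: cutoff_def M_def R_def indicator_def)
  qed
  also have "\<dots> = interaction (outer_part j w) w"
    by (intro interaction_sym vorticity_cutoff wv strip_compl_borel)
  finally have ev2: "eventually (\<lambda>n. interaction (cutoff (strip R) (u n)) (cutoff M (u n)) < interaction (outer_part j w) w + e / 4) sequentially"
    using e by (intro order_tendstoD(2)[OF aM]) simp
  from ev1 ev2 show ?thesis
  proof eventually_elim
    case (elim n)
    have "cutoff (- strip R) (u n) = (\<lambda>x. cutoff M (u n) x + cutoff (- strip (2 * R)) (u n) x)"
      using R by (intro ext) (auto simp: cutoff_def M_def strip_def indicator_def)
    then have "interaction (cutoff (strip R) (u n)) (cutoff (- strip R) (u n))
      = interaction (cutoff (strip R) (u n)) (cutoff M (u n))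
        + interaction (cutoff (strip R) (u n)) (cutoff (- strip (2 * R)) (u n))"
      unfolding interaction_def
      using pairing_add_right[OF subkernel_hgreen vorticity_cutoff[OF uv sR] vorticity_cutoff[OF uv M]
          vorticity_cutoff[OF uv s2], of n n n] by simp
    moreover have "interaction (cutoff (strip R) (u n)) (cutoff (- strip (2 * R)) (u n)) \<le> q"
      unfolding q_def
      by (rule far_interaction_le[OF bounded_vorticity_cutoff[OF u sR] bounded_vorticity_cutoff[OF u s2] R])
        (auto simp: cutoff_def strip_def indicator_def split: if_splits)
    ultimately have cross: "interaction (cutoff (strip R) (u n)) (cutoff (- strip R) (u n))
        \<le> interaction (cutoff (strip R) (u n)) (cutoff M (u n)) + q" by linarith
    have "interaction (cutoff (strip R) (u n)) (cutoff M (u n)) < interaction (cutoff (- strip R) w) w + e / 4"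
      using elim(2) by (simp only: R_def)
    then have "interaction (u n) (u n) \<le> interaction w w + 2 * (interaction (cutoff (- strip R) w) w + q) + e
        + interaction (cutoff (- strip R) (u n)) (cutoff (- strip R) (u n))"
      using elim(1) cross unfolding cutoff_split(4)[OF uv[of n] sR] by argo
    then show ?case unfolding te by (simp only: R_def)
  qed
qed

lemma weak_mass_impulse_lower:
  assumes u: "\<And>n. vorticity (u n)" and w: "vorticity w" and uw: "weakly u w" and d: "0 < d"
  shows "eventually (\<lambda>n. mass w - d < mass (u n)) sequentially"
    and "eventually (\<lambda>n. impulse w - d < impulse (u n)) sequentially"
proof -
  have "eventually (\<lambda>n. (\<integral>x. w x * 1 \<partial>lborel) - d < (\<integral>x. u n x * 1 \<partial>lborel)) sequentially"
    by (rule weak_weight_lower[OF uw]) (auto intro: vorticity_integrable u w vorticity_nonneg[OF u] vorticity_nonneg[OF w] d)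
  then show "eventually (\<lambda>n. mass w - d < mass (u n)) sequentially" by (simp add: mass_def)
  have eq: "f x * max 0 (snd x) = snd x * f x" if "vorticity f" for f x
    using vorticity_zero[OF that, of x] by (cases "0 < snd x") auto
  have "eventually (\<lambda>n. (\<integral>x. w x * max 0 (snd x) \<partial>lborel) - d < (\<integral>x. u n x * max 0 (snd x) \<partial>lborel)) sequentially"
    by (rule weak_weight_lower[OF uw])
      (auto simp: eq u w intro: vorticity_impulse_integrable vorticity_nonneg[OF u] vorticity_nonneg[OF w] d)
  then show "eventually (\<lambda>n. impulse w - d < impulse (u n)) sequentially"
    by (simp add: impulse_def eq u w)
qed

lemma outer_interaction_antimono:
  assumes "vorticity u" "i \<le> j"
  shows "interaction (outer_part j u) (outer_part j u) \<le> interaction (outer_part i u) (outer_part i u)"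
proof -
  have "outer_part j u x \<le> outer_part i u x" for x
    using assms vorticity_nonneg[OF assms(1), of x] by (auto simp: cutoff_def strip_def indicator_def)
  then show ?thesis by (intro interaction_mono vorticity_cutoff assms strip_compl_borel)
qed

section \<open>Compactness of maximizing sequences\<close>

context variational
begin

text \<open>Mass and impulse are bounded by assumption; the enstrophy is bounded because the values
  of the functional are bounded below and \<open>penalized_le\<close> keeps half of the
  penalty.\<close>

lemma bounded_sequence:
  assumes W: "\<And>n. vorticity (W n)" and m: "\<And>n. mass (W n) \<le> \<nu>"
    and i: "(\<lambda>n. impulse (W n)) \<longlonglongrightarrow> \<mu>" and p: "(\<lambda>n. penalized l (W n)) \<longlonglongrightarrow> S"
  shows "\<exists>K. 0 \<le> K \<and> (\<forall>n::nat. bounded_vorticity K (W n))"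
proof -
  from convergent_imp_Bseq[OF convergentI[OF i]] obtain I where I: "0 < I" "\<forall>n. norm (impulse (W n)) \<le> I" by (rule BseqE)
  from convergent_imp_Bseq[OF convergentI[OF p]] obtain P where P: "0 < P" "\<forall>n. norm (penalized l (W n)) \<le> P" by (rule BseqE)
  define M where "M = \<nu> + I"
  define C where "C = (8 * l * M + M) * M / 2 + P"
  have M: "0 < M" using pos I by (simp add: M_def)
  have C: "0 \<le> C" using M P pos by (simp add: C_def)
  have Q: "enstrophy (W n) \<le> C * (4 * l)" for n
  proof -
    have "mass (W n) + impulse (W n) \<le> M" using m[of n] I(2)[rule_format, of n] by (simp add: M_def)
    from penalized_le[OF W pos(3) this M] have "enstrophy (W n) / (4 * l) \<le> C"
      using P(2)[rule_format, of n] unfolding C_def real_norm_def by linarith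
    then show ?thesis using pos(3) by (simp add: divide_le_eq)
  qed
  define K where "K = \<nu> + I + C * (4 * l)"
  have C4: "0 \<le> C * (4 * l)" using C pos by simp
  have "bounded_vorticity K (W n)" for n
    unfolding bounded_vorticity_def K_def
    using W m[of n] I(1) I(2)[rule_format, of n] Q[of n] C4 pos by auto
  moreover have "0 \<le> K" using pos I C4 by (simp add: K_def)
  ultimately show ?thesis by blast
qed

lemma weak_limit_constraints:
  assumes u: "\<And>n. vorticity (u n)" and w: "vorticity w" and uw: "weakly u w"
    and m: "\<And>n. mass (u n) \<le> \<nu>" and i: "(\<lambda>n. impulse (u n)) \<longlonglongrightarrow> \<mu>"
  shows "mass w \<le> \<nu>" "impulse w \<le> \<mu>"
proof -
  show "mass w \<le> \<nu>"
  proof (rule field_le_epsilon)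
    fix e :: real assume e: "0 < e"
    obtain n where "mass w - e < mass (u n)"
      using weak_mass_impulse_lower(1)[OF u w uw e] by (auto simp: eventually_sequentially)
    then show "mass w \<le> \<nu> + e" using m[of n] by simp
  qed
  show "impulse w \<le> \<mu>"
  proof (rule field_le_epsilon)
    fix e :: real assume e: "0 < e"
    have "eventually (\<lambda>n. impulse w - e \<le> impulse (u n)) sequentially"
      using weak_mass_impulse_lower(2)[OF u w uw e] by eventually_elim simp
    then have "impulse w - e \<le> \<mu>"
      by (intro tendsto_lowerbound[OF i]) auto
    then show "impulse w \<le> \<mu> + e" by simp
  qed
qed

text \<open>Without energy in the tail the interaction is upper semicontinuous along the sequence,
  and the enstrophy is always lower semicontinuous. Hence the value at \<open>w\<close> is at least
  \<open>S\<close>, and at most \<open>S\<close> by the relaxed problem. Equality leaves no room for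
  a drop of enstrophy, so the enstrophies converge, and by strictness in the relaxed problem no
  impulse is missing.\<close>

lemma compact_if_tail_vanishes:
  assumes u: "\<And>n. bounded_vorticity K (u n)" and w: "bounded_vorticity K w" and uw: "weakly u w"
    and m: "\<And>n. mass (u n) \<le> \<nu>" and i: "(\<lambda>n. impulse (u n)) \<longlonglongrightarrow> \<mu>"
    and p: "(\<lambda>n. penalized l (u n)) \<longlonglongrightarrow> S"
    and tail: "\<And>e. 0 < e \<Longrightarrow> \<exists>j. eventually (\<lambda>n. interaction (outer_part j (u n)) (outer_part j (u n)) \<le> e) sequentially"
  shows "penalized l w = S" "impulse w = \<mu>" "(\<lambda>n. enstrophy (u n)) \<longlonglongrightarrow> enstrophy w"
proof -
  note uv = bounded_vorticityD[OF u] and wv = bounded_vorticityD[OF w]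
  note cons = weak_limit_constraints[OF uv wv uw m i]
  \<comment> \<open>The four shares of \<open>e\<close> are two from \<open>tail_error\<close>, one
    from the splitting and one from the tail. Enlarging \<open>j\<close> only shrinks the outer
    part, so both requirements on \<open>j\<close> can be met at once.\<close>
  have ub: "eventually (\<lambda>n. interaction (u n) (u n) \<le> interaction w w + 4 * e) sequentially" if e: "0 < e" for e
  proof -
    obtain j0 where j0: "eventually (\<lambda>n. interaction (outer_part j0 (u n)) (outer_part j0 (u n)) \<le> e) sequentially"
      using tail[OF e] by blast
    have "eventually (\<lambda>j. tail_error K w j < e) sequentially"
      by (rule order_tendstoD(2)[OF tail_error_tendsto[OF wv] e])
    then obtain j1 where j1: "\<And>j. j1 \<le> j \<Longrightarrow> tail_error K w j < e" by (auto simp: eventually_sequentially)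
    define j where "j = max j0 j1"
    from eventually_energy_split[OF u w uw e, of j] j0 show ?thesis
    proof eventually_elim
      case (elim n)
      have "interaction (outer_part j (u n)) (outer_part j (u n)) \<le> interaction (outer_part j0 (u n)) (outer_part j0 (u n))"
        by (rule outer_interaction_antimono[OF uv]) (simp add: j_def)
      moreover have "tail_error K w j < e" by (rule j1) (simp add: j_def)
      ultimately show ?case using elim by linarith
    qed
  qed
  \<comment> \<open>Since the values tend to \<open>S\<close>, an upper bound for the interaction is
    at the same time an upper bound for the enstrophy.\<close>
  have Q: "eventually (\<lambda>n. enstrophy (u n) / (2 * l) \<le> interaction w w / 2 - S + e) sequentially" if e: "0 < e" for e
  proof -
    have "eventually (\<lambda>n. S - e / 2 < penalized l (u n)) sequentially"
      using e by (intro order_tendstoD(1)[OF p]) simp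
    moreover have "0 < e / 4" using e by simp
    note ub[OF this]
    ultimately show ?thesis
    proof eventually_elim
      case (elim n)
      then show ?case unfolding penalized_def by linarith
    qed
  qed
  have lower: "eventually (\<lambda>n. enstrophy w - e < enstrophy (u n)) sequentially" if "0 < e" for e
    by (rule weak_enstrophy_lower[OF uw vorticity_square[OF uv] vorticity_square[OF wv] that])
  have "S \<le> penalized l w"
  proof (rule field_le_epsilon)
    fix e :: real assume e: "0 < e"
    have e': "0 < e * l" "0 < e / 2" using e pos by simp_all
    have "eventually (\<lambda>n. S \<le> penalized l w + e) sequentially"
      using Q[OF e'(2)] lower[OF e'(1)]
    proof eventually_elim
      case (elim n)
      have "(enstrophy w - e * l) / (2 * l) \<le> enstrophy (u n) / (2 * l)"
        using elim pos by (intro divide_right_mono) auto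
      moreover have "(enstrophy w - e * l) / (2 * l) = enstrophy w / (2 * l) - e / 2"
        using pos by (simp add: diff_divide_distrib)
      ultimately show ?case using elim unfolding penalized_def by linarith
    qed
    then show "S \<le> penalized l w + e" by simp
  qed
  then show pS: "penalized l w = S" using relaxed_le[OF wv cons(2,1)] by simp
  show "impulse w = \<mu>"
    using relaxed_less[OF wv cons(2,1)] pS cons(2) by fastforce
  show "(\<lambda>n. enstrophy (u n)) \<longlonglongrightarrow> enstrophy w"
  proof (rule LIMSEQ_I)
    fix e :: real assume e: "0 < e"
    then have e': "0 < e / (4 * l)" using pos by simp
    have "eventually (\<lambda>n. norm (enstrophy (u n) - enstrophy w) < e) sequentially"
      using Q[OF e'] lower[OF e]
    proof eventually_elim
      case (elim n)
      have "interaction w w / 2 - S = enstrophy w / (2 * l)" using pS unfolding penalized_def by linarith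
      then have "enstrophy (u n) / (2 * l) * (2 * l) \<le> (enstrophy w / (2 * l) + e / (4 * l)) * (2 * l)"
        using elim pos by (intro mult_right_mono) auto
      also have "\<dots> = enstrophy w + e / 2" using pos by (simp add: field_simps)
      finally have "enstrophy (u n) \<le> enstrophy w + e / 2" using pos by simp
      then show ?case using elim e by (simp add: abs_less_iff)
    qed
    then show "\<exists>no. \<forall>n\<ge>no. norm (enstrophy (u n) - enstrophy w) < e" by (simp add: eventually_sequentially)
  qed
qed

text \<open>If the tail kept a fixed amount of energy, the weak limit \<open>w\<close> would be a maximizer under its
  own constraints, hence \<open>G w > w / l\<close>. The tail, after a translation, has a nonzero weak limit
  \<open>v\<close>, and placing it on top of \<open>w\<close> increases the energy by \<open>\<integral> (G w - w / l) v > 0\<close>.\<close>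

lemma tail_vanishes:
  assumes u: "\<And>n. bounded_vorticity K (u n)" and w: "bounded_vorticity K w" and uw: "weakly u w"
    and m: "\<And>n. mass (u n) \<le> \<nu>" and i: "(\<lambda>n. impulse (u n)) \<longlonglongrightarrow> \<mu>"
    and p: "(\<lambda>n. penalized l (u n)) \<longlonglongrightarrow> S" and mw: "0 < mass w" and e: "0 < e"
  shows "\<exists>j. eventually (\<lambda>n. interaction (outer_part j (u n)) (outer_part j (u n)) \<le> e) sequentially"
proof (rule ccontr)
  assume "\<nexists>j. eventually (\<lambda>n. interaction (outer_part j (u n)) (outer_part j (u n)) \<le> e) sequentially"
  then have neg: "\<not> eventually (\<lambda>n. interaction (outer_part j (u n)) (outer_part j (u n)) \<le> e) sequentially" for j
    by blast
  note uv = bounded_vorticityD[OF u] and wv = bounded_vorticityD[OF w]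
  have K: "0 \<le> K" using w enstrophy_nonneg[of w] by (simp add: bounded_vorticity_def)
  define d where "d = (\<lambda>j. inverse (real (Suc j)))"
  have d: "0 < d j" for j by (simp add: d_def)
  have d0: "d \<longlonglongrightarrow> 0" unfolding d_def by (rule LIMSEQ_inverse_real_of_nat)
  \<comment> \<open>Everything wanted of an index at scale \<open>j\<close>; it holds for all large
    \<open>n\<close>. As the negated claim provides arbitrarily large \<open>n\<close> with tail
    energy above \<open>e\<close>, one index \<open>N j\<close> serves both purposes, and
    \<open>B j\<close> is its tail.\<close>
  define good where "good = (\<lambda>j n.
      interaction (u n) (u n) \<le> interaction w w + 2 * tail_error K w j + d j
        + interaction (outer_part j (u n)) (outer_part j (u n))
      \<and> mass (inner_part j w) - d j < mass (inner_part j (u n))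
      \<and> impulse (inner_part j w) - d j < impulse (inner_part j (u n))
      \<and> enstrophy (inner_part j w) - d j < enstrophy (inner_part j (u n))
      \<and> S - d j < penalized l (u n) \<and> impulse (u n) < \<mu> + d j)"
  have ev_good: "eventually (good j) sequentially" for j
  proof -
    note iu = vorticity_cutoff[OF uv strip_borel] and iw = vorticity_cutoff[OF wv strip_borel]
      and wk = weakly_cutoff[OF uw strip_borel]
    have "S - d j < S" "\<mu> < \<mu> + d j" using d[of j] by auto
    note ev = eventually_energy_split[OF u w uw d, of j j] weak_mass_impulse_lower[OF iu iw wk d]
      weak_enstrophy_lower[OF wk vorticity_square[OF iu] vorticity_square[OF iw] d]
      order_tendstoD(1)[OF p this(1)] order_tendstoD(2)[OF i this(2)]
    show ?thesis
      unfolding good_def by (intro eventually_conj ev)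
  qed
  have "\<forall>j. \<exists>n. good j n \<and> \<not> interaction (outer_part j (u n)) (outer_part j (u n)) \<le> e"
  proof (rule allI, rule ccontr)
    fix j
    assume "\<nexists>n. good j n \<and> \<not> interaction (outer_part j (u n)) (outer_part j (u n)) \<le> e"
    then have "interaction (outer_part j (u n)) (outer_part j (u n)) \<le> e" if "good j n" for n
      using that by blast
    then have "eventually (\<lambda>n. interaction (outer_part j (u n)) (outer_part j (u n)) \<le> e) sequentially"
      by (rule eventually_mono[OF ev_good[of j]])
    then show False using neg[of j] by blast
  qed
  from choice[OF this] obtain N where "\<forall>j. good j (N j) \<and>
      \<not> interaction (outer_part j (u (N j))) (outer_part j (u (N j))) \<le> e" ..
  then have good: "\<And>j. good j (N j)"
    and big: "\<And>j. \<not> interaction (outer_part j (u (N j))) (outer_part j (u (N j))) \<le> e"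
    by blast+
  define B where "B = (\<lambda>j. outer_part j (u (N j)))"
  have BK: "bounded_vorticity K (B j)" for j
    unfolding B_def by (intro bounded_vorticity_cutoff u strip_compl_borel)
  note Bv = bounded_vorticityD[OF BK]
  have Be: "e \<le> interaction (B j) (B j)" for j using big[of j] by (simp add: B_def)
  \<comment> \<open>Three errors, all tending to 0 or, for \<theta>, to 1: \<kappa> is the energy
    lost in separating \<open>w\<close> from the tail, \<theta> the factor by which \<open>w\<close>
    and the tail together may exceed the constraints, and \<rho> the sum of \<kappa> and of the
    price of that factor.\<close>
  define \<kappa> where "\<kappa> = (\<lambda>j. d j + d j / 2 + d j / (2 * l) + tail_error K w j
      + (enstrophy w - enstrophy (inner_part j w)) / (2 * l))"
  define \<theta> where "\<theta> = (\<lambda>j. 1 + (mass w - mass (inner_part j w) + d j) / \<nu>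
      + (impulse w - impulse (inner_part j w) + 2 * d j) / \<mu>)"
  define \<rho> where "\<rho> = (\<lambda>j. ((\<theta> j)\<^sup>2 - 1) * S + \<kappa> j)"
  have \<rho>0: "\<rho> \<longlonglongrightarrow> 0"
  proof -
    have "\<kappa> \<longlonglongrightarrow> 0 + 0 / 2 + 0 / (2 * l) + 0 + (enstrophy w - enstrophy w) / (2 * l)"
      unfolding \<kappa>_def using pos
      by (intro tendsto_intros d0 tail_error_tendsto wv inner_part_tendsto) auto
    moreover have "\<theta> \<longlonglongrightarrow> 1 + (mass w - mass w + 0) / \<nu> + (impulse w - impulse w + 2 * 0) / \<mu>"
      unfolding \<theta>_def using pos
      by (intro tendsto_intros d0 wv inner_part_tendsto) auto
    ultimately have "\<rho> \<longlonglongrightarrow> (1\<^sup>2 - 1) * S + 0"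
      unfolding \<rho>_def by (intro tendsto_intros) auto
    then show ?thesis by simp
  qed
  \<comment> \<open>Up to \<kappa>, the tail supplies all of the value that \<open>w\<close>
    lacks.\<close>
  have pB: "S - penalized l w - \<kappa> j \<le> penalized l (B j)" for j
  proof -
    have g: "interaction (u (N j)) (u (N j)) \<le> interaction w w + 2 * tail_error K w j + d j + interaction (B j) (B j)"
      "enstrophy (inner_part j w) - d j < enstrophy (inner_part j (u (N j)))"
      "S - d j < penalized l (u (N j))"
      using good[of j] unfolding good_def B_def by auto
    have Qu: "enstrophy (u (N j)) = enstrophy (inner_part j (u (N j))) + enstrophy (B j)"
      unfolding B_def by (rule cutoff_split(3)[OF uv strip_borel])
    have "(enstrophy (inner_part j w) - d j + enstrophy (B j)) / (2 * l) \<le> enstrophy (u (N j)) / (2 * l)"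
      unfolding Qu using g(2) pos by (intro divide_right_mono) auto
    then have "enstrophy (inner_part j w) / (2 * l) - d j / (2 * l) + enstrophy (B j) / (2 * l) \<le> enstrophy (u (N j)) / (2 * l)"
      by (simp only: add_divide_distrib diff_divide_distrib)
    then show ?thesis
      using g unfolding \<kappa>_def penalized_def diff_divide_distrib by linarith
  qed
  have nn: "mass (inner_part j w) \<le> mass w" "impulse (inner_part j w) \<le> impulse w" for j
    using cutoff_split(1,2)[OF wv strip_borel, of "real (Suc j)"]
      mass_nonneg[OF vorticity_cutoff[OF wv strip_compl_borel], of "real (Suc j)"]
      impulse_nonneg[OF vorticity_cutoff[OF wv strip_compl_borel], of "real (Suc j)"] by simp_all
  have t1: "0 \<le> (mass w - mass (inner_part j w) + d j) / \<nu>"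
    and t2: "0 \<le> (impulse w - impulse (inner_part j w) + 2 * d j) / \<mu>" for j
    using nn[of j] d[of j] pos by (auto intro!: divide_nonneg_nonneg)
  have \<theta>1: "1 \<le> \<theta> j" for j using t1[of j] t2[of j] by (simp add: \<theta>_def)
  have norm_eq: "t + x = (1 + x / t) * t" if "0 < t" for x t :: real
    using that by (simp add: distrib_right)
  have mB: "mass w + mass (B j) \<le> \<theta> j * \<nu>" for j
  proof -
    have "mass w + mass (B j) \<le> \<nu> + (mass w - mass (inner_part j w) + d j)"
      using good[of j] m[of "N j"] cutoff_split(1)[OF uv[of "N j"] strip_borel, of "real (Suc j)"]
      unfolding good_def B_def by linarith
    also have "\<dots> = (1 + (mass w - mass (inner_part j w) + d j) / \<nu>) * \<nu>"
      by (rule norm_eq[OF pos(2)])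
    also have "\<dots> \<le> \<theta> j * \<nu>"
      using t2[of j] pos by (intro mult_right_mono) (auto simp: \<theta>_def)
    finally show ?thesis .
  qed
  have iB: "impulse w + impulse (B j) \<le> \<theta> j * \<mu>" for j
  proof -
    have "impulse w + impulse (B j) \<le> \<mu> + (impulse w - impulse (inner_part j w) + 2 * d j)"
      using good[of j] cutoff_split(2)[OF uv[of "N j"] strip_borel, of "real (Suc j)"]
      unfolding good_def B_def by linarith
    also have "\<dots> = (1 + (impulse w - impulse (inner_part j w) + 2 * d j) / \<mu>) * \<mu>"
      by (rule norm_eq[OF pos(1)])
    also have "\<dots> \<le> \<theta> j * \<mu>"
      using t1[of j] pos by (intro mult_right_mono) (auto simp: \<theta>_def)
    finally show ?thesis .
  qed
  \<comment> \<open>The central comparison: any rival \<open>f\<close> of \<open>w\<close>,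
    superposed with any copy \<open>g\<close> of the tail, satisfies the constraints up to \<theta>.
    It is applied first with the tail left in its place, to show that \<open>w\<close> is a
    maximizer, and then with \<open>w\<close> itself and the tail moved back.\<close>
  have test: "penalized l f + (interaction f g - (\<integral>x. f x * g x \<partial>lborel) / l) \<le> penalized l w + \<rho> j"
    if f: "vorticity f" "mass f \<le> mass w" "impulse f \<le> impulse w"
      and g: "vorticity g" "mass g = mass (B j)" "impulse g = impulse (B j)" "penalized l g = penalized l (B j)" for f g j
  proof -
    have "penalized l (\<lambda>x. f x + g x) \<le> (\<theta> j)\<^sup>2 * S"
    proof (rule relaxed_scaled[OF vorticity_add[OF f(1) g(1)] \<theta>1])
      show "impulse (\<lambda>x. f x + g x) \<le> \<theta> j * \<mu>" using iB[of j] f g by (simp add: impulse_add)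
      show "mass (\<lambda>x. f x + g x) \<le> \<theta> j * \<nu>" using mB[of j] f g by (simp add: mass_add)
    qed
    then show ?thesis
      unfolding penalized_add[OF f(1) g(1)] g(4) \<rho>_def using pB[of j] by (simp add: algebra_simps)
  qed
  have max: "penalized l f \<le> penalized l w"
    if f: "vorticity f" "impulse f \<le> impulse w" "mass f \<le> mass w" for f
  proof -
    define c where "c = (\<lambda>j. sqrt (enstrophy (outer_part j f)) * sqrt K / l)"
    have "c \<longlonglongrightarrow> sqrt 0 * sqrt K / l"
      unfolding c_def using pos by (intro tendsto_intros inner_part_tendsto f) auto
    then have c0: "c \<longlonglongrightarrow> 0" by simp
    have "penalized l f \<le> penalized l w + \<rho> j + c j" for j
    proof -
      have fo: "vorticity (outer_part j f)" by (intro vorticity_cutoff f strip_compl_borel)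
      have "f x * B j x = outer_part j f x * B j x" for x
        by (auto simp: B_def cutoff_def indicator_def)
      then have "(\<integral>x. f x * B j x \<partial>lborel) = (\<integral>x. outer_part j f x * B j x \<partial>lborel)"
        by (rule Bochner_Integration.integral_cong[OF refl])
      also have "\<dots> \<le> sqrt (enstrophy (outer_part j f)) * sqrt (enstrophy (B j))"
        using integral_Cauchy_Schwarz[OF vorticity_square[OF fo] vorticity_square[OF Bv[of j]]]
        unfolding enstrophy_def by (rule order_trans[OF abs_ge_self])
      also have "\<dots> \<le> sqrt (enstrophy (outer_part j f)) * sqrt K"
        using BK[of j] by (intro mult_left_mono) (auto simp: bounded_vorticity_def enstrophy_nonneg)
      finally have "(\<integral>x. f x * B j x \<partial>lborel) / l \<le> c j"
        unfolding c_def using pos by (intro divide_right_mono) auto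
      moreover have "0 \<le> interaction f (B j)"
        unfolding interaction_def by (rule pairing_nonneg[OF kernel_hgreen f(1) Bv])
      ultimately show ?thesis using test[OF f(1,3,2) Bv[of j] refl refl refl] by linarith
    qed
    moreover have "(\<lambda>j. penalized l w + \<rho> j + c j) \<longlonglongrightarrow> penalized l w + 0 + 0"
      by (intro tendsto_intros \<rho>0 c0)
    ultimately show ?thesis by (intro LIMSEQ_le_const[where X = "\<lambda>j. penalized l w + \<rho> j + c j"]) auto
  qed
  have EL: "AE x in lborel. 0 < snd x \<longrightarrow> w x / l < potential w x"
    by (rule maximizer_potential_gt[OF wv mw pos(3) max])
  obtain k c where k: "1 \<le> k" and c: "0 < c"
    and nv: "\<And>f. bounded_vorticity K f \<Longrightarrow> e \<le> interaction f f \<Longrightarrow> \<exists>a. c < mass (cutoff (slab k a) f)"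
    using nonvanishing[OF e K] by blast
  have "\<forall>j. \<exists>a. c < mass (cutoff (slab k a) (B j))"
    by (intro allI nv BK Be)
  from choice[OF this] obtain z where "\<forall>j. c < mass (cutoff (slab k (z j)) (B j))" ..
  then have z: "\<And>j. c < mass (cutoff (slab k (z j)) (B j))" by blast
  \<comment> \<open>The tails keep their energy, so they have mass in some slab; moving that slab to
    the origin prevents the weak limit \<open>v\<close> from being zero.\<close>
  define V where "V = (\<lambda>j x. B j (x + (z j, 0)))"
  have VK: "bounded_vorticity K (V j)" for j
    unfolding V_def by (rule bounded_vorticity_translate[OF BK])
  note Vv = bounded_vorticityD[OF VK]
  have Vtr: "mass (V j) = mass (B j)" "impulse (V j) = impulse (B j)" "penalized l (V j) = penalized l (B j)" for j
    unfolding V_def penalized_def interaction_translate_horizontal[OF Bv Bv]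
    using vorticity_translate[OF Bv, of 0 j "z j"] by simp_all
  obtain s v where s: "strict_mono (s :: nat \<Rightarrow> nat)" and v: "bounded_vorticity K v" and Vw: "weakly (\<lambda>j. V (s j)) v"
    using bounded_vorticity_weakly_compact[of K V, OF VK] by (elim exE conjE)
  note vv = bounded_vorticityD[OF v]
  have mv: "0 < mass v"
  proof (rule weak_limit_mass_pos[OF Vv vv Vw _ c])
    show "c \<le> mass (cutoff (slab k 0) (V (s j)))" for j
      unfolding V_def mass_slab_translate[OF Bv] using z[of "s j"] by simp
  qed
  \<comment> \<open>By the Euler-Lagrange inequality the maximum changes nothing almost everywhere
    in the half plane; it only provides a weight that is nonnegative everywhere, as lower
    semicontinuity requires.\<close>
  define W where "W = (\<lambda>x. max 0 (potential w x - w x / l))"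
  note [measurable] = vorticity_measurable[OF wv] potential_measurable[OF wv]
  have [measurable]: "W \<in> borel_measurable borel" unfolding W_def by measurable
  have fW: "AE x in lborel. f x * W x = f x * potential w x - f x * w x / l" if f: "vorticity f" for f
    using EL
  proof eventually_elim
    case (elim x)
    then show ?case
      using vorticity_zero[OF f, of x] by (cases "0 < snd x") (auto simp: W_def right_diff_distrib)
  qed
  have int: "integrable lborel (\<lambda>x. f x * potential w x - f x * w x / l)" if f: "vorticity f" for f
    by (intro Bochner_Integration.integrable_diff interaction_potential_integrable integrable_divide_zero
        square_integrable_mult vorticity_square f wv) 
  have fWi: "integrable lborel (\<lambda>x. f x * W x)" if f: "vorticity f" for f
  proof -
    note [measurable] = vorticity_measurable[OF f]
    show ?thesis by (rule integrable_cong_AE_imp[OF int[OF f]]) (use fW[OF f] in \<open>auto elim: AE_mp\<close>)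
  qed
  have fWe: "(\<integral>x. f x * W x \<partial>lborel) = interaction w f - (\<integral>x. w x * f x \<partial>lborel) / l" if f: "vorticity f" for f
  proof -
    note [measurable] = vorticity_measurable[OF f]
    have "(\<integral>x. f x * W x \<partial>lborel) = (\<integral>x. f x * potential w x - f x * w x / l \<partial>lborel)"
      by (rule integral_cong_AE[OF _ _ fW[OF f]]) measurable
    also have "\<dots> = (\<integral>x. f x * potential w x \<partial>lborel) - (\<integral>x. f x * w x / l \<partial>lborel)"
      by (intro Bochner_Integration.integral_diff interaction_potential_integrable integrable_divide_zero
        square_integrable_mult vorticity_square f wv)
    also have "(\<integral>x. f x * potential w x \<partial>lborel) = interaction w f"
      using interaction_potential(1)[OF f wv] interaction_sym[OF f wv] by simp
    finally show ?thesis by (simp add: mult.commute)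
  qed
  have "0 < (\<integral>x. v x * W x \<partial>lborel)"
  proof (rule integral_mult_pos[OF vorticity_integrable[OF vv] vorticity_nonneg[OF vv] _ fWi[OF vv]])
    show "0 < (\<integral>x. v x \<partial>lborel)" using mv by (simp add: mass_def)
    show "0 \<le> W x" for x by (simp add: W_def)
    show "AE x in lborel. 0 < v x \<longrightarrow> 0 < W x"
      using EL
    proof eventually_elim
      case (elim x)
      then show ?case using vorticity_zero[OF vv, of x] by (cases "0 < snd x") (auto simp: W_def)
    qed
  qed
  \<comment> \<open>The cross term of \<open>w\<close> with the moved tails is eventually above
    \<open>q\<close>, by lower semicontinuity with weight \<open>W\<close>, whereas the comparison
    bounds it by the error \<rho>, which falls below \<open>q\<close>.\<close>
  then obtain q where q: "0 < q" "q < (\<integral>x. v x * W x \<partial>lborel)" using dense by blast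
  have "eventually (\<lambda>j. (\<integral>x. v x * W x \<partial>lborel) - ((\<integral>x. v x * W x \<partial>lborel) - q) < (\<integral>x. V (s j) x * W x \<partial>lborel)) sequentially"
  proof (rule weak_weight_lower[OF Vw _ _ fWi[OF Vv] vorticity_nonneg[OF Vv] fWi[OF vv] vorticity_nonneg[OF vv]])
    show "0 \<le> W x" for x by (simp add: W_def)
  qed (use q in simp_all)
  moreover have "(\<lambda>j. \<rho> (s j)) \<longlonglongrightarrow> 0" by (rule LIMSEQ_subseq_LIMSEQ[OF \<rho>0 s, unfolded comp_def])
  then have "eventually (\<lambda>j. \<rho> (s j) < q) sequentially" using q by (intro order_tendstoD) auto
  ultimately have "eventually (\<lambda>j. False) sequentially"
  proof eventually_elim
    case (elim j)
    have "interaction w (V (s j)) - (\<integral>x. w x * V (s j) x \<partial>lborel) / l \<le> \<rho> (s j)"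
      using test[OF wv order_refl order_refl Vv Vtr] by simp
    then show ?case using elim fWe[OF Vv, of "s j"] by simp
  qed
  then show False by simp
qed

end

section \<open>Strong convergence and the compactness theorem\<close>

context variational
begin

text \<open>Strong convergence follows from weak convergence and convergence of the norms; in the weighted
  \<open>L\<^sup>1\<close> space, where \<open>\<bar>a - b\<bar> = a - b + 2 max 0 (b - a)\<close>, only the part where \<open>u < w\<close> matters, and
  it is dominated by \<open>x\<^sub>2 w\<close>.\<close>

lemma strong_convergence:
  assumes u: "\<And>n. bounded_vorticity K (u n)" and w: "bounded_vorticity K w" and uw: "weakly u w"
    and i: "(\<lambda>n. impulse (u n)) \<longlonglongrightarrow> impulse w" and q: "(\<lambda>n. enstrophy (u n)) \<longlonglongrightarrow> enstrophy w"
  shows "(\<lambda>n. \<integral>x. (u n x - w x)\<^sup>2 \<partial>lborel) \<longlonglongrightarrow> 0"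
    and "(\<lambda>n. \<integral>x. \<bar>snd x * u n x - snd x * w x\<bar> \<partial>lborel) \<longlonglongrightarrow> 0"
proof -
  note uv = bounded_vorticityD[OF u] and wv = bounded_vorticityD[OF w]
  note us = vorticity_square[OF uv] and ws = vorticity_square[OF wv]
  note [measurable] = vorticity_measurable[OF wv] vorticity_measurable[OF uv]
  define D where "D = (\<lambda>n. \<integral>x. (u n x - w x)\<^sup>2 \<partial>lborel)"
  have "(\<lambda>n. enstrophy (u n) - 2 * (\<integral>x. u n x * w x \<partial>lborel) + enstrophy w)
      \<longlonglongrightarrow> enstrophy w - 2 * (\<integral>x. w x * w x \<partial>lborel) + enstrophy w"
    by (intro tendsto_intros q weaklyD uw ws)
  moreover have "D n = enstrophy (u n) - 2 * (\<integral>x. u n x * w x \<partial>lborel) + enstrophy w" for n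
    unfolding D_def enstrophy_def by (rule integral_square_diff[OF us ws])
  then have "D = (\<lambda>n. enstrophy (u n) - 2 * (\<integral>x. u n x * w x \<partial>lborel) + enstrophy w)" by (rule ext)
  moreover have "(\<integral>x. w x * w x \<partial>lborel) = enstrophy w" by (simp add: enstrophy_def power2_eq_square)
  ultimately have D: "D \<longlonglongrightarrow> 0" by simp
  then show "(\<lambda>n. \<integral>x. (u n x - w x)\<^sup>2 \<partial>lborel) \<longlonglongrightarrow> 0" by (simp add: D_def)
  define h where "h = (\<lambda>x::real \<times> real. max 0 (snd x))"
  have [measurable]: "h \<in> borel_measurable borel" unfolding h_def by measurable
  have h0: "0 \<le> h x" for x by (simp add: h_def)
  note lm = level_borel[OF \<open>h \<in> borel_measurable borel\<close>]
  note [measurable] = lm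
  define P where "P = (\<lambda>n x. h x * max 0 (w x - u n x))"
  have P0: "0 \<le> P n x" for n x using h0[of x] by (simp add: P_def)
  have hw: "h x * f x = snd x * f x" if "vorticity f" for f x
    using vorticity_zero[OF that, of x] by (cases "0 < snd x") (auto simp: h_def)
  have P1: "P n x \<le> snd x * w x" for n x
  proof -
    have "P n x \<le> h x * w x"
      unfolding P_def using vorticity_nonneg[OF wv, of x] vorticity_nonneg[OF uv, of n x]
      by (intro mult_left_mono h0) auto
    then show ?thesis by (simp add: hw wv)
  qed
  have [measurable]: "P n \<in> borel_measurable borel" for n unfolding P_def by measurable
  have Pi: "integrable lborel (P n)" for n
  proof (rule Bochner_Integration.integrable_bound[OF vorticity_impulse_integrable[OF wv]])
    have "norm (P n x) \<le> norm (snd x * w x)" for x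
      unfolding real_norm_def abs_of_nonneg[OF P0] by (rule order_trans[OF P1 abs_ge_self])
    then show "AE x in lborel. norm (P n x) \<le> norm (snd x * w x)" by simp
  qed measurable
  have eq: "\<bar>snd x * u n x - snd x * w x\<bar> = (snd x * u n x - snd x * w x) + 2 * P n x" for n x
  proof -
    have "\<bar>h x * u n x - h x * w x\<bar> = (h x * u n x - h x * w x) + 2 * P n x"
      unfolding P_def using h0[of x] mult_left_mono[of "u n x" "w x" "h x"] mult_left_mono[of "w x" "u n x" "h x"]
      by (cases "u n x \<le> w x") (auto simp: right_diff_distrib abs_if not_le)
    then show ?thesis by (simp add: hw uv wv)
  qed
  have int_eq: "(\<integral>x. \<bar>snd x * u n x - snd x * w x\<bar> \<partial>lborel) = (impulse (u n) - impulse w) + 2 * (\<integral>x. P n x \<partial>lborel)" for n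
  proof -
    note ii = vorticity_impulse_integrable[OF uv, of n] vorticity_impulse_integrable[OF wv]
    have "(\<integral>x. \<bar>snd x * u n x - snd x * w x\<bar> \<partial>lborel)
        = (\<integral>x. (snd x * u n x - snd x * w x) \<partial>lborel) + (\<integral>x. 2 * P n x \<partial>lborel)"
      unfolding eq by (intro Bochner_Integration.integral_add Bochner_Integration.integrable_diff
          integrable_mult_right ii Pi)
    also have "(\<integral>x. (snd x * u n x - snd x * w x) \<partial>lborel) = impulse (u n) - impulse w"
      unfolding impulse_def by (rule Bochner_Integration.integral_diff[OF ii])
    finally show ?thesis by simp
  qed
  have P: "(\<lambda>n. \<integral>x. P n x \<partial>lborel) \<longlonglongrightarrow> 0"
  proof (rule LIMSEQ_I)
    fix e :: real assume e: "0 < e"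
    have "(\<lambda>j. \<integral>x. indicator (level h j) x * (snd x * w x) \<partial>lborel) \<longlonglongrightarrow> (\<integral>x. snd x * w x \<partial>lborel)"
    proof (rule integral_dominated_convergence[OF _ _ vorticity_impulse_integrable[OF wv]])
      show "AE x in lborel. (\<lambda>j. indicator (level h j) x * (snd x * w x)) \<longlonglongrightarrow> snd x * w x"
        by (intro AE_I2 level_tendsto)
      show "AE x in lborel. norm (indicator (level h j) x * (snd x * w x)) \<le> snd x * w x" for j
        using vorticity_height_nonneg[OF wv] by (intro AE_I2) (simp add: indicator_def)
    qed measurable
    then have "eventually (\<lambda>j. impulse w - e / 2 < (\<integral>x. indicator (level h j) x * (snd x * w x) \<partial>lborel)) sequentially"
      using e by (intro order_tendstoD) (auto simp: impulse_def)
    then obtain j where j: "impulse w - e / 2 < (\<integral>x. indicator (level h j) x * (snd x * w x) \<partial>lborel)"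
      by (auto simp: eventually_sequentially)
    \<comment> \<open>On the level set the height is square integrable, and Cauchy-Schwarz bounds
      the integral of \<open>P n\<close> by the convergence already proved in the unweighted space;
      off it \<open>P n\<close> is at most \<open>snd x * w x\<close>, of which less than
      \<open>e / 2\<close> is left there.\<close>
    define \<phi> where "\<phi> = (\<lambda>x. indicator (level h j) x * h x)"
    have \<phi>: "square_integrable \<phi>" unfolding \<phi>_def by (rule level_test[OF _ h0]) measurable
    define C where "C = sqrt (\<integral>x. (\<phi> x)\<^sup>2 \<partial>lborel)"
    have md: "square_integrable (\<lambda>x. \<bar>u n x - w x\<bar>)" for n
      using square_integrable_diff[OF us[of n] ws] by (simp add: square_integrable_def)
    have iA: "integrable lborel (\<lambda>x. indicator (level h j) x * (snd x * w x))"
    proof (rule Bochner_Integration.integrable_bound[OF vorticity_impulse_integrable[OF wv]])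
      show "AE x in lborel. norm (indicator (level h j) x * (snd x * w x)) \<le> norm (snd x * w x)"
        by (intro AE_I2) (simp add: indicator_def)
    qed measurable
    have b: "(\<integral>x. P n x \<partial>lborel) \<le> C * sqrt (D n) + e / 2" for n
    proof -
      have le: "P n x \<le> \<phi> x * \<bar>u n x - w x\<bar> + (snd x * w x - indicator (level h j) x * (snd x * w x))" for x
      proof (cases "x \<in> level h j")
        case True
        have "P n x \<le> h x * \<bar>u n x - w x\<bar>" unfolding P_def by (intro mult_left_mono h0) auto
        then show ?thesis using True by (simp add: \<phi>_def)
      next
        case False
        then show ?thesis using P1[of n x] by (simp add: \<phi>_def)
      qed
      have i1: "integrable lborel (\<lambda>x. \<phi> x * \<bar>u n x - w x\<bar>)"
        by (rule square_integrable_mult[OF \<phi> md])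
      have i2: "integrable lborel (\<lambda>x. snd x * w x - indicator (level h j) x * (snd x * w x))"
        by (intro Bochner_Integration.integrable_diff vorticity_impulse_integrable wv iA)
      have "(\<integral>x. P n x \<partial>lborel) \<le> (\<integral>x. \<phi> x * \<bar>u n x - w x\<bar> + (snd x * w x - indicator (level h j) x * (snd x * w x)) \<partial>lborel)"
        by (rule integral_mono[OF Pi Bochner_Integration.integrable_add[OF i1 i2] le])
      also have "\<dots> = (\<integral>x. \<phi> x * \<bar>u n x - w x\<bar> \<partial>lborel) + (impulse w - (\<integral>x. indicator (level h j) x * (snd x * w x) \<partial>lborel))"
        unfolding Bochner_Integration.integral_add[OF i1 i2]
          Bochner_Integration.integral_diff[OF vorticity_impulse_integrable[OF wv] iA] impulse_def ..
      also have "(\<integral>x. \<phi> x * \<bar>u n x - w x\<bar> \<partial>lborel) \<le> C * sqrt (D n)"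
        using integral_Cauchy_Schwarz[OF \<phi> md[of n]] unfolding C_def D_def by simp
      finally show ?thesis using j by linarith
    qed
    have "(\<lambda>n. C * sqrt (D n)) \<longlonglongrightarrow> 0"
      using tendsto_mult[OF tendsto_const[of C] tendsto_real_sqrt[OF D]] by simp
    then have "eventually (\<lambda>n. C * sqrt (D n) < e / 2) sequentially" using e by (intro order_tendstoD) auto
    then have "eventually (\<lambda>n. norm ((\<integral>x. P n x \<partial>lborel) - 0) < e) sequentially"
    proof eventually_elim
      case (elim n)
      have "0 \<le> (\<integral>x. P n x \<partial>lborel)" by (intro integral_nonneg_AE AE_I2 P0)
      then show ?case using b[of n] elim by simp
    qed
    then show "\<exists>no. \<forall>n\<ge>no. norm ((\<integral>x. P n x \<partial>lborel) - 0) < e" by (simp add: eventually_sequentially)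
  qed
  have "(\<lambda>n. (impulse (u n) - impulse w) + 2 * (\<integral>x. P n x \<partial>lborel)) \<longlonglongrightarrow> (impulse w - impulse w) + 2 * 0"
    by (intro tendsto_intros i P)
  then show "(\<lambda>n. \<integral>x. \<bar>snd x * u n x - snd x * w x\<bar> \<partial>lborel) \<longlonglongrightarrow> 0"
    unfolding int_eq by simp
qed

lemma maximizing_sequence_compact:
  assumes u: "\<And>n. vorticity (u n)" and m: "\<And>n. mass (u n) \<le> \<nu>"
    and i: "(\<lambda>n. impulse (u n)) \<longlonglongrightarrow> \<mu>" and p: "(\<lambda>n. penalized l (u n)) \<longlonglongrightarrow> S"
    and c: "\<And>n. c \<le> mass (cutoff (slab k 0) (u n))" and c0: "0 < c"
  shows "\<exists>r w. strict_mono r \<and> vorticity w \<and> penalized l w = S \<and> impulse w = \<mu> \<and> mass w \<le> \<nu> \<and>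
    (\<lambda>n. \<integral>x. (u (r n) x - w x)\<^sup>2 \<partial>lborel) \<longlonglongrightarrow> 0 \<and>
    (\<lambda>n. \<integral>x. \<bar>snd x * u (r n) x - snd x * w x\<bar> \<partial>lborel) \<longlonglongrightarrow> 0"
proof -
  obtain K where uK: "\<And>n. bounded_vorticity K (u n)"
    using bounded_sequence[of u, OF u m i p] by blast
  obtain r w where r: "strict_mono (r :: nat \<Rightarrow> nat)" and w: "bounded_vorticity K w" and rw: "weakly (\<lambda>n. u (r n)) w"
    using bounded_vorticity_weakly_compact[of K u, OF uK] by (elim exE conjE)
  note wv = bounded_vorticityD[OF w]
  have ri: "(\<lambda>n. impulse (u (r n))) \<longlonglongrightarrow> \<mu>" by (rule LIMSEQ_subseq_LIMSEQ[OF i r, unfolded comp_def])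
  have rp: "(\<lambda>n. penalized l (u (r n))) \<longlonglongrightarrow> S" by (rule LIMSEQ_subseq_LIMSEQ[OF p r, unfolded comp_def])
  have mw: "0 < mass w" by (rule weak_limit_mass_pos[OF u wv rw c c0])
  note lim = compact_if_tail_vanishes[OF uK w rw m ri rp tail_vanishes[OF uK w rw m ri rp mw]]
  have "(\<lambda>n. impulse (u (r n))) \<longlonglongrightarrow> impulse w" using ri lim(2) by simp
  note conv = strong_convergence[OF uK w rw this lim(3)]
  show ?thesis
    using r wv lim(1,2) weak_limit_constraints(1)[OF u wv rw m ri] conv by blast
qed

text \<open>The translations are fixed once for the entire sequence, before any subsequence is
  taken: each term has its own slab of substantial mass, found from its energy alone. Every
  subsequence then has a convergent further subsequence, which is what relative compactness of the
  range asks for.\<close>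

theorem maximizing_sequence_compact_up_to_translation:
  assumes u: "\<And>n. vorticity (u n)" and m: "\<And>n. mass (u n) \<le> \<nu>"
    and i: "(\<lambda>n. impulse (u n)) \<longlonglongrightarrow> \<mu>" and p: "(\<lambda>n. penalized l (u n)) \<longlonglongrightarrow> S"
  shows "\<exists>a :: nat \<Rightarrow> real. \<forall>s :: nat \<Rightarrow> nat. strict_mono s \<longrightarrow> (\<exists>r w. strict_mono r \<and> vorticity w \<and>
    penalized l w = S \<and> impulse w = \<mu> \<and> mass w \<le> \<nu> \<and>
    (\<lambda>n. \<integral>x. (u (s (r n)) (x + (a (s (r n)), 0)) - w x)\<^sup>2 \<partial>lborel) \<longlonglongrightarrow> 0 \<and>
    (\<lambda>n. \<integral>x. \<bar>snd x * u (s (r n)) (x + (a (s (r n)), 0)) - snd x * w x\<bar> \<partial>lborel) \<longlonglongrightarrow> 0)"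
proof -
  obtain K where K: "0 \<le> K" and uK: "\<And>n. bounded_vorticity K (u n)"
    using bounded_sequence[of u, OF u m i p] by blast
  obtain k c where c: "0 < c"
    and nv: "\<And>f. bounded_vorticity K f \<Longrightarrow> S \<le> interaction f f \<Longrightarrow> \<exists>a. c < mass (cutoff (slab k a) f)"
    using nonvanishing[OF pos(4) K] by blast
  have "S / 2 < S" using pos by simp
  then have "eventually (\<lambda>n. S / 2 < penalized l (u n)) sequentially" by (rule order_tendstoD[OF p])
  then obtain N where N: "\<And>n. N \<le> n \<Longrightarrow> S / 2 < penalized l (u n)" by (auto simp: eventually_sequentially)
  have "\<exists>a. c < mass (cutoff (slab k a) (u n))" if "N \<le> n" for n
  proof (rule nv[OF uK])
    have "0 \<le> enstrophy (u n) / (2 * l)" using enstrophy_nonneg[of "u n"] pos by simp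
    then show "S \<le> interaction (u n) (u n)" using N[OF that] unfolding penalized_def by linarith
  qed
  then have "\<forall>n. \<exists>a. N \<le> n \<longrightarrow> c < mass (cutoff (slab k a) (u n))" by blast
  from choice[OF this] obtain a where a: "\<And>n. N \<le> n \<Longrightarrow> c < mass (cutoff (slab k (a n)) (u n))" by blast
  define U where "U = (\<lambda>n x. u n (x + (a n, 0)))"
  have U: "vorticity (U n)" "mass (U n) = mass (u n)" "impulse (U n) = impulse (u n)"
    "penalized l (U n) = penalized l (u n)" for n
    unfolding U_def penalized_def interaction_translate_horizontal[OF u u]
    using vorticity_translate[OF u, of 0 n "a n"] by simp_all
  have main: "\<exists>r w. strict_mono r \<and> vorticity w \<and> penalized l w = S \<and> impulse w = \<mu> \<and> mass w \<le> \<nu> \<and>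
      (\<lambda>n. \<integral>x. (U (s (r n)) x - w x)\<^sup>2 \<partial>lborel) \<longlonglongrightarrow> 0 \<and>
      (\<lambda>n. \<integral>x. \<bar>snd x * U (s (r n)) x - snd x * w x\<bar> \<partial>lborel) \<longlonglongrightarrow> 0"
    if s: "strict_mono s" for s :: "nat \<Rightarrow> nat"
  proof -
    \<comment> \<open>For indices below \<open>N\<close> the value may be too small to provide a
      slab and the translation is arbitrary, so these terms are skipped; \<open>s\<close> is at
      least the identity, so dropping \<open>N\<close> terms suffices.\<close>
    define t where "t = (\<lambda>n. s (n + N))"
    have t: "strict_mono t" using s by (simp add: t_def strict_mono_def)
    have tN: "N \<le> t n" for n using seq_suble[OF s, of "n + N"] by (simp add: t_def)
    have "\<exists>r w. strict_mono r \<and> vorticity w \<and> penalized l w = S \<and> impulse w = \<mu> \<and> mass w \<le> \<nu> \<and>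
      (\<lambda>n. \<integral>x. (U (t (r n)) x - w x)\<^sup>2 \<partial>lborel) \<longlonglongrightarrow> 0 \<and>
      (\<lambda>n. \<integral>x. \<bar>snd x * U (t (r n)) x - snd x * w x\<bar> \<partial>lborel) \<longlonglongrightarrow> 0"
    proof (rule maximizing_sequence_compact[where u = "\<lambda>n. U (t n)" and c = c and k = k])
      show "(\<lambda>n. impulse (U (t n))) \<longlonglongrightarrow> \<mu>"
        unfolding U by (rule LIMSEQ_subseq_LIMSEQ[OF i t, unfolded comp_def])
      show "(\<lambda>n. penalized l (U (t n))) \<longlonglongrightarrow> S"
        unfolding U by (rule LIMSEQ_subseq_LIMSEQ[OF p t, unfolded comp_def])
      show "c \<le> mass (cutoff (slab k 0) (U (t n)))" for n
        unfolding U_def mass_slab_translate[OF u] by (intro less_imp_le a tN)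
    qed (auto simp: U m c)
    then obtain r w where rw: "strict_mono r" "vorticity w" "penalized l w = S" "impulse w = \<mu>" "mass w \<le> \<nu>"
      "(\<lambda>n. \<integral>x. (U (t (r n)) x - w x)\<^sup>2 \<partial>lborel) \<longlonglongrightarrow> 0"
      "(\<lambda>n. \<integral>x. \<bar>snd x * U (t (r n)) x - snd x * w x\<bar> \<partial>lborel) \<longlonglongrightarrow> 0"
      by (elim exE conjE)
    have "strict_mono (\<lambda>n. r n + N)" using rw(1) by (simp add: strict_mono_def)
    then show ?thesis
      using rw(2-) unfolding t_def by (intro exI[of _ "\<lambda>n. r n + N"] exI[of _ w] conjI)
  qed
  have "\<forall>s :: nat \<Rightarrow> nat. strict_mono s \<longrightarrow> (\<exists>r w. strict_mono r \<and> vorticity w \<and>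
    penalized l w = S \<and> impulse w = \<mu> \<and> mass w \<le> \<nu> \<and>
    (\<lambda>n. \<integral>x. (u (s (r n)) (x + (a (s (r n)), 0)) - w x)\<^sup>2 \<partial>lborel) \<longlonglongrightarrow> 0 \<and>
    (\<lambda>n. \<integral>x. \<bar>snd x * u (s (r n)) (x + (a (s (r n)), 0)) - snd x * w x\<bar> \<partial>lborel) \<longlonglongrightarrow> 0)"
    using main unfolding U_def by simp
  then show ?thesis by (rule exI[of _ a])
qed

end

section \<open>Relative compactness in \<open>L\<^sup>p\<close>\<close>

text \<open>Points of a closure are approximated by terms \<open>F (n j)\<close> whose indices may
  repeat or decrease. Either one index occurs infinitely often, or each value is taken finitely
  often; then larger values occur beyond every position, and iterating that choice gives a genuine
  subsequence.\<close>

lemma nat_subsequence_constant_or_strict_mono: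
  fixes s :: "nat \<Rightarrow> nat"
  shows "\<exists>t :: nat \<Rightarrow> nat. strict_mono t \<and> ((\<exists>c. \<forall>i. s (t i) = c) \<or> strict_mono (\<lambda>i. s (t i)))"
proof (cases "\<exists>c. infinite {i. s i = c}")
  case True
  then obtain c where c: "infinite {i. s i = c}" by blast
  define t where "t = enumerate {i. s i = c}"
  have "\<forall>i. s (t i) = c" using enumerate_in_set[OF c] by (simp add: t_def)
  moreover have "strict_mono t" unfolding t_def by (rule strict_mono_enumerate[OF c])
  ultimately show ?thesis by blast
next
  case False
  have "\<exists>j>i. s i < s j" for i
  proof -
    have "finite (\<Union>c\<in>{..s i}. {j. s j = c})" using False by (intro finite_UN_I) auto
    then have "finite ({..i} \<union> (\<Union>c\<in>{..s i}. {j. s j = c}))" by simp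
    then obtain j where "j \<notin> {..i} \<union> (\<Union>c\<in>{..s i}. {j. s j = c})" using ex_new_if_finite infinite_UNIV_nat by blast
    then show ?thesis by (intro exI[of _ j]) auto
  qed
  then have "\<forall>i. \<exists>j. i < j \<and> s i < s j" by blast
  from choice[OF this] obtain g where g: "\<And>i. i < g i" "\<And>i. s i < s (g i)" by blast
  define t where "t = (\<lambda>n. (g ^^ n) 0)"
  have "strict_mono t" unfolding strict_mono_Suc_iff t_def using g(1) by simp
  moreover have "strict_mono (\<lambda>i. s (t i))" unfolding strict_mono_Suc_iff t_def using g(2) by simp
  ultimately show ?thesis by blast
qed

text \<open>The pseudometric of \<open>L\<^sup>p\<close> becomes a metric on a set of representatives; open sets are
  saturated, so compactness may be tested there.\<close>

lemma relatively_compactin_Lp_topology: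
  assumes tri: "\<And>f g h. f \<in> Lp p M \<Longrightarrow> g \<in> Lp p M \<Longrightarrow> h \<in> Lp p M \<Longrightarrow>
      Lp_norm p M (\<lambda>x. f x - h x) \<le> Lp_norm p M (\<lambda>x. f x - g x) + Lp_norm p M (\<lambda>x. g x - h x)"
    and F: "\<And>n. F n \<in> Lp p M"
    and sub: "\<And>s::nat \<Rightarrow> nat. strict_mono s \<Longrightarrow> \<exists>r g. strict_mono r \<and> g \<in> Lp p M \<and>
      (\<lambda>n. Lp_norm p M (\<lambda>x. F (s (r n)) x - g x)) \<longlonglongrightarrow> 0"
  shows "relatively_compactin (Lp_topology p M) (range F)"
proof -
  define X where "X = Lp p M"
  define d where "d = (\<lambda>f g. Lp_norm p M (\<lambda>x. f x - g x))"
  define T where "T = Lp_topology p M"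
  have d_nonneg: "0 \<le> d f g" for f g by (simp add: d_def Lp_norm_def)
  have d_sym: "d f g = d g f" for f g by (simp add: d_def Lp_norm_def abs_minus_commute)
  have d_refl: "d f f = 0" for f by (simp add: d_def Lp_norm_def)
  have d_tri: "d f h \<le> d f g + d g h" if "f \<in> X" "g \<in> X" "h \<in> X" for f g h
    using tri[of f g h] that by (simp add: d_def X_def)
  have topX: "topspace T = X" by (simp add: T_def X_def)
  have FX: "F n \<in> X" for n using F by (simp add: X_def)
  have open_T: "openin T U \<longleftrightarrow> U \<subseteq> X \<and> (\<forall>f\<in>U. \<exists>e>0. \<forall>g\<in>X. d f g < e \<longrightarrow> g \<in> U)" for U
    unfolding T_def openin_Lp_topology X_def[symmetric] by (simp add: d_def Lp_norm_def abs_minus_commute)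
  define C where "C = T closure_of range F"
  have CX: "C \<subseteq> X" using closure_of_subset_topspace[of T] by (simp add: C_def topX)
  have C_near: "\<exists>n. d f (F n) < e" if f: "f \<in> C" and e: "0 < e" for f e
  proof -
    have fX: "f \<in> X" using f CX by blast
    have "openin T {g \<in> X. d f g < e}"
      unfolding open_T
    proof (intro conjI ballI)
      fix g assume g: "g \<in> {g \<in> X. d f g < e}"
      have "h \<in> {g \<in> X. d f g < e}" if "h \<in> X" "d g h < e - d f g" for h
        using d_tri[OF fX _ that(1), of g] g that by simp
      then show "\<exists>e'>0. \<forall>h\<in>X. d g h < e' \<longrightarrow> h \<in> {g \<in> X. d f g < e}"
        using g by (intro exI[of _ "e - d f g"]) simp
    qed auto
    moreover have "f \<in> {g \<in> X. d f g < e}" using fX e by (simp add: d_refl)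
    moreover have "\<forall>U. f \<in> U \<and> openin T U \<longrightarrow> (\<exists>y\<in>range F. y \<in> U)"
      using f unfolding C_def closure_of_def by simp
    ultimately have "\<exists>y\<in>range F. y \<in> {g \<in> X. d f g < e}" by (simp only:)
    then show ?thesis by auto
  qed
  have C_lim: "g \<in> C" if g: "g \<in> X" and near: "\<And>e. 0 < e \<Longrightarrow> \<exists>f\<in>C. d g f < e" for g
  proof (rule ccontr)
    assume "g \<notin> C"
    have "openin T (X - C)" using closedin_closure_of[of T "range F"] by (simp add: closedin_def topX C_def)
    then obtain e where "0 < e" "\<forall>f\<in>X. d g f < e \<longrightarrow> f \<in> X - C"
      using g \<open>g \<notin> C\<close> unfolding open_T by blast
    then show False using near[of e] CX by blast
  qed
  \<comment> \<open>The choice depends on \<open>f\<close> only through the predicate, which is the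
    same for functions at distance 0; hence \<open>rep\<close> picks one function per class.\<close>
  define rep where "rep = (\<lambda>f. SOME g. g \<in> X \<and> d f g = 0)"
  have rep: "rep f \<in> X \<and> d f (rep f) = 0" if "f \<in> X" for f
    unfolding rep_def by (rule someI[of _ f]) (simp add: that d_refl)
  have rep_eq: "rep f = rep g" if f: "f \<in> X" and g: "g \<in> X" and fg: "d f g = 0" for f g
  proof -
    have "d f h = 0 \<longleftrightarrow> d g h = 0" if h: "h \<in> X" for h
      using d_tri[OF f g h] d_tri[OF g f h] d_sym[of f g] fg d_nonneg[of f h] d_nonneg[of g h] by linarith
    then have "(\<lambda>h. h \<in> X \<and> d f h = 0) = (\<lambda>h. h \<in> X \<and> d g h = 0)" by blast
    then show ?thesis by (simp add: rep_def)
  qed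
  have repC: "rep f \<in> C" if f: "f \<in> C" for f
  proof (rule C_lim)
    have fX: "f \<in> X" using f CX by blast
    show "rep f \<in> X" using rep[OF fX] by blast
    show "\<exists>h\<in>C. d (rep f) h < e" if "0 < e" for e
      using rep[OF fX] f that d_sym[of f "rep f"] by (intro bexI[of _ f]) auto
  qed
  interpret Y: Metric_space "rep ` X" d
  proof
    show "0 \<le> d x y" for x y by (rule d_nonneg)
    show "d x y = d y x" for x y by (rule d_sym)
    show "d x y = 0 \<longleftrightarrow> x = y" if x: "x \<in> rep ` X" and y: "y \<in> rep ` X" for x y
    proof
      assume d0: "d x y = 0"
      obtain f g where f: "f \<in> X" "x = rep f" and g: "g \<in> X" "y = rep g" using x y by blast
      have "d f g \<le> d f x + (d x y + d y g)"
        using d_tri[of f x g] d_tri[of x y g] rep f g by fastforce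
      then have "d f g = 0"
        using d0 rep[OF f(1)] rep[OF g(1)] f(2) g(2) d_sym[of y g] d_nonneg[of f g] by simp
      then show "x = y" using rep_eq f g by simp
    qed (simp add: d_refl)
    show "d x z \<le> d x y + d y z" if "x \<in> rep ` X" "y \<in> rep ` X" "z \<in> rep ` X" for x y z
      using that rep by (intro d_tri) auto
  qed
  have "compactin Y.mtopology (rep ` C)"
    unfolding Y.compactin_sequentially
  proof (intro conjI allI impI)
    show "rep ` C \<subseteq> rep ` X" using CX by blast
    fix \<sigma> :: "nat \<Rightarrow> _" assume "range \<sigma> \<subseteq> rep ` C"
    then have \<sigma>: "\<sigma> j \<in> rep ` C" for j by blast
    have "rep ` C \<subseteq> C" using repC by (rule image_subsetI)
    then have \<sigma>C: "\<sigma> j \<in> C" for j using \<sigma>[of j] by (rule subsetD)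
    have \<sigma>Y: "\<sigma> j \<in> rep ` X" for j using \<sigma>[of j] CX by (rule subsetD[OF image_mono, rotated])
    have \<sigma>X: "\<sigma> j \<in> X" for j using CX \<sigma>C[of j] by (rule subsetD)
    \<comment> \<open>A sequence in the closure is shadowed by members of the original range with
      errors tending to 0, so subsequences need to be extracted only from \<open>F\<close>.\<close>
    have "\<forall>j. \<exists>n. d (\<sigma> j) (F n) < inverse (real (Suc j))"
      by (intro allI C_near \<sigma>C) simp
    from choice[OF this] obtain n where "\<forall>j. d (\<sigma> j) (F (n j)) < inverse (real (Suc j))" ..
    then have n: "\<And>j. d (\<sigma> j) (F (n j)) < inverse (real (Suc j))" by (rule spec)
    obtain t :: "nat \<Rightarrow> nat" where t: "strict_mono t" and tc: "(\<exists>c. \<forall>i. n (t i) = c) \<or> strict_mono (\<lambda>i. n (t i))"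
      using nat_subsequence_constant_or_strict_mono[of n] by blast
    have "\<exists>(r :: nat \<Rightarrow> nat) g. strict_mono r \<and> g \<in> X \<and> (\<lambda>i. d (F (n (t (r i)))) g) \<longlonglongrightarrow> 0"
      using tc
    proof
      assume "\<exists>c. \<forall>i. n (t i) = c"
      then obtain c where "\<And>i. n (t i) = c" by blast
      then show ?thesis
        by - (rule exI[of _ "\<lambda>i. i"], rule exI[of _ "F c"], simp add: strict_mono_def FX d_refl)
    next
      assume "strict_mono (\<lambda>i. n (t i))"
      from sub[OF this] show ?thesis by (simp only: d_def X_def)
    qed
    then obtain r g where r: "strict_mono r" and g: "g \<in> X" and lim: "(\<lambda>i. d (F (n (t (r i)))) g) \<longlonglongrightarrow> 0"
      by (elim exE conjE)
    have tr: "strict_mono (\<lambda>i. t (r i))" using t r by (simp add: strict_mono_def)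
    have gY: "rep g \<in> X" "d g (rep g) = 0" using rep[OF g] by auto
    have "(\<lambda>i. inverse (real (Suc (t (r i))))) \<longlonglongrightarrow> 0"
      by (rule LIMSEQ_subseq_LIMSEQ[OF LIMSEQ_inverse_real_of_nat tr, unfolded comp_def])
    from tendsto_add[OF this lim]
    have up: "(\<lambda>i. inverse (real (Suc (t (r i)))) + d (F (n (t (r i)))) g) \<longlonglongrightarrow> 0" by simp
    have le: "d (\<sigma> (t (r i))) (rep g) \<le> inverse (real (Suc (t (r i)))) + d (F (n (t (r i)))) g" for i
      using d_tri[OF \<sigma>X FX gY(1), of "t (r i)" "n (t (r i))"] d_tri[OF FX g gY(1), of "n (t (r i))"]
        n[of "t (r i)"] gY(2) by linarith
    have lim': "(\<lambda>i. d (\<sigma> (t (r i))) (rep g)) \<longlonglongrightarrow> 0"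
      by (rule tendsto_sandwich[OF always_eventually always_eventually tendsto_const up])
        (use le d_nonneg in auto)
    have "g \<in> C"
    proof (rule C_lim[OF g])
      fix e :: real assume "0 < e"
      then have "eventually (\<lambda>i. d (\<sigma> (t (r i))) (rep g) < e) sequentially" by (rule order_tendstoD[OF lim'])
      then obtain i where i: "d (\<sigma> (t (r i))) (rep g) < e" by (auto simp: eventually_sequentially)
      have "d g (\<sigma> (t (r i))) \<le> d g (rep g) + d (rep g) (\<sigma> (t (r i)))" by (rule d_tri[OF g gY(1) \<sigma>X])
      then have "d g (\<sigma> (t (r i))) < e" using i gY(2) d_sym[of "rep g"] by simp
      then show "\<exists>f\<in>C. d g f < e" using \<sigma>C by blast
    qed
    then have "rep g \<in> rep ` C" by blast
    moreover have "limitin Y.mtopology (\<sigma> \<circ> (\<lambda>i. t (r i))) (rep g) sequentially"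
      unfolding Y.limitin_metric_dist_null using lim' g \<sigma>Y by (auto simp: comp_def)
    ultimately show "\<exists>l r. l \<in> rep ` C \<and> strict_mono r \<and> limitin Y.mtopology (\<sigma> \<circ> r) l sequentially"
      using tr by blast
  qed
  then have cover: "\<And>\<U>. \<forall>U\<in>\<U>. openin Y.mtopology U \<Longrightarrow> rep ` C \<subseteq> \<Union>\<U> \<Longrightarrow>
      \<exists>\<F>. finite \<F> \<and> \<F> \<subseteq> \<U> \<and> rep ` C \<subseteq> \<Union>\<F>"
    unfolding compactin_def by blast
  have "compactin T C"
    unfolding compactin_def
  proof (intro conjI allI impI)
    show "C \<subseteq> topspace T" using CX topX by simp
    fix \<U> assume "Ball \<U> (openin T) \<and> C \<subseteq> \<Union>\<U>"
    then have op: "\<And>U. U \<in> \<U> \<Longrightarrow> openin T U" and cov: "C \<subseteq> \<Union>\<U>" by blast+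
    have "openin Y.mtopology (U \<inter> rep ` X)" if U: "U \<in> \<U>" for U
      unfolding Y.openin_mtopology
    proof (intro conjI allI impI)
      fix x assume x: "x \<in> U \<inter> rep ` X"
      then obtain e where e: "0 < e" "\<forall>g\<in>X. d x g < e \<longrightarrow> g \<in> U"
        using op[OF U] unfolding open_T by blast
      have "Y.mball x e \<subseteq> U \<inter> rep ` X"
        using e rep by (auto simp: Y.mball_def)
      then show "\<exists>r>0. Y.mball x r \<subseteq> U \<inter> rep ` X" using e(1) by blast
    qed blast
    then have opY: "\<forall>V\<in>(\<lambda>U. U \<inter> rep ` X) ` \<U>. openin Y.mtopology V" by blast
    have covY: "rep ` C \<subseteq> \<Union>((\<lambda>U. U \<inter> rep ` X) ` \<U>)"
    proof
      fix y assume "y \<in> rep ` C"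
      then have "y \<in> C" "y \<in> rep ` X" using repC CX by blast+
      then show "y \<in> \<Union>((\<lambda>U. U \<inter> rep ` X) ` \<U>)" using cov by blast
    qed
    from cover[OF opY covY] obtain \<F>
      where \<F>: "finite \<F>" "\<F> \<subseteq> (\<lambda>U. U \<inter> rep ` X) ` \<U>" "rep ` C \<subseteq> \<Union>\<F>"
      by (elim exE conjE)
    obtain \<G> where \<G>: "\<G> \<subseteq> \<U>" "finite \<G>" "\<F> = (\<lambda>U. U \<inter> rep ` X) ` \<G>"
      using finite_subset_image[OF \<F>(1,2)] by blast
    have "C \<subseteq> \<Union>\<G>"
    proof
      fix f assume f: "f \<in> C"
      then have fX: "f \<in> X" using CX by blast
      obtain U where U: "U \<in> \<G>" "rep f \<in> U" using \<F>(3) \<G>(3) f by blast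
      then obtain e where e: "0 < e" "\<forall>g\<in>X. d (rep f) g < e \<longrightarrow> g \<in> U"
        using op \<G>(1) unfolding open_T by blast
      have "d (rep f) f = 0" using rep[OF fX] d_sym by simp
      then have "f \<in> U" using e fX by simp
      then show "f \<in> \<Union>\<G>" using U(1) by blast
    qed
    then show "\<exists>\<F>. finite \<F> \<and> \<F> \<subseteq> \<U> \<and> C \<subseteq> \<Union>\<F>" using \<G> by blast
  qed
  moreover have "range F \<subseteq> topspace T" using FX topX by blast
  ultimately show ?thesis unfolding relatively_compactin_def T_def C_def by blast
qed

section \<open>The exponents one and two\<close>

lemma Lp_norm_1: "Lp_norm 1 M f = (\<integral>x. \<bar>f x\<bar> \<partial>M)"
  by (simp add: Lp_norm_def)

lemma Lp_norm_2: "Lp_norm 2 M f = sqrt (\<integral>x. (f x)\<^sup>2 \<partial>M)"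
  by (simp add: Lp_norm_def powr_half_sqrt)

lemma Lp_1: "f \<in> Lp 1 M \<longleftrightarrow> integrable M f"
  by (auto simp: Lp_def integrable_iff_bounded)

lemma Lp_2: "f \<in> Lp 2 M \<longleftrightarrow> f \<in> borel_measurable M \<and> integrable M (\<lambda>x. (f x)\<^sup>2)"
  by (simp add: Lp_def)

lemma Lp_norm_1_triangle:
  assumes "f \<in> Lp 1 M" "g \<in> Lp 1 M" "h \<in> Lp 1 M"
  shows "Lp_norm 1 M (\<lambda>x. f x - h x) \<le> Lp_norm 1 M (\<lambda>x. f x - g x) + Lp_norm 1 M (\<lambda>x. g x - h x)"
proof -
  have i: "integrable M f" "integrable M g" "integrable M h" using assms by (simp_all only: Lp_1)
  have "(\<integral>x. \<bar>f x - h x\<bar> \<partial>M) \<le> (\<integral>x. \<bar>f x - g x\<bar> + \<bar>g x - h x\<bar> \<partial>M)"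
    using i by (intro integral_mono) auto
  also have "\<dots> = (\<integral>x. \<bar>f x - g x\<bar> \<partial>M) + (\<integral>x. \<bar>g x - h x\<bar> \<partial>M)"
    using i by (intro Bochner_Integration.integral_add) auto
  finally show ?thesis by (simp only: Lp_norm_1)
qed

lemma square_integrable_sum:
  fixes u v :: "'a \<Rightarrow> real"
  assumes [measurable]: "u \<in> borel_measurable M" "v \<in> borel_measurable M"
    and "integrable M (\<lambda>x. (u x)\<^sup>2)" "integrable M (\<lambda>x. (v x)\<^sup>2)"
  shows "integrable M (\<lambda>x. (u x + v x)\<^sup>2)" "integrable M (\<lambda>x. u x * v x)"
proof -
  have i: "integrable M (\<lambda>x. (u x)\<^sup>2 + (v x)\<^sup>2)" using assms by simp
  show m: "integrable M (\<lambda>x. u x * v x)"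
  proof (rule Bochner_Integration.integrable_bound[OF i])
    have "norm (u x * v x) \<le> norm ((u x)\<^sup>2 + (v x)\<^sup>2)" for x
    proof -
      have "2 * \<bar>u x * v x\<bar> \<le> (u x)\<^sup>2 + (v x)\<^sup>2"
        using sum_squares_bound[of "\<bar>u x\<bar>" "\<bar>v x\<bar>"] by (simp add: abs_mult mult.assoc)
      then show ?thesis using abs_ge_zero[of "u x * v x"] unfolding real_norm_def by linarith
    qed
    then show "AE x in M. norm (u x * v x) \<le> norm ((u x)\<^sup>2 + (v x)\<^sup>2)" by simp
  qed measurable
  then show "integrable M (\<lambda>x. (u x + v x)\<^sup>2)"
    using assms by (simp add: power2_sum mult.assoc)
qed

text \<open>The cross term is estimated by \<open>2 u v \<le> (b / a) u\<^sup>2 + (a / b) v\<^sup>2\<close>, where \<open>a\<close> and \<open>b\<close>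
  slightly exceed the norms of \<open>u\<close> and \<open>v\<close>.\<close>

lemma L2_norm_sum_le:
  fixes u v :: "'a \<Rightarrow> real"
  assumes [measurable]: "u \<in> borel_measurable M" "v \<in> borel_measurable M"
    and u: "integrable M (\<lambda>x. (u x)\<^sup>2)" and v: "integrable M (\<lambda>x. (v x)\<^sup>2)"
  shows "sqrt (\<integral>x. (u x + v x)\<^sup>2 \<partial>M) \<le> sqrt (\<integral>x. (u x)\<^sup>2 \<partial>M) + sqrt (\<integral>x. (v x)\<^sup>2 \<partial>M)"
proof (rule field_le_epsilon)
  fix e :: real assume e: "0 < e"
  define A where "A = (\<integral>x. (u x)\<^sup>2 \<partial>M)"
  define B where "B = (\<integral>x. (v x)\<^sup>2 \<partial>M)"
  define a where "a = sqrt A + e / 2"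
  define b where "b = sqrt B + e / 2"
  have AB: "0 \<le> A" "0 \<le> B" unfolding A_def B_def by (auto intro: integral_nonneg_AE)
  have ab: "0 < a" "0 < b" using e AB by (auto simp: a_def b_def add_nonneg_pos)
  have sab: "sqrt A \<le> a" "sqrt B \<le> b" using e by (auto simp: a_def b_def)
  have Aa: "A \<le> a\<^sup>2" using power_mono[OF sab(1), of 2] AB by simp
  have Bb: "B \<le> b\<^sup>2" using power_mono[OF sab(2), of 2] AB by simp
  have pt: "(u x + v x)\<^sup>2 \<le> (1 + b / a) * (u x)\<^sup>2 + (1 + a / b) * (v x)\<^sup>2" for x
  proof -
    have "0 \<le> (b * u x - a * v x)\<^sup>2 / (a * b)" using ab by simp
    also have "\<dots> = b / a * (u x)\<^sup>2 + a / b * (v x)\<^sup>2 - 2 * u x * v x"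
      using ab by (simp add: power2_diff power_mult_distrib field_simps power2_eq_square)
    finally show ?thesis by (simp add: power2_sum distrib_right)
  qed
  have "(\<integral>x. (u x + v x)\<^sup>2 \<partial>M) \<le> (\<integral>x. (1 + b / a) * (u x)\<^sup>2 + (1 + a / b) * (v x)\<^sup>2 \<partial>M)"
    using u v by (intro integral_mono pt square_integrable_sum) auto
  also have "\<dots> = (1 + b / a) * A + (1 + a / b) * B"
    unfolding A_def B_def using u v by simp
  also have "\<dots> \<le> (1 + b / a) * a\<^sup>2 + (1 + a / b) * b\<^sup>2"
    using ab Aa Bb by (intro add_mono mult_left_mono) auto
  also have "\<dots> = (a + b)\<^sup>2" using ab by (simp add: field_simps power2_eq_square)
  finally have "sqrt (\<integral>x. (u x + v x)\<^sup>2 \<partial>M) \<le> a + b"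
    using ab by (intro real_le_lsqrt) auto
  then show "sqrt (\<integral>x. (u x + v x)\<^sup>2 \<partial>M) \<le> sqrt (\<integral>x. (u x)\<^sup>2 \<partial>M) + sqrt (\<integral>x. (v x)\<^sup>2 \<partial>M) + e"
    by (simp add: a_def b_def A_def B_def)
qed

lemma Lp_norm_2_triangle:
  assumes "f \<in> Lp 2 M" "g \<in> Lp 2 M" "h \<in> Lp 2 M"
  shows "Lp_norm 2 M (\<lambda>x. f x - h x) \<le> Lp_norm 2 M (\<lambda>x. f x - g x) + Lp_norm 2 M (\<lambda>x. g x - h x)"
proof -
  have [measurable]: "f \<in> borel_measurable M" "g \<in> borel_measurable M" "h \<in> borel_measurable M"
    and i: "integrable M (\<lambda>x. (f x)\<^sup>2)" "integrable M (\<lambda>x. (g x)\<^sup>2)" "integrable M (\<lambda>x. (h x)\<^sup>2)"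
    using assms by (auto simp: Lp_2)
  have d: "integrable M (\<lambda>x. (p x - q x)\<^sup>2)"
    if [measurable]: "p \<in> borel_measurable M" "q \<in> borel_measurable M"
      and "integrable M (\<lambda>x. (p x)\<^sup>2)" "integrable M (\<lambda>x. (q x)\<^sup>2)" for p q :: "'a \<Rightarrow> real"
    using square_integrable_sum(1)[of p M "\<lambda>x. - q x"] that by simp
  have "sqrt (\<integral>x. ((f x - g x) + (g x - h x))\<^sup>2 \<partial>M)
      \<le> sqrt (\<integral>x. (f x - g x)\<^sup>2 \<partial>M) + sqrt (\<integral>x. (g x - h x)\<^sup>2 \<partial>M)"
    by (intro L2_norm_sum_le d i) measurable
  then show ?thesis by (simp add: Lp_norm_2)
qed

section \<open>Functions on the half plane\<close>

lemma halfplane_borel [measurable]: "halfplane \<in> sets borel"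
  unfolding halfplane_def by (intro borel_open open_Collect_less continuous_intros)

lemma halfplane_lebesgue: "halfplane \<inter> space lebesgue \<in> sets lebesgue"
  by simp

lemma AE_halfplane: "(AE x in halfplane_measure. P x) \<longleftrightarrow> (AE x in lborel. x \<in> halfplane \<longrightarrow> P x)"
  unfolding AE_restrict_space_iff[OF halfplane_lebesgue] by (rule AE_completion_iff)

lemma borel_measurable_halfplane: "h \<in> borel_measurable borel \<Longrightarrow> h \<in> borel_measurable halfplane_measure"
  by (intro measurable_restrict_space1 measurable_completion) simp

lemma halfplane_integral:
  fixes h :: "real \<times> real \<Rightarrow> real"
  assumes [measurable]: "h \<in> borel_measurable borel" and h: "\<And>x. x \<notin> halfplane \<Longrightarrow> h x = 0"
  shows "(\<integral>x. h x \<partial>halfplane_measure) = (\<integral>x. h x \<partial>lborel)"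
    and "integrable halfplane_measure h \<longleftrightarrow> integrable lborel h"
proof -
  have eq: "indicator halfplane x *\<^sub>R h x = h x" for x
    using h[of x] by (cases "x \<in> halfplane") auto
  show "(\<integral>x. h x \<partial>halfplane_measure) = (\<integral>x. h x \<partial>lborel)"
    unfolding integral_restrict_space[OF halfplane_lebesgue] eq by (rule integral_completion) simp
  show "integrable halfplane_measure h \<longleftrightarrow> integrable lborel h"
    unfolding integrable_restrict_space[OF halfplane_lebesgue] eq by (rule integrable_completion) simp
qed

lemma vorticity_off_halfplane: "vorticity f \<Longrightarrow> x \<notin> halfplane \<Longrightarrow> f x = 0"
  by (rule vorticity_zero) (simp_all add: halfplane_def not_less)

lemma AE_lborel_translate:
  fixes a :: "'a::euclidean_space"
  assumes "AE x in lborel. P x"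
  shows "AE x in lborel. P (x + a)"
proof -
  obtain N where N: "N \<in> null_sets lborel" "{x \<in> space lborel. \<not> P x} \<subseteq> N"
    using assms by (auto simp: eventually_ae_filter)
  then have [measurable]: "N \<in> sets borel" by auto
  have [measurable]: "(\<lambda>x. x + a) \<in> borel \<rightarrow>\<^sub>M borel" by measurable
  have m: "(\<lambda>x. indicator N (x + a) :: ennreal) \<in> borel_measurable lborel"
    by (rule measurable_compose[of "\<lambda>x. x + a" lborel borel]) measurable
  have "(\<integral>\<^sup>+x. indicator N (x + a) \<partial>lborel) = (\<integral>\<^sup>+x. indicator N x \<partial>lborel)"
    by (rule nn_integral_lborel_translate) measurable
  also have "\<dots> = 0" by (simp add: null_setsD1[OF N(1)])
  finally have "AE x in lborel. (indicator N (x + a) :: ennreal) = 0"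
    by (subst (asm) nn_integral_0_iff_AE[OF m])
  then show ?thesis
    by eventually_elim (use N(2) in \<open>auto simp: indicator_def split: if_splits\<close>)
qed

text \<open>Admissible functions are only Lebesgue measurable, so composing them with a translation
  needs measurability from the completed measure to itself; continuity of the map would not give
  this.\<close>

lemma translate_measurable_halfplane:
  "(\<lambda>x. x + (a, 0)) \<in> halfplane_measure \<rightarrow>\<^sub>M halfplane_measure"
proof (rule measurable_restrict_space3)
  have "(\<lambda>x. (a, 0) + (\<Sum>j\<in>Basis. (1 * (x \<bullet> j)) *\<^sub>R j)) \<in> lebesgue \<rightarrow>\<^sub>M (lebesgue :: (real \<times> real) measure)"
    by (rule lebesgue_affine_measurable) simp
  then show "(\<lambda>x. x + (a, 0)) \<in> lebesgue \<rightarrow>\<^sub>M (lebesgue :: (real \<times> real) measure)"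
    by (simp add: euclidean_representation add.commute)
  show "(\<lambda>x. x + (a, 0)) \<in> halfplane \<rightarrow> halfplane" by (auto simp: halfplane_def)
qed

text \<open>The iterated integral is treated in two stages. For each fixed \<open>y\<close> the
  inner integrand may be changed on a null set, which by symmetry of the kernel turns the inner
  integral into \<open>potential F y * \<omega> y\<close>; after that the outer one may be changed
  too. Only then is it identified with the joint integral.\<close>

lemma energy_representative:
  assumes F: "vorticity F" and \<omega>: "\<omega> \<in> borel_measurable halfplane_measure"
    and ae: "AE x in halfplane_measure. \<omega> x = F x"
  shows "energy \<omega> = interaction F F / 2"
proof -
  note [measurable] = \<omega> borel_measurable_halfplane[OF vorticity_measurable[OF F]] vorticity_measurable[OF F]
    borel_measurable_halfplane[OF potential_measurable[OF F]] potential_measurable[OF F]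
  have inner: "(\<integral>x. green x y * \<omega> x * \<omega> y \<partial>halfplane_measure) = potential F y * \<omega> y" if y: "y \<in> halfplane" for y
  proof -
    have [measurable]: "hgreen y \<in> borel_measurable borel" by (rule kernel_measurable_right[OF kernel_hgreen])
    note [measurable] = borel_measurable_halfplane[OF this]
    have "(\<integral>x. green x y * \<omega> x * \<omega> y \<partial>halfplane_measure) = (\<integral>x. hgreen y x * \<omega> x * \<omega> y \<partial>halfplane_measure)"
    proof (rule Bochner_Integration.integral_cong[OF refl])
      fix x assume "x \<in> space halfplane_measure"
      then have "0 < snd x" "0 < snd y" using y by (auto simp: halfplane_def space_restrict_space)
      then show "green x y * \<omega> x * \<omega> y = hgreen y x * \<omega> x * \<omega> y"
        by (simp add: green_def hgreen_def max_def dist_commute mult_ac)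
    qed
    also have "\<dots> = (\<integral>x. hgreen y x * F x * \<omega> y \<partial>halfplane_measure)"
    proof (rule integral_cong_AE)
      show "AE x in halfplane_measure. hgreen y x * \<omega> x * \<omega> y = hgreen y x * F x * \<omega> y"
        using ae by eventually_elim simp
    qed measurable
    also have "\<dots> = (\<integral>x. hgreen y x * F x * \<omega> y \<partial>lborel)"
      by (rule halfplane_integral) (auto simp: vorticity_off_halfplane[OF F])
    also have "\<dots> = potential F y * \<omega> y" by (simp add: potential_def)
    finally show ?thesis .
  qed
  have "(\<integral>y. (\<integral>x. green x y * \<omega> x * \<omega> y \<partial>halfplane_measure) \<partial>halfplane_measure)
      = (\<integral>y. potential F y * \<omega> y \<partial>halfplane_measure)"
    by (rule Bochner_Integration.integral_cong[OF refl inner]) (simp add: space_restrict_space)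
  also have "\<dots> = (\<integral>y. F y * potential F y \<partial>halfplane_measure)"
  proof (rule integral_cong_AE)
    show "AE y in halfplane_measure. potential F y * \<omega> y = F y * potential F y"
      using ae by eventually_elim simp
  qed measurable
  also have "\<dots> = (\<integral>y. F y * potential F y \<partial>lborel)"
    by (rule halfplane_integral) (auto simp: vorticity_off_halfplane[OF F])
  also have "\<dots> = interaction F F" by (rule interaction_potential(1)[OF F F, symmetric])
  finally show ?thesis by (simp add: energy_def)
qed

lemma penalized_representative:
  assumes F: "vorticity F" and \<omega>: "\<omega> \<in> borel_measurable halfplane_measure"
    and ae: "AE x in halfplane_measure. \<omega> x = F x"
  shows "penalized_energy l \<omega> = penalized l F"
proof -
  note [measurable] = \<omega> borel_measurable_halfplane[OF vorticity_measurable[OF F]] vorticity_measurable[OF F]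
  have "(\<integral>x. (\<omega> x)\<^sup>2 \<partial>halfplane_measure) = (\<integral>x. (F x)\<^sup>2 \<partial>halfplane_measure)"
  proof (rule integral_cong_AE)
    show "AE x in halfplane_measure. (\<omega> x)\<^sup>2 = (F x)\<^sup>2" using ae by eventually_elim simp
  qed measurable
  also have "\<dots> = enstrophy F"
    unfolding enstrophy_def by (rule halfplane_integral) (auto simp: vorticity_off_halfplane[OF F])
  finally show ?thesis
    unfolding penalized_energy_def penalized_def energy_representative[OF assms] by simp
qed

lemma vorticity_admissible:
  assumes F: "vorticity F" and "impulse F = m" "mass F \<le> \<nu>"
  shows "F \<in> admissible m \<nu>"
proof -
  note [measurable] = vorticity_measurable[OF F]
  have "integrable halfplane_measure F" "(\<integral>x. F x \<partial>halfplane_measure) = mass F"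
    using halfplane_integral[of F] vorticity_off_halfplane[OF F] vorticity_integrable[OF F] by (auto simp: mass_def)
  moreover have "integrable halfplane_measure (\<lambda>x. snd x * F x)" "(\<integral>x. snd x * F x \<partial>halfplane_measure) = impulse F"
    using halfplane_integral[of "\<lambda>x. snd x * F x"] vorticity_off_halfplane[OF F] vorticity_impulse_integrable[OF F]
    by (auto simp: impulse_def)
  moreover have "integrable halfplane_measure (\<lambda>x. (F x)\<^sup>2)"
    using halfplane_integral(2)[of "\<lambda>x. (F x)\<^sup>2"] vorticity_off_halfplane[OF F] vorticity_square_integrable[OF F] by auto
  ultimately show ?thesis
    using assms borel_measurable_halfplane[OF vorticity_measurable[OF F]] vorticity_nonneg[OF F]
    by (simp add: admissible_def Lp_2)
qed

text \<open>A Lebesgue measurable function agrees almost everywhere with a Borel one. Clipping the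
  latter at 0 and cutting it off below the boundary enforces sign and support at every point without
  leaving the class.\<close>

lemma admissible_representative:
  assumes \<omega>: "\<omega> \<in> admissible m \<nu>"
  shows "\<exists>F. vorticity F \<and> impulse F = m \<and> mass F \<le> \<nu> \<and> (AE x in halfplane_measure. \<omega> x = F x)"
proof -
  have [measurable]: "\<omega> \<in> borel_measurable halfplane_measure" and q: "integrable halfplane_measure (\<lambda>x. (\<omega> x)\<^sup>2)"
    and nn: "AE x in halfplane_measure. 0 \<le> \<omega> x" and i: "integrable halfplane_measure (\<lambda>x. snd x * \<omega> x)"
    "(\<integral>x. snd x * \<omega> x \<partial>halfplane_measure) = m" and c: "integrable halfplane_measure \<omega>"
    "(\<integral>x. \<omega> x \<partial>halfplane_measure) \<le> \<nu>"
    using \<omega> by (auto simp: admissible_def Lp_2)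
  have "(\<lambda>x. indicator halfplane x *\<^sub>R \<omega> x) \<in> borel_measurable lebesgue"
    using borel_measurable_restrict_space_iff[OF halfplane_lebesgue, of \<omega>] by simp
  then obtain g where [measurable]: "g \<in> borel_measurable lborel"
    and g: "AE x in lborel. indicator halfplane x *\<^sub>R \<omega> x = g x"
    using completion_ex_borel_measurable_real by blast
  define F where "F = (\<lambda>x. indicator halfplane x * max 0 (g x))"
  have [measurable]: "F \<in> borel_measurable borel" unfolding F_def by measurable
  note [measurable] = borel_measurable_halfplane[OF \<open>F \<in> borel_measurable borel\<close>]
  have ae: "AE x in halfplane_measure. \<omega> x = F x"
    using nn unfolding AE_halfplane
    using g by eventually_elim (auto simp: F_def)
  have off: "F x = 0" if "x \<notin> halfplane" for x using that by (simp add: F_def)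
  have [measurable]: "(\<lambda>x. snd x) \<in> borel_measurable halfplane_measure"
    by (intro borel_measurable_halfplane) simp
  have "integrable halfplane_measure F"
    by (rule integrable_cong_AE_imp[OF c(1)]) (use ae in \<open>auto elim: AE_mp\<close>)
  then have F1: "integrable lborel F" using halfplane_integral(2)[of F] off by simp
  have ae2: "AE x in halfplane_measure. snd x * F x = snd x * \<omega> x" using ae by eventually_elim simp
  have "integrable halfplane_measure (\<lambda>x. snd x * F x)"
    by (rule integrable_cong_AE_imp[OF i(1)]) (use ae2 in \<open>auto elim: AE_mp\<close>)
  then have F2: "integrable lborel (\<lambda>x. snd x * F x)"
    using halfplane_integral(2)[of "\<lambda>x. snd x * F x"] off by simp
  have ae3: "AE x in halfplane_measure. (F x)\<^sup>2 = (\<omega> x)\<^sup>2" using ae by eventually_elim simp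
  have "integrable halfplane_measure (\<lambda>x. (F x)\<^sup>2)"
    by (rule integrable_cong_AE_imp[OF q]) (use ae3 in \<open>auto elim: AE_mp\<close>)
  then have F3: "integrable lborel (\<lambda>x. (F x)\<^sup>2)"
    using halfplane_integral(2)[of "\<lambda>x. (F x)\<^sup>2"] off by simp
  have F: "vorticity F"
    using F1 F2 F3 by (intro vorticityI) (auto simp: F_def halfplane_def)
  have "(\<integral>x. \<omega> x \<partial>halfplane_measure) = (\<integral>x. F x \<partial>halfplane_measure)"
    by (rule integral_cong_AE[OF _ _ ae]) measurable
  then have "mass F \<le> \<nu>" using c(2) halfplane_integral(1)[of F] off by (simp add: mass_def)
  moreover have "(\<integral>x. snd x * F x \<partial>halfplane_measure) = (\<integral>x. snd x * \<omega> x \<partial>halfplane_measure)"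
    by (rule integral_cong_AE[OF _ _ ae2]) measurable
  then have "impulse F = m" using i(2) halfplane_integral(1)[of "\<lambda>x. snd x * F x"] off by (simp add: impulse_def)
  ultimately show ?thesis using F ae by blast
qed

section \<open>Minimizing sequences\<close>

text \<open>The supremum over Borel representatives is finite by \<open>penalized_le\<close>, with
  mass plus impulse at most \<open>\<nu> + \<mu>\<close>, and positive by the explicit square. This
  makes the extended real infimum an ordinary number, and representatives transfer the two
  inequalities.\<close>

lemma min_value_variational:
  assumes "0 < \<mu>" "0 < \<nu>" "0 < l"
  shows "\<exists>S. variational \<mu> \<nu> l S \<and> min_value \<mu> \<nu> l = ereal (- S)"
proof -
  define A where "A = {penalized l f | f. vorticity f \<and> impulse f = \<mu> \<and> mass f \<le> \<nu>}"
  define M where "M = \<nu> + \<mu>"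
  have M: "0 < M" using assms by (simp add: M_def)
  have bdd: "bdd_above A"
  proof (rule bdd_aboveI)
    fix p assume "p \<in> A"
    then obtain f where f: "vorticity f" "impulse f = \<mu>" "mass f \<le> \<nu>" "p = penalized l f" by (auto simp: A_def)
    have "0 \<le> enstrophy f / (4 * l)" using enstrophy_nonneg[of f] assms by simp
    then show "p \<le> (8 * l * M + M) * M / 2"
      using penalized_le[OF f(1) assms(3) _ M] f by (simp add: M_def)
  qed
  obtain f0 where f0: "vorticity f0" "impulse f0 = \<mu>" "mass f0 \<le> \<nu>" "0 < penalized l f0"
    using exists_positive_energy[OF assms] by (elim exE conjE)
  then have "penalized l f0 \<in> A" by (auto simp: A_def)
  define S where "S = Sup A"
  have upper: "penalized l f \<le> S" if "vorticity f" "impulse f = \<mu>" "mass f \<le> \<nu>" for f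
    unfolding S_def by (rule cSup_upper[OF _ bdd]) (use that in \<open>auto simp: A_def\<close>)
  have "variational \<mu> \<nu> l S"
    using assms upper f0 by unfold_locales (auto intro: less_le_trans[OF f0(4) upper])
  moreover have "min_value \<mu> \<nu> l = ereal (- S)"
  proof (rule antisym)
    show "ereal (- S) \<le> min_value \<mu> \<nu> l"
      unfolding min_value_def
    proof (rule INF_greatest)
      fix \<omega> assume "\<omega> \<in> admissible \<mu> \<nu>"
      moreover from this obtain F where F: "vorticity F" "impulse F = \<mu>" "mass F \<le> \<nu>" "AE x in halfplane_measure. \<omega> x = F x"
        using admissible_representative by blast
      ultimately have "penalized_energy l \<omega> = penalized l F"
        by (intro penalized_representative) (auto simp: admissible_def Lp_2)
      then show "ereal (- S) \<le> ereal (- penalized_energy l \<omega>)" using upper F by simp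
    qed
    show "min_value \<mu> \<nu> l \<le> ereal (- S)"
    proof (rule ccontr)
      assume "\<not> min_value \<mu> \<nu> l \<le> ereal (- S)"
      then have "ereal (- S) < min_value \<mu> \<nu> l" by (simp only: not_le)
      from ereal_dense2[OF this] obtain r where r: "ereal (- S) < ereal r" "ereal r < min_value \<mu> \<nu> l"
        by blast
      then have "- r < S" by simp
      then obtain p where p: "p \<in> A" "- r < p"
        unfolding S_def using less_cSup_iff[OF _ bdd] \<open>penalized l f0 \<in> A\<close> by blast
      then obtain f where f: "vorticity f" "impulse f = \<mu>" "mass f \<le> \<nu>" "p = penalized l f" by (auto simp: A_def)
      have "penalized_energy l f = penalized l f"
        by (intro penalized_representative f borel_measurable_halfplane vorticity_measurable) simp
      then have "min_value \<mu> \<nu> l \<le> ereal (- p)"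
        unfolding min_value_def using vorticity_admissible[OF f(1,2,3)] f(4) by (intro INF_lower2[of f]) auto
      also have "\<dots> < ereal r" using p by simp
      finally show False using r by simp
    qed
  qed
  ultimately show ?thesis by blast
qed

text \<open>Translation and change of representative commute up to null sets, so the distances of
  the given functions to a limit are integrals over the plane of their Borel versions. The varying
  impulses \<open>m n\<close> enter only through their limit.\<close>

lemma minimizing_sequence_relatively_compact:
  assumes "variational \<mu> \<nu> l S"
    and \<omega>: "\<And>n. \<omega> n \<in> admissible (m n) \<nu>" and m: "m \<longlonglongrightarrow> \<mu>"
    and p: "(\<lambda>n. penalized_energy l (\<omega> n)) \<longlonglongrightarrow> S"
  shows "(\<exists>y. (\<forall>n. y n \<in> halfplane_boundary) \<and>
      relatively_compactin (Lp_topology 2 halfplane_measure) (range (\<lambda>n x. \<omega> n (x + y n))) \<and>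
      relatively_compactin (Lp_topology 1 halfplane_measure) (range (\<lambda>n x. snd x * \<omega> n (x + y n))))"
    and "\<exists>w. vorticity w \<and> impulse w = \<mu> \<and> mass w \<le> \<nu> \<and> penalized l w = S"
proof -
  interpret variational \<mu> \<nu> l S by fact
  have "\<forall>n. \<exists>F. vorticity F \<and> impulse F = m n \<and> mass F \<le> \<nu> \<and> (AE x in halfplane_measure. \<omega> n x = F x)"
    by (intro allI admissible_representative \<omega>)
  from choice[OF this] obtain F where "\<forall>n. vorticity (F n) \<and> impulse (F n) = m n \<and> mass (F n) \<le> \<nu>
      \<and> (AE x in halfplane_measure. \<omega> n x = F n x)" ..
  then have F: "vorticity (F n)" "impulse (F n) = m n" "mass (F n) \<le> \<nu>" "AE x in halfplane_measure. \<omega> n x = F n x" for n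
    by blast+
  have \<omega>m: "\<omega> n \<in> borel_measurable halfplane_measure" for n
    using \<omega>[of n] by (simp add: admissible_def Lp_2)
  have pF: "penalized_energy l (\<omega> n) = penalized l (F n)" for n
    by (rule penalized_representative[OF F(1) \<omega>m F(4)])
  have "\<exists>a :: nat \<Rightarrow> real. \<forall>s :: nat \<Rightarrow> nat. strict_mono s \<longrightarrow> (\<exists>r w. strict_mono r \<and> vorticity w \<and>
    penalized l w = S \<and> impulse w = \<mu> \<and> mass w \<le> \<nu> \<and>
    (\<lambda>n. \<integral>x. (F (s (r n)) (x + (a (s (r n)), 0)) - w x)\<^sup>2 \<partial>lborel) \<longlonglongrightarrow> 0 \<and>
    (\<lambda>n. \<integral>x. \<bar>snd x * F (s (r n)) (x + (a (s (r n)), 0)) - snd x * w x\<bar> \<partial>lborel) \<longlonglongrightarrow> 0)"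
    by (rule maximizing_sequence_compact_up_to_translation) (use F m p in \<open>auto simp: pF\<close>)
  then obtain a :: "nat \<Rightarrow> real" where a: "\<forall>s :: nat \<Rightarrow> nat. strict_mono s \<longrightarrow> (\<exists>r w. strict_mono r \<and> vorticity w \<and>
    penalized l w = S \<and> impulse w = \<mu> \<and> mass w \<le> \<nu> \<and>
    (\<lambda>n. \<integral>x. (F (s (r n)) (x + (a (s (r n)), 0)) - w x)\<^sup>2 \<partial>lborel) \<longlonglongrightarrow> 0 \<and>
    (\<lambda>n. \<integral>x. \<bar>snd x * F (s (r n)) (x + (a (s (r n)), 0)) - snd x * w x\<bar> \<partial>lborel) \<longlonglongrightarrow> 0)" ..
  have "strict_mono (\<lambda>n::nat. n)" by (simp add: strict_mono_def)
  from a[rule_format, OF this] show "\<exists>w. vorticity w \<and> impulse w = \<mu> \<and> mass w \<le> \<nu> \<and> penalized l w = S"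
    by (elim exE conjE) (intro exI conjI)
  define y where "y = (\<lambda>n. (a n, 0 :: real))"
  define U where "U = (\<lambda>n x. F n (x + y n))"
  have U: "vorticity (U n)" for n
    unfolding U_def y_def using vorticity_translate(1)[OF F(1), of 0 n "a n"] by simp
  define V where "V = (\<lambda>n x. \<omega> n (x + y n))"
  have Vm [measurable]: "V n \<in> borel_measurable halfplane_measure" for n
    unfolding V_def y_def by (rule measurable_compose[OF translate_measurable_halfplane \<omega>m])
  have VU: "AE x in halfplane_measure. V n x = U n x" for n
  proof -
    have "AE x in lborel. x + y n \<in> halfplane \<longrightarrow> \<omega> n (x + y n) = F n (x + y n)"
      using F(4)[of n] unfolding AE_halfplane by (rule AE_lborel_translate)
    then show ?thesis
      unfolding AE_halfplane by eventually_elim (auto simp: V_def U_def y_def halfplane_def)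
  qed
  have [measurable]: "(\<lambda>x. snd x) \<in> borel_measurable halfplane_measure"
    by (intro borel_measurable_halfplane) simp
  have UM: "U n \<in> borel_measurable halfplane_measure" for n
    by (intro borel_measurable_halfplane vorticity_measurable U)
  note [measurable] = UM
  have V2: "V n \<in> Lp 2 halfplane_measure" for n
  proof -
    have i: "integrable halfplane_measure (\<lambda>x. (U n x)\<^sup>2)"
      using vorticity_admissible[OF U refl order_refl, of n] by (simp add: admissible_def Lp_2)
    have "AE x in halfplane_measure. (U n x)\<^sup>2 = (V n x)\<^sup>2" using VU[of n] by eventually_elim simp
    then have "integrable halfplane_measure (\<lambda>x. (V n x)\<^sup>2)"
      by (rule integrable_cong_AE_imp[OF i, rotated]) measurable
    then show ?thesis by (simp add: Lp_2)
  qed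
  have V1: "(\<lambda>x. snd x * V n x) \<in> Lp 1 halfplane_measure" for n
  proof -
    have i: "integrable halfplane_measure (\<lambda>x. snd x * U n x)"
      using vorticity_admissible[OF U refl order_refl, of n] by (simp add: admissible_def)
    have "AE x in halfplane_measure. snd x * U n x = snd x * V n x" using VU[of n] by eventually_elim simp
    then have "integrable halfplane_measure (\<lambda>x. snd x * V n x)"
      by (rule integrable_cong_AE_imp[OF i, rotated]) measurable
    then show ?thesis by (simp only: Lp_1)
  qed
  have N2: "Lp_norm 2 halfplane_measure (\<lambda>x. V n x - w x) = sqrt (\<integral>x. (U n x - w x)\<^sup>2 \<partial>lborel)"
    if w: "vorticity w" for n w
  proof -
    note [measurable] = vorticity_measurable[OF w] borel_measurable_halfplane[OF vorticity_measurable[OF w]]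
      vorticity_measurable[OF U]
    have "(\<integral>x. (V n x - w x)\<^sup>2 \<partial>halfplane_measure) = (\<integral>x. (U n x - w x)\<^sup>2 \<partial>halfplane_measure)"
    proof (rule integral_cong_AE)
      show "AE x in halfplane_measure. (V n x - w x)\<^sup>2 = (U n x - w x)\<^sup>2" using VU[of n] by eventually_elim simp
    qed measurable
    also have "\<dots> = (\<integral>x. (U n x - w x)\<^sup>2 \<partial>lborel)"
      by (rule halfplane_integral) (auto simp: vorticity_off_halfplane[OF w] vorticity_off_halfplane[OF U])
    finally show ?thesis by (simp add: Lp_norm_2)
  qed
  have N1: "Lp_norm 1 halfplane_measure (\<lambda>x. snd x * V n x - snd x * w x) = (\<integral>x. \<bar>snd x * U n x - snd x * w x\<bar> \<partial>lborel)"
    if w: "vorticity w" for n w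
  proof -
    note [measurable] = vorticity_measurable[OF w] borel_measurable_halfplane[OF vorticity_measurable[OF w]]
      vorticity_measurable[OF U]
    have "(\<integral>x. \<bar>snd x * V n x - snd x * w x\<bar> \<partial>halfplane_measure) = (\<integral>x. \<bar>snd x * U n x - snd x * w x\<bar> \<partial>halfplane_measure)"
    proof (rule integral_cong_AE)
      show "AE x in halfplane_measure. \<bar>snd x * V n x - snd x * w x\<bar> = \<bar>snd x * U n x - snd x * w x\<bar>"
        using VU[of n] by eventually_elim simp
    qed measurable
    also have "\<dots> = (\<integral>x. \<bar>snd x * U n x - snd x * w x\<bar> \<partial>lborel)"
      by (rule halfplane_integral) (auto simp: vorticity_off_halfplane[OF w] vorticity_off_halfplane[OF U])
    finally show ?thesis by (simp only: Lp_norm_1)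
  qed
  have "relatively_compactin (Lp_topology 2 halfplane_measure) (range V)"
  proof (rule relatively_compactin_Lp_topology[OF Lp_norm_2_triangle V2])
    fix s :: "nat \<Rightarrow> nat" assume "strict_mono s"
    from a[rule_format, OF this] obtain r w where rw: "strict_mono r" "vorticity w" "impulse w = \<mu>" "mass w \<le> \<nu>"
      "(\<lambda>n. \<integral>x. (U (s (r n)) x - w x)\<^sup>2 \<partial>lborel) \<longlonglongrightarrow> 0"
      unfolding U_def y_def by (elim exE conjE)
    have "w \<in> Lp 2 halfplane_measure"
      using vorticity_admissible[OF rw(2,3,4)] by (simp add: admissible_def)
    moreover have "(\<lambda>n. Lp_norm 2 halfplane_measure (\<lambda>x. V (s (r n)) x - w x)) \<longlonglongrightarrow> 0"
      unfolding N2[OF rw(2)] using tendsto_real_sqrt[OF rw(5)] by simp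
    ultimately show "\<exists>r g. strict_mono r \<and> g \<in> Lp 2 halfplane_measure \<and>
        (\<lambda>n. Lp_norm 2 halfplane_measure (\<lambda>x. V (s (r n)) x - g x)) \<longlonglongrightarrow> 0"
      using rw(1) by blast
  qed
  moreover have "relatively_compactin (Lp_topology 1 halfplane_measure) (range (\<lambda>n x. snd x * V n x))"
  proof (rule relatively_compactin_Lp_topology[OF Lp_norm_1_triangle V1])
    fix s :: "nat \<Rightarrow> nat" assume "strict_mono s"
    from a[rule_format, OF this] obtain r w where rw: "strict_mono r" "vorticity w" "impulse w = \<mu>" "mass w \<le> \<nu>"
      "(\<lambda>n. \<integral>x. \<bar>snd x * U (s (r n)) x - snd x * w x\<bar> \<partial>lborel) \<longlonglongrightarrow> 0"
      unfolding U_def y_def by (elim exE conjE)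
    have "(\<lambda>x. snd x * w x) \<in> Lp 1 halfplane_measure"
      using vorticity_admissible[OF rw(2,3,4)] unfolding Lp_1 by (simp add: admissible_def)
    moreover have "(\<lambda>n. Lp_norm 1 halfplane_measure (\<lambda>x. snd x * V (s (r n)) x - snd x * w x)) \<longlonglongrightarrow> 0"
      unfolding N1[OF rw(2)] by (rule rw(5))
    ultimately show "\<exists>r g. strict_mono r \<and> g \<in> Lp 1 halfplane_measure \<and>
        (\<lambda>n. Lp_norm 1 halfplane_measure (\<lambda>x. snd x * V (s (r n)) x - g x)) \<longlonglongrightarrow> 0"
      using rw(1) by (intro exI[of _ r] exI[of _ "\<lambda>x. snd x * w x"] conjI)
  qed
  moreover have "\<forall>n. y n \<in> halfplane_boundary" by (simp add: y_def halfplane_boundary_def)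
  ultimately show "\<exists>y. (\<forall>n. y n \<in> halfplane_boundary) \<and>
      relatively_compactin (Lp_topology 2 halfplane_measure) (range (\<lambda>n x. \<omega> n (x + y n))) \<and>
      relatively_compactin (Lp_topology 1 halfplane_measure) (range (\<lambda>n x. snd x * \<omega> n (x + y n)))"
    unfolding V_def by (intro exI[of _ y] conjI)
qed

theorem theorem1p3:
  fixes \<mu> \<nu> l :: real
  assumes "0 < \<mu>" and "0 < \<nu>" and "0 < l"
  shows "(\<forall>(\<omega> :: nat \<Rightarrow> real \<times> real \<Rightarrow> real) (m :: nat \<Rightarrow> real).
            (\<forall>n. \<omega> n \<in> admissible (m n) \<nu>) \<longrightarrow>
            m \<longlonglongrightarrow> \<mu> \<longrightarrow>
            (\<lambda>n. ereal (- penalized_energy l (\<omega> n))) \<longlonglongrightarrow> min_value \<mu> \<nu> l \<longrightarrow>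
            (\<exists>y :: nat \<Rightarrow> real \<times> real.
               (\<forall>n. y n \<in> halfplane_boundary) \<and>
               relatively_compactin (Lp_topology 2 halfplane_measure)
                 (range (\<lambda>n x. \<omega> n (x + y n))) \<and>
               relatively_compactin (Lp_topology 1 halfplane_measure)
                 (range (\<lambda>n x. snd x * \<omega> n (x + y n))))) \<and>
         (\<exists>\<omega>\<in>admissible \<mu> \<nu>. ereal (- penalized_energy l \<omega>) = min_value \<mu> \<nu> l)"
proof
  obtain S where S: "variational \<mu> \<nu> l S" and mv: "min_value \<mu> \<nu> l = ereal (- S)"
    using min_value_variational[OF assms] by blast
  have lim: "(\<lambda>n. penalized_energy l (\<omega> n)) \<longlonglongrightarrow> S"
    if "(\<lambda>n. ereal (- penalized_energy l (\<omega> n))) \<longlonglongrightarrow> min_value \<mu> \<nu> l" for \<omega>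
    using that unfolding mv lim_ereal by (rule tendsto_minus_cancel)
  show "\<forall>(\<omega> :: nat \<Rightarrow> real \<times> real \<Rightarrow> real) (m :: nat \<Rightarrow> real).
            (\<forall>n. \<omega> n \<in> admissible (m n) \<nu>) \<longrightarrow>
            m \<longlonglongrightarrow> \<mu> \<longrightarrow>
            (\<lambda>n. ereal (- penalized_energy l (\<omega> n))) \<longlonglongrightarrow> min_value \<mu> \<nu> l \<longrightarrow>
            (\<exists>y :: nat \<Rightarrow> real \<times> real.
               (\<forall>n. y n \<in> halfplane_boundary) \<and>
               relatively_compactin (Lp_topology 2 halfplane_measure)
                 (range (\<lambda>n x. \<omega> n (x + y n))) \<and>
               relatively_compactin (Lp_topology 1 halfplane_measure)
                 (range (\<lambda>n x. snd x * \<omega> n (x + y n))))"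
  proof (intro allI impI)
    fix \<omega> :: "nat \<Rightarrow> real \<times> real \<Rightarrow> real" and m :: "nat \<Rightarrow> real"
    assume "\<forall>n. \<omega> n \<in> admissible (m n) \<nu>" and m: "m \<longlonglongrightarrow> \<mu>"
      and c: "(\<lambda>n. ereal (- penalized_energy l (\<omega> n))) \<longlonglongrightarrow> min_value \<mu> \<nu> l"
    then have "\<And>n. \<omega> n \<in> admissible (m n) \<nu>" by blast
    from minimizing_sequence_relatively_compact(1)[OF S this m lim[OF c]]
    show "\<exists>y :: nat \<Rightarrow> real \<times> real.
               (\<forall>n. y n \<in> halfplane_boundary) \<and>
               relatively_compactin (Lp_topology 2 halfplane_measure)
                 (range (\<lambda>n x. \<omega> n (x + y n))) \<and>
               relatively_compactin (Lp_topology 1 halfplane_measure)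
                 (range (\<lambda>n x. snd x * \<omega> n (x + y n)))" .
  qed
  show "\<exists>\<omega>\<in>admissible \<mu> \<nu>. ereal (- penalized_energy l \<omega>) = min_value \<mu> \<nu> l"
  proof -
    \<comment> \<open>Existence comes from compactness applied to a sequence in the constraint set
      whose values are within \<open>1 / (n + 1)\<close> of the infimum; here the impulses are
      constantly \<mu>.\<close>
    have "\<exists>\<omega>\<in>admissible \<mu> \<nu>. ereal (- penalized_energy l \<omega>) < ereal (- S + inverse (real (Suc n)))" for n
    proof -
      have "min_value \<mu> \<nu> l < ereal (- S + inverse (real (Suc n)))" unfolding mv by simp
      then show ?thesis unfolding min_value_def INF_less_iff .
    qed
    then have "\<forall>n. \<exists>\<omega>. \<omega> \<in> admissible \<mu> \<nu> \<and> - penalized_energy l \<omega> < - S + inverse (real (Suc n))"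
      by (auto simp: Bex_def)
    from choice[OF this] obtain \<omega> where "\<forall>n::nat. \<omega> n \<in> admissible \<mu> \<nu> \<and> - penalized_energy l (\<omega> n) < - S + inverse (real (Suc n))" ..
    then have both: "\<omega> n \<in> admissible \<mu> \<nu> \<and> - penalized_energy l (\<omega> n) < - S + inverse (real (Suc n))" for n
      by (rule spec)
    have \<omega>: "\<omega> n \<in> admissible \<mu> \<nu>" for n by (rule conjunct1[OF both])
    have up: "S - inverse (real (Suc n)) \<le> penalized_energy l (\<omega> n)" for n
      using conjunct2[OF both[of n]] by linarith
    have ub: "penalized_energy l (\<omega> n) \<le> S" for n
    proof -
      have "ereal (- S) \<le> ereal (- penalized_energy l (\<omega> n))"
        unfolding mv[symmetric] min_value_def by (rule INF_lower[OF \<omega>])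
      then show ?thesis by simp
    qed
    have lb: "(\<lambda>n. S - inverse (real (Suc n))) \<longlonglongrightarrow> S"
      using tendsto_diff[OF tendsto_const[of S] LIMSEQ_inverse_real_of_nat] by simp
    have "(\<lambda>n. penalized_energy l (\<omega> n)) \<longlonglongrightarrow> S"
      by (rule tendsto_sandwich[OF always_eventually[OF allI[OF up]] always_eventually[OF allI[OF ub]] lb tendsto_const])
    from minimizing_sequence_relatively_compact(2)[OF S \<omega> tendsto_const this]
    obtain w where w: "vorticity w" "impulse w = \<mu>" "mass w \<le> \<nu>" "penalized l w = S" by (elim exE conjE)
    have "penalized_energy l w = S"
      unfolding w(4)[symmetric]
      by (intro penalized_representative w borel_measurable_halfplane vorticity_measurable) simp
    then show ?thesis unfolding mv using vorticity_admissible[OF w(1,2,3)] by blast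
  qed
qed

end
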